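(* Let $p$ be a prime and let $\sigma,\sigma'$ denote injective group homomorphisms $\bar{\mathbb F}_p^\times\to\mathbb Q/\mathbb Z$; let $\pi_\sigma$ be the associated representation of $\mathcal H_{\mathbb Z}$ on $\mathbb W(\bar{\mathbb F}_p)\simeq\mathcal O^{I(p)}$. (1) The restriction $\pi_\sigma|_{\mathcal H_{\mathbb Z}^{(p)}}$ of $\pi_\sigma$ to $\mathcal H_{\mathbb Z}^{(p)}$ is $\mathcal O$-linear and indecomposable over $\mathcal O$. (2) The ($\mathcal O$-linear) representations $\pi_\sigma|_{\mathcal H_{\mathbb Z}^{(p)}}$, for distinct $\sigma$, are pairwise inequivalent. (3) The representation $\pi_\sigma$ is linear and indecomposable over $\mathbb Z_p$. (4) Two representations $\pi_\sigma$ and $\pi_{\sigma'}$ are equivalent over $\mathbb Z_p$ if and only if there exists $\alpha\in\mathrm{Aut}(\bar{\mathbb F}_p)$ such that $\sigma'=\sigma\circ\alpha$.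
   Context: $\mathbb N$ is the set of positive integers; $I(p)\subset\mathbb N$ the positive integers prime to $p$; $(\mathbb Q/\mathbb Z)^{(p)}\subset\mathbb Q/\mathbb Z$ the subgroup of fractions with denominator prime to $p$ (the image of any injective group homomorphism $\sigma:\bar{\mathbb F}_p^\times\to\mathbb Q/\mathbb Z$). \textbf{BC-algebra.} $\mathbb Z[\mathbb Q/\mathbb Z]$ has generators $e(\gamma)$. Let $\sigma_n(e(\gamma))=e(n\gamma)$, $\tilde\rho_n(e(\gamma))=\sum_{n\gamma'=\gamma}e(\gamma')$. $\mathcal H_{\mathbb Z}$ is the ring generated by $\mathbb Z[\mathbb Q/\mathbb Z]$ and $\tilde\mu_n,\mu_n^*$ ($n\in\mathbb N$) with relations $\tilde\mu_n x\mu_n^*=\tilde\rho_n(x)$, $\mu_n^*x=\sigma_n(x)\mu_n^*$, $x\tilde\mu_n=\tilde\mu_n\sigma_n(x)$, $\tilde\mu_{nm}=\tilde\mu_n\tilde\mu_m$, $\mu_{nm}^*=\mu_n^*\mu_m^*$, $\mu_n^*\tilde\mu_n=n$, and $\tilde\mu_n\mu_m^*=\mu_m^*\tilde\mu_n$ if $\gcd(n,m)=1$. \textbf{The representation.} Let $\mathcal O=\mathbb W_{p^\infty}(\bar{\mathbb F}_p)$ ($p$-typical Witt vectors), the ring of integers of the completion of the maximal unramified extension of $\mathbb Q_p$, $\mathrm{Fr}\in\mathrm{Aut}(\mathcal O)$ the automorphism induced by $x\mapsto x^p$ on $\bar{\mathbb F}_p$, and $\tau:\bar{\mathbb F}_p^\times\to\mathcal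 O^\times$ the Teichmüller lift. The big Witt ring $\mathbb W(\bar{\mathbb F}_p)$ is canonically isomorphic to $\mathcal O^{I(p)}$ (with the product of the $p$-adic topologies), the $n$-th component of $x$ being the $p$-typical Witt vector with components $F_n(x)_{p^k}$, $k\ge 0$. Let $\epsilon_m$ ($m\in I(p)$) be the vector with only non-zero component $\epsilon_m(m)=1$. The representation $\pi_\sigma$ of $\mathcal H_{\mathbb Z}$ on $\mathcal O^{I(p)}$ by continuous additive maps is determined as follows. For $n\in I(p)$ the operators of $\tilde\mu_n$, $\mu_n^*$, and of all $x\in\mathbb Z[\mathbb Q/\mathbb Z]$ are $\mathcal O$-linear and continuous, with $\pi_\sigma(\tilde\mu_n)\epsilon_m=n\,\epsilon_{nm}$; $\pi_\sigma(\mu_n^* )\epsilon_k=\epsilon_{k/n}$ if $n|k$ and $0$ otherwise; $\pi_\sigma(e(\gamma))\epsilon_m=\tau(\sigma^{-1}(\gamma))^m\epsilon_m$ for $\gamma\in(\mathbb Q/\mathbb Z)^{(p)}$; $\pi_\sigma(e(\gamma))=1$ for $\gamma$ of $p$-power order. Moreover $\pi_\sigma(\mu_p^* )=\mathrm{Fr}$ and $\pi_\sigma(\tilde\mu_p)=p\,\mathrm{Fr}^{-1}$, acting componentwise. \textbf{The algebra $\mathcal H_{\mathbb Z}^{(p)}$.} Let $\mathcal J_p\subset\mathcal H_{\mathbb Z}$ be the two-sided ideal generated by the elements $1-e(p^{-k})$, $k\in\mathbb N$; it is contained in $\mathrm{Ker}\,\pi_\sigma$. $\mathcal H_{\mathbb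 Z}^{(p)}$ is the quotient by $\mathcal J_p$ of the subalgebra of $\mathcal H_{\mathbb Z}$ generated by $\mathbb Z[\mathbb Q/\mathbb Z]$, $\tilde\mu_n$, $\mu_n^*$ for $n\in I(p)$; it acts through $\pi_\sigma$. Operators intertwining or commuting with these representations are understood to be continuous and linear over the indicated ring; indecomposable means not a direct sum of two non-zero subrepresentations (with continuous projections). *)

theory Defs
  imports
    "HOL-Analysis.Function_Topology"
    "HOL-Algebra.Algebraic_Closure_Type"
    "HOL-Library.Function_Algebras"
    "HOL-Library.Poly_Mapping"
    "Berlekamp_Zassenhaus.Finite_Field"
begin

lemma poly_mapping_single_sum:
  fixes f :: "'a \<Rightarrow>\<^sub>0 'b::comm_monoid_add"
  shows "(\<Sum>k\<in>Poly_Mapping.keys f. Poly_Mapping.single k (Poly_Mapping.lookup f k)) = f"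
  by (rule poly_mapping_eqI)
     (auto simp: lookup_sum lookup_single when_def sum.delta' in_keys_iff if_distrib cong: if_cong)

lemma poly_mapping_induct_add [case_names zero single add]:
  fixes f :: "'a \<Rightarrow>\<^sub>0 'b::comm_monoid_add"
  assumes "P 0" "\<And>k c. P (Poly_Mapping.single k c)" "\<And>f g. P f \<Longrightarrow> P g \<Longrightarrow> P (f + g)"
  shows "P f"
proof -
  have "P (\<Sum>k\<in>A. Poly_Mapping.single k (Poly_Mapping.lookup f k))" if "finite A" for A
    using that by (induction) (auto intro: assms)
  from this[OF finite_keys[of f]] show ?thesis by (simp add: poly_mapping_single_sum)
qed

text \<open>Polynomials with integer coefficients in variables indexed by \<open>'v\<close>, as finitely supported
  functions on exponent vectors.\<close>

type_synonym 'v zpoly = "('v \<Rightarrow>\<^sub>0 nat) \<Rightarrow>\<^sub>0 int"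

definition zvar :: "'v \<Rightarrow> 'v zpoly" where
  "zvar v = Poly_Mapping.single (Poly_Mapping.single v 1) 1"

definition zeval :: "('v \<Rightarrow> 'a::comm_ring_1) \<Rightarrow> 'v zpoly \<Rightarrow> 'a" where
  "zeval f P = (\<Sum>m\<in>Poly_Mapping.keys P. of_int (Poly_Mapping.lookup P m) * (\<Prod>v\<in>Poly_Mapping.keys m. f v ^ Poly_Mapping.lookup m v))"

definition mono_eval :: "('v \<Rightarrow> 'a::comm_ring_1) \<Rightarrow> ('v \<Rightarrow>\<^sub>0 nat) \<Rightarrow> 'a" where
  "mono_eval f m = (\<Prod>v\<in>Poly_Mapping.keys m. f v ^ Poly_Mapping.lookup m v)"

lemma mono_eval_superset:
  assumes "finite A" "Poly_Mapping.keys m \<subseteq> A"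
  shows "mono_eval f m = (\<Prod>v\<in>A. f v ^ Poly_Mapping.lookup m v)"
  unfolding mono_eval_def by (rule prod.mono_neutral_left) (use assms in \<open>auto simp: in_keys_iff\<close>)

lemma mono_eval_add: "mono_eval f (m + n) = mono_eval f m * mono_eval f n"
proof -
  let ?A = "Poly_Mapping.keys m \<union> Poly_Mapping.keys n"
  have "Poly_Mapping.keys (m + n) \<subseteq> ?A" by (rule keys_add)
  then show ?thesis
    by (simp add: mono_eval_superset[of ?A] lookup_add power_add prod.distrib)
qed

lemma mono_eval_0 [simp]: "mono_eval f 0 = 1"
  by (simp add: mono_eval_def)

lemma zeval_superset:
  assumes "finite A" "Poly_Mapping.keys P \<subseteq> A"
  shows "zeval f P = (\<Sum>m\<in>A. of_int (Poly_Mapping.lookup P m) * mono_eval f m)"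
  unfolding zeval_def mono_eval_def
  by (rule sum.mono_neutral_left) (use assms in \<open>auto simp: in_keys_iff\<close>)

lemma zeval_add: "zeval f (P + Q) = zeval f P + zeval f Q"
proof -
  let ?A = "Poly_Mapping.keys P \<union> Poly_Mapping.keys Q"
  have "Poly_Mapping.keys (P + Q) \<subseteq> ?A" by (rule keys_add)
  then show ?thesis
    by (simp add: zeval_superset[of ?A] lookup_add sum.distrib distrib_right)
qed

lemma zeval_0 [simp]: "zeval f 0 = 0"
  by (simp add: zeval_def)

lemma zeval_single: "zeval f (Poly_Mapping.single m c) = of_int c * mono_eval f m"
  by (subst zeval_superset[of "{m}"]) (auto)

lemma zeval_mult: "zeval f (P * Q) = zeval f P * zeval f Q"
proof (induction P rule: poly_mapping_induct_add)
  case (single k c)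
  show ?case
    by (induction Q rule: poly_mapping_induct_add)
       (simp_all add: distrib_left zeval_add mult_single zeval_single mono_eval_add)
qed (simp_all add: distrib_right zeval_add)

lemma zeval_1 [simp]: "zeval f 1 = 1"
  by (simp add: zeval_single flip: single_one)

lemma zeval_var [simp]: "zeval f (zvar v) = f v"
  by (simp add: zvar_def zeval_single mono_eval_def)

locale rhom =
  fixes h :: "'a::comm_ring_1 \<Rightarrow> 'b::comm_ring_1"
  assumes add: "h (x + y) = h x + h y" and mult: "h (x * y) = h x * h y" and one: "h 1 = 1"
begin

lemma zero: "h 0 = 0" using add[of 0 0] by simp
lemma uminus: "h (- x) = - h x" using add[of x "-x"] by (simp add: zero add_eq_0_iff)
lemma diff: "h (x - y) = h x - h y" using add[of x "-y"] by (simp add: uminus)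
lemma power: "h (x ^ n) = h x ^ n" by (induction n) (auto simp: one mult)
lemma of_nat: "h (of_nat n) = of_nat n" by (induction n) (auto simp: zero one add)
lemma of_int: "h (of_int n) = of_int n" by (cases n rule: int_diff_cases) (auto simp: diff of_nat)
lemma sum: "h (sum f A) = (\<Sum>x\<in>A. h (f x))"
  by (induction A rule: infinite_finite_induct) (auto simp: zero add)
lemma prod: "h (prod f A) = (\<Prod>x\<in>A. h (f x))"
  by (induction A rule: infinite_finite_induct) (auto simp: one mult)
lemma zeval: "h (zeval f P) = zeval (\<lambda>v. h (f v)) P"
  by (simp add: zeval_def sum mult of_int prod power)
end

lemma rhom_zeval: "rhom (zeval f)"
  by standard (simp_all add: zeval_add zeval_mult)

lemma zeval_zvar [simp]: "zeval zvar P = P"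
proof (induction P rule: poly_mapping_induct_add)
  case (single m c)
  have *: "zvar v ^ n = Poly_Mapping.single (Poly_Mapping.single v n) 1" for v :: 'a and n
    by (induction n) (auto simp: zvar_def mult_single single_add[symmetric])
  have "(\<Prod>v\<in>A. zvar v ^ Poly_Mapping.lookup m v) =
      Poly_Mapping.single (\<Sum>v\<in>A. Poly_Mapping.single v (Poly_Mapping.lookup m v)) 1" if "finite A" for A
    using that by induction (auto simp: mult_single *)
  from this[OF finite_keys[of m]] have "mono_eval zvar m = Poly_Mapping.single m 1"
    by (simp add: mono_eval_def poly_mapping_single_sum)
  then show ?case
    by (simp add: zeval_single mult_single flip: single_of_int)
qed (simp_all add: zeval_add)

lemma zpoly_torsion_free:
  fixes P :: "'v zpoly"
  assumes "of_nat n * P = 0" "n > 0"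
  shows "P = 0"
proof (rule poly_mapping_eqI)
  fix m
  have "Poly_Mapping.lookup (of_nat n * P) m = int n * Poly_Mapping.lookup P m" for P :: "'v zpoly"
    by (induction P rule: poly_mapping_induct_add)
       (auto simp: distrib_left lookup_add mult_single lookup_single when_def simp flip: single_of_nat)
  with assms show "Poly_Mapping.lookup P m = Poly_Mapping.lookup 0 m" by (metis lookup_zero mult_eq_0_iff of_nat_eq_0_iff less_numeral_extra(3))
qed

text \<open>The ghost components (Witt polynomials) for the prime \<open>p\<close>.\<close>

definition ghost :: "nat \<Rightarrow> (nat \<Rightarrow> 'a::comm_ring_1) \<Rightarrow> nat \<Rightarrow> 'a" where
  "ghost p x n = (\<Sum>i\<le>n. of_nat (p ^ i) * x i ^ (p ^ (n - i)))"

lemma (in rhom) ghost: "h (ghost p x n) = ghost p (\<lambda>i. h (x i)) n"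
  by (simp add: ghost_def sum mult of_nat power)

lemma ghost_split: "ghost p x n = (\<Sum>i<n. of_nat (p ^ i) * x i ^ (p ^ (n - i))) + of_nat (p ^ n) * x n"
  unfolding ghost_def by (simp add: lessThan_Suc_atMost[symmetric])

lemma ghost_inj:
  fixes x y :: "nat \<Rightarrow> 'v zpoly"
  assumes "p > 0" "\<And>n. ghost p x n = ghost p y n"
  shows "x = y"
proof
  fix n show "x n = y n"
  proof (induction n rule: less_induct)
    case (less n)
    have "(\<Sum>i<n. of_nat (p ^ i) * x i ^ (p ^ (n - i))) = (\<Sum>i<n. of_nat (p ^ i) * y i ^ (p ^ (n - i)))"
      by (rule sum.cong) (auto simp: less)
    with assms(2)[of n] have "of_nat (p ^ n) * x n = of_nat (p ^ n) * y n"
      by (simp add: ghost_split)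
    then have "of_nat (p ^ n) * (x n - y n) = 0" by (simp add: right_diff_distrib)
    then have "x n - y n = 0" by (rule zpoly_torsion_free) (use assms(1) in simp)
    then show ?case by simp
  qed
qed

lemma dvd_power_diff_p:
  fixes x y :: "'a::comm_ring_1"
  assumes "of_nat (p ^ Suc j) dvd x - y"
  shows "of_nat (p ^ Suc (Suc j)) dvd x ^ p - y ^ p"
proof -
  have p: "of_nat p dvd x - y"
    using assms by (rule dvd_trans[rotated]) (simp)
  have "of_nat p dvd (\<Sum>i<p. y ^ (p - Suc i) * x ^ i)"
  proof -
    have *: "of_nat p dvd x ^ i - y ^ i" for i
      using p by (rule dvd_trans) (simp add: power_diff_sumr2)
    have "(\<Sum>i<p. y ^ (p - Suc i) * x ^ i) =
        (\<Sum>i<p. y ^ (p - Suc i) * (x ^ i - y ^ i)) + (\<Sum>i<p. y ^ (p - Suc i) * y ^ i)"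
      by (simp add: sum.distrib[symmetric] algebra_simps)
    also have "(\<Sum>i<p. y ^ (p - Suc i) * y ^ i) = of_nat p * y ^ (p - 1)"
      by (simp flip: power_add)
    also have "of_nat p dvd (\<Sum>i<p. y ^ (p - Suc i) * (x ^ i - y ^ i)) + of_nat p * y ^ (p - 1)"
      by (intro dvd_add dvd_sum dvd_triv_left) (auto intro: dvd_mult *)
    finally show ?thesis .
  qed
  then have "of_nat (p ^ Suc j) * of_nat p dvd (x - y) * (\<Sum>i<p. y ^ (p - Suc i) * x ^ i)"
    using assms by (rule mult_dvd_mono[rotated])
  then show ?thesis by (simp add: power_diff_sumr2 mult.commute mult.left_commute)
qed

lemma dvd_power_diff:
  fixes x y :: "'a::comm_ring_1"
  assumes "of_nat p dvd x - y"
  shows "of_nat (p ^ Suc k) dvd x ^ (p ^ k) - y ^ (p ^ k)"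
proof (induction k)
  case (Suc k)
  from dvd_power_diff_p[OF this] show ?case by (simp add: power_mult[symmetric] mult.commute)
qed (use assms in simp)

definition frob_lift :: "nat \<Rightarrow> 'v zpoly \<Rightarrow> 'v zpoly" where
  "frob_lift p = zeval (\<lambda>v. zvar v ^ p)"

lemma rhom_frob_lift: "rhom (frob_lift p)"
  unfolding frob_lift_def by (rule rhom_zeval)

lemma prime_dvd_add_power:
  fixes x y :: "'a::comm_ring_1"
  assumes "prime p"
  shows "of_nat p dvd (x + y) ^ p - (x ^ p + y ^ p)"
proof -
  have p: "p > 0" using assms by (simp add: prime_gt_0_nat)
  have "{..p} = insert 0 (insert p {0<..<p})" using p by auto
  then have "(x + y) ^ p = x ^ p + y ^ p + (\<Sum>k\<in>{0<..<p}. of_nat (p choose k) * x ^ k * y ^ (p - k))"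
    using p by (simp add: binomial_ring)
  moreover have "of_nat p dvd (\<Sum>k\<in>{0<..<p}. of_nat (p choose k) * x ^ k * y ^ (p - k))"
  proof (intro dvd_sum dvd_mult2)
    fix k assume "k \<in> {0<..<p}"
    then have "p dvd p choose k" using assms by (intro dvd_choose_prime) auto
    then show "(of_nat p :: 'a) dvd of_nat (p choose k)" by (metis dvd_def of_nat_mult)
  qed
  ultimately show ?thesis by simp
qed

lemma int_fermat: "prime p \<Longrightarrow> int p dvd c ^ p - c"
proof (induction c rule: int_induct[where k=0])
  case base then show ?case by (simp add: prime_gt_0_nat power_0_left)
next
  case (step1 i)
  have "int p dvd ((i + 1) ^ p - (i ^ p + 1 ^ p)) + (i ^ p - i)"
    by (rule dvd_add) (use step1 prime_dvd_add_power[of p i 1] in auto)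
  then show ?case by (simp add: algebra_simps)
next
  case (step2 i)
  have "int p dvd (i ^ p - i) - ((i - 1 + 1) ^ p - ((i - 1) ^ p + 1 ^ p))"
    by (rule dvd_diff) (use step2 prime_dvd_add_power[of p "i - 1" 1] in auto)
  then show ?case by (simp add: algebra_simps)
qed

lemma frob_lift_cong:
  assumes p: "prime p"
  shows "of_nat p dvd frob_lift p P - P ^ p"
proof (induction P rule: poly_mapping_induct_add)
  case zero
  show ?case using p by (simp add: frob_lift_def prime_gt_0_nat power_0_left)
next
  case (add f g)
  have "frob_lift p (f + g) - (f + g) ^ p =
     (frob_lift p f - f ^ p) + (frob_lift p g - g ^ p) - ((f + g) ^ p - (f ^ p + g ^ p))"
    by (simp add: rhom.add[OF rhom_frob_lift])
  then show ?case using add prime_dvd_add_power[OF p, of f g] by (metis dvd_add dvd_diff)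
next
  case (single m c)
  have e: "Poly_Mapping.single m c = of_int c * mono_eval zvar m"
    by (metis zeval_single zeval_zvar)
  have m: "frob_lift p (mono_eval zvar m) = mono_eval zvar m ^ p"
    by (simp add: mono_eval_def rhom.prod[OF rhom_frob_lift] rhom.power[OF rhom_frob_lift]
        prod_power_distrib) (simp add: frob_lift_def mult.commute flip: power_mult)
  have "frob_lift p (Poly_Mapping.single m c) - Poly_Mapping.single m c ^ p =
      - (of_int (c ^ p - c) * mono_eval zvar m ^ p)"
    by (simp add: e rhom.mult[OF rhom_frob_lift] rhom.of_int[OF rhom_frob_lift] m algebra_simps)
  moreover have "(of_nat p :: 'a zpoly) dvd of_int (c ^ p - c)"
    using int_fermat[OF p, of c] by (metis dvd_def of_int_mult of_int_of_nat_eq)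
  ultimately show ?case by simp
qed

lemma dwork:
  fixes g :: "nat \<Rightarrow> 'v zpoly"
  assumes p: "prime p" and g: "\<And>n. of_nat (p ^ Suc n) dvd g (Suc n) - frob_lift p (g n)"
  shows "\<exists>!S. \<forall>n. ghost p S n = g n"
proof -
  define Q where "Q S n s \<longleftrightarrow> of_nat (p ^ n) * s = g n - (\<Sum>i<n. of_nat (p ^ i) * S i ^ (p ^ (n - i)))"
    for S :: "nat \<Rightarrow> 'v zpoly" and n and s
  have Qg: "Q S n (S n) \<longleftrightarrow> ghost p S n = g n" for S n
    by (auto simp: Q_def ghost_split algebra_simps)
  have "\<exists>S. \<forall>n. Q S n (S n)"
  proof (rule dependent_wf_choice[OF wf_less])
    fix S S' :: "nat \<Rightarrow> 'v zpoly" and n r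
    assume "\<And>z. (z, n) \<in> {(x, y). x < y} \<Longrightarrow> S z = S' z"
    then show "Q S n r = Q S' n r" by (simp add: Q_def)
  next
    fix n and S :: "nat \<Rightarrow> 'v zpoly"
    assume IH: "\<And>y. (y, n) \<in> {(x, y). x < y} \<Longrightarrow> Q S y (S y)"
    show "\<exists>r. Q S n r"
    proof (cases n)
      case 0 then show ?thesis by (simp add: Q_def)
    next
      case (Suc m)
      have gm: "g m = ghost p S m" using IH[of m] by (simp add: Suc Qg)
      have "of_nat (p ^ n) dvd of_nat (p ^ i) * frob_lift p (S i) ^ (p ^ (m - i)) - of_nat (p ^ i) * S i ^ (p ^ (n - i))"
        if "i \<le> m" for i
      proof -
        have "of_nat (p ^ Suc (m - i)) dvd frob_lift p (S i) ^ (p ^ (m - i)) - (S i ^ p) ^ (p ^ (m - i))"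
          by (rule dvd_power_diff) (rule frob_lift_cong[OF p])
        then have "of_nat (p ^ i) * of_nat (p ^ Suc (m - i)) dvd
            of_nat (p ^ i) * (frob_lift p (S i) ^ (p ^ (m - i)) - (S i ^ p) ^ (p ^ (m - i)))"
          by (rule mult_dvd_mono[OF dvd_refl])
        also have "of_nat (p ^ i) * of_nat (p ^ Suc (m - i)) = (of_nat (p ^ n) :: 'v zpoly)"
          using that by (simp add: Suc flip: of_nat_mult power_add of_nat_power power_Suc)
        also have "(S i ^ p) ^ (p ^ (m - i)) = S i ^ (p ^ (n - i))"
          using that by (simp add: Suc Suc_diff_le power_mult)
        finally show ?thesis by (simp add: right_diff_distrib)
      qed
      then have "of_nat (p ^ n) dvd (\<Sum>i\<le>m. of_nat (p ^ i) * frob_lift p (S i) ^ (p ^ (m - i)) - of_nat (p ^ i) * S i ^ (p ^ (n - i)))"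
        by (intro dvd_sum) auto
      moreover have "(\<Sum>i\<le>m. of_nat (p ^ i) * frob_lift p (S i) ^ (p ^ (m - i)) - of_nat (p ^ i) * S i ^ (p ^ (n - i))) =
         frob_lift p (g m) - (\<Sum>i<n. of_nat (p ^ i) * S i ^ (p ^ (n - i)))"
        unfolding gm rhom.ghost[OF rhom_frob_lift] by (simp add: ghost_def sum_subtractf Suc lessThan_Suc_atMost)
      moreover have "of_nat (p ^ n) dvd g n - frob_lift p (g m)" using g[of m] by (simp add: Suc)
      ultimately have "of_nat (p ^ n) dvd (g n - frob_lift p (g m)) +
          (frob_lift p (g m) - (\<Sum>i<n. of_nat (p ^ i) * S i ^ (p ^ (n - i))))"
        by (intro dvd_add) simp_all
      then have "of_nat (p ^ n) dvd g n - (\<Sum>i<n. of_nat (p ^ i) * S i ^ (p ^ (n - i)))"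
        by simp
      then show ?thesis unfolding Q_def dvd_def by metis
    qed
  qed
  then show ?thesis
    unfolding Qg
  proof (elim exE, intro ex1I)
    fix S S' :: "nat \<Rightarrow> 'v zpoly"
    assume S: "\<forall>n. ghost p S n = g n"
    then show "\<forall>n. ghost p S n = g n" .
    assume "\<forall>n. ghost p S' n = g n"
    with S show "S' = S" by (intro ghost_inj[OF prime_gt_0_nat[OF p]]) simp
  qed
qed

lemma ghost_zvar_frob:
  "\<exists>t. ghost p (\<lambda>i. zvar (f i)) (Suc n) =
     frob_lift p (ghost p (\<lambda>i. zvar (f i)) n) + of_nat (p ^ Suc n) * t"
proof
  show "ghost p (\<lambda>i. zvar (f i)) (Suc n) =
     frob_lift p (ghost p (\<lambda>i. zvar (f i)) n) + of_nat (p ^ Suc n) * zvar (f (Suc n))"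
    by (subst ghost_split, subst rhom.ghost[OF rhom_frob_lift])
       (simp add: ghost_def lessThan_Suc_atMost frob_lift_def Suc_diff_le flip: power_mult)
qed

text \<open>\<open>witt_poly p g\<close> is the unique sequence of integer polynomials whose ghost components are \<open>g\<close>.
  It exists whenever \<open>g\<close> satisfies Dwork's congruences (lemma \<open>dwork\<close> above), in particular for the
  sum, product and negative of ghost components of indeterminates.\<close>

definition witt_poly :: "nat \<Rightarrow> (nat \<Rightarrow> 'v zpoly) \<Rightarrow> nat \<Rightarrow> 'v zpoly" where
  "witt_poly p g = (THE S. \<forall>n. ghost p S n = g n)"

definition XX :: "nat \<Rightarrow> (nat + nat) zpoly" where "XX = (\<lambda>i. zvar (Inl i))"
definition YY :: "nat \<Rightarrow> (nat + nat) zpoly" where "YY = (\<lambda>i. zvar (Inr i))"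

definition "add_poly p = witt_poly p (\<lambda>n. ghost p XX n + ghost p YY n)"
definition "mul_poly p = witt_poly p (\<lambda>n. ghost p XX n * ghost p YY n)"
definition "neg_poly p = witt_poly p (\<lambda>n. - ghost p zvar n)"

lemma ghost_witt_poly:
  assumes "prime p" "\<And>n. of_nat (p ^ Suc n) dvd g (Suc n) - frob_lift p (g n)"
  shows "ghost p (witt_poly p g) n = g n"
  using theI'[OF dwork[OF assms]] by (auto simp: witt_poly_def)

lemma dvd_frob_diff:
  fixes a b a' b' q :: "'a::comm_ring_1"
  assumes "\<exists>s. a = a' + q * s" "\<exists>t. b = b' + q * t"
  shows "q dvd (a + b) - (a' + b')" "q dvd a * b - a' * b'" "q dvd - a - (- a')"
proof -
  obtain s t where st: "a = a' + q * s" "b = b' + q * t" using assms by blast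
  have "(a + b) - (a' + b') = q * (s + t)" "a * b - a' * b' = q * (s * b' + a' * t + q * s * t)"
    "- a - (- a') = q * (- s)"
    unfolding st by (simp_all add: algebra_simps)
  then show "q dvd (a + b) - (a' + b')" "q dvd a * b - a' * b'" "q dvd - a - (- a')"
    by (metis dvd_triv_left)+
qed

lemma ghost_add_poly:
  assumes "prime p" shows "ghost p (add_poly p) n = ghost p XX n + ghost p YY n"
  unfolding add_poly_def
proof (rule ghost_witt_poly[OF assms])
  show "of_nat (p ^ Suc n) dvd ghost p XX (Suc n) + ghost p YY (Suc n) - frob_lift p (ghost p XX n + ghost p YY n)" for n
    unfolding rhom.add[OF rhom_frob_lift] XX_def YY_def
    by (rule dvd_frob_diff(1)[OF ghost_zvar_frob ghost_zvar_frob])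
qed

lemma ghost_mul_poly:
  assumes "prime p" shows "ghost p (mul_poly p) n = ghost p XX n * ghost p YY n"
  unfolding mul_poly_def
proof (rule ghost_witt_poly[OF assms])
  show "of_nat (p ^ Suc n) dvd ghost p XX (Suc n) * ghost p YY (Suc n) - frob_lift p (ghost p XX n * ghost p YY n)" for n
    unfolding rhom.mult[OF rhom_frob_lift] XX_def YY_def
    by (rule dvd_frob_diff(2)[OF ghost_zvar_frob ghost_zvar_frob])
qed

lemma ghost_neg_poly:
  assumes "prime p" shows "ghost p (neg_poly p) n = - ghost p zvar n"
  unfolding neg_poly_def
proof (rule ghost_witt_poly[OF assms])
  show "of_nat (p ^ Suc n) dvd - ghost p zvar (Suc n) - frob_lift p (- ghost p zvar n)" for n
    unfolding rhom.uminus[OF rhom_frob_lift]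
    by (rule dvd_frob_diff(3)[OF ghost_zvar_frob[where f="\<lambda>i. i"] ghost_zvar_frob[where f="\<lambda>i. i"]])
qed

text \<open>The ring of \<open>p\<close>-typical Witt vectors over \<open>'k\<close>, where \<open>p = CARD('p)\<close> is carried by a phantom
  type argument.\<close>

datatype ('p, 'k) witt = Witt (wcoord: "nat \<Rightarrow> 'k")

instantiation witt :: (prime_card, comm_ring_1) "{zero, one, plus, minus, uminus, times}"
begin
definition "0 = Witt (\<lambda>_. 0)"
definition "1 = Witt (\<lambda>n. if n = 0 then 1 else 0)"
definition "x + y = Witt (\<lambda>n. zeval (case_sum (wcoord x) (wcoord y)) (add_poly CARD('a) n))"
  for x y :: "('a, 'b) witt"
definition "x * y = Witt (\<lambda>n. zeval (case_sum (wcoord x) (wcoord y)) (mul_poly CARD('a) n))"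
  for x y :: "('a, 'b) witt"
definition "- x = Witt (\<lambda>n. zeval (wcoord x) (neg_poly CARD('a) n))" for x :: "('a, 'b) witt"
definition "x - y = x + (- y)" for x y :: "('a, 'b) witt"
instance ..
end

definition wghost :: "('p::prime_card, 'k::comm_ring_1) witt \<Rightarrow> nat \<Rightarrow> 'k" where
  "wghost x = ghost CARD('p) (wcoord x)"

lemma wghost_add [simp]: "wghost (x + y :: ('p::prime_card, 'k::comm_ring_1) witt) n = wghost x n + wghost y n"
  and wghost_mult [simp]: "wghost (x * y) n = wghost x n * wghost y n"
  and wghost_uminus [simp]: "wghost (- x) n = - wghost x n"
proof -
  note h = rhom_zeval[where f="case_sum (wcoord x) (wcoord y)"]
  have X: "zeval (case_sum (wcoord x) (wcoord y)) (ghost CARD('p) XX n) = wghost x n"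
     and Y: "zeval (case_sum (wcoord x) (wcoord y)) (ghost CARD('p) YY n) = wghost y n"
    by (simp_all add: rhom.ghost[OF h] XX_def YY_def wghost_def)
  have Z: "zeval (wcoord x) (ghost CARD('p) zvar n) = wghost x n"
    by (simp add: rhom.ghost[OF rhom_zeval] wghost_def)
  show "wghost (x + y) n = wghost x n + wghost y n"
    using X Y unfolding wghost_def plus_witt_def witt.sel
    by (simp flip: rhom.ghost[OF h] add: ghost_add_poly prime_card rhom.add[OF h])
  show "wghost (x * y) n = wghost x n * wghost y n"
    using X Y unfolding wghost_def times_witt_def witt.sel
    by (simp flip: rhom.ghost[OF h] add: ghost_mul_poly prime_card rhom.mult[OF h])
  show "wghost (- x) n = - wghost x n"
    using Z unfolding wghost_def uminus_witt_def witt.sel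
    by (simp flip: rhom.ghost[OF rhom_zeval] add: ghost_neg_poly prime_card rhom.uminus[OF rhom_zeval])
qed

lemma wghost_0 [simp]: "wghost 0 n = 0"
  by (simp add: wghost_def zero_witt_def ghost_def power_0_left)

lemma wghost_1 [simp]: "wghost 1 n = 1"
proof -
  have "wghost 1 n = (\<Sum>i\<le>n. if i = 0 then 1 else 0)"
    unfolding wghost_def ghost_def one_witt_def by (rule sum.cong) (auto simp: power_0_left)
  then show ?thesis by simp
qed

lemma wghost_inj:
  fixes x y :: "('p::prime_card, 'v zpoly) witt"
  assumes "\<And>n. wghost x n = wghost y n"
  shows "x = y"
  using ghost_inj[of "CARD('p)" "wcoord x" "wcoord y"] assms
  by (simp add: wghost_def witt.expand)

definition witt_map :: "('k \<Rightarrow> 'l) \<Rightarrow> ('p, 'k) witt \<Rightarrow> ('p, 'l) witt" where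
  "witt_map h x = Witt (\<lambda>n. h (wcoord x n))"

context rhom
begin
lemma witt_map_add: "witt_map h (x + y :: ('p::prime_card, _) witt) = witt_map h x + witt_map h y"
  and witt_map_mult: "witt_map h (x * y :: ('p::prime_card, _) witt) = witt_map h x * witt_map h y"
  and witt_map_uminus: "witt_map h (- x :: ('p::prime_card, _) witt) = - witt_map h x"
  and witt_map_0: "witt_map h (0 :: ('p::prime_card, _) witt) = 0"
  and witt_map_1: "witt_map h (1 :: ('p::prime_card, _) witt) = 1"
proof -
  have *: "(\<lambda>v. h (case_sum a b v)) = case_sum (\<lambda>i. h (a i)) (\<lambda>i. h (b i))" for a b :: "nat \<Rightarrow> 'a"
    by (auto split: sum.splits)
  show "witt_map h (x + y :: ('p::prime_card, _) witt) = witt_map h x + witt_map h y"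
    "witt_map h (x * y :: ('p::prime_card, _) witt) = witt_map h x * witt_map h y"
    "witt_map h (- x :: ('p::prime_card, _) witt) = - witt_map h x"
    "witt_map h (0 :: ('p::prime_card, _) witt) = 0"
    "witt_map h (1 :: ('p::prime_card, _) witt) = 1"
    by (auto simp: witt_map_def plus_witt_def times_witt_def uminus_witt_def zero_witt_def one_witt_def
      zeval * zero one)
qed
end

lemma witt_lift: "witt_map (zeval id) (Witt (\<lambda>n. zvar (wcoord x n))) = x"
  by (simp add: witt_map_def)

instance witt :: (prime_card, comm_ring_1) comm_ring_1
proof
  fix a b c :: "('a, 'b) witt"
  define A B C :: "('a, 'b zpoly) witt" where "A = Witt (\<lambda>n. zvar (wcoord a n))"
    and "B = Witt (\<lambda>n. zvar (wcoord b n))" and "C = Witt (\<lambda>n. zvar (wcoord c n))"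
  let ?h = "witt_map (zeval id) :: ('a, 'b zpoly) witt \<Rightarrow> _"
  have abc: "a = ?h A" "b = ?h B" "c = ?h C" by (simp_all add: A_def B_def C_def witt_lift)
  note hom = rhom.witt_map_add[OF rhom_zeval, symmetric] rhom.witt_map_mult[OF rhom_zeval, symmetric]
    rhom.witt_map_uminus[OF rhom_zeval, symmetric]
  note hom' = rhom.witt_map_add[OF rhom_zeval] rhom.witt_map_mult[OF rhom_zeval]
    rhom.witt_map_uminus[OF rhom_zeval] rhom.witt_map_0[OF rhom_zeval] rhom.witt_map_1[OF rhom_zeval]
  show "a + b + c = a + (b + c)" "a + b = b + a" "a * b * c = a * (b * c)" "a * b = b * a"
    "(a + b) * c = a * c + b * c"
    unfolding abc hom by (rule arg_cong[where f="?h"], rule wghost_inj, simp add: algebra_simps)+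
  have "?h (0 + A) = ?h A" "?h (1 * A) = ?h A" "?h (- A + A) = ?h 0"
    by (rule arg_cong[where f="?h"], rule wghost_inj, simp)+
  then show "0 + a = a" "1 * a = a" "- a + a = 0"
    unfolding hom' abc by simp_all
  show "a - b = a + - b" by (rule minus_witt_def)
  show "(0 :: ('a, 'b) witt) \<noteq> 1" by (auto simp: zero_witt_def one_witt_def fun_eq_iff intro: exI[of _ 0])
qed

text \<open>The \<open>p\<close>-adic topology.\<close>

instantiation witt :: (prime_card, comm_ring_1) topological_space
begin
definition open_witt :: "('a, 'b) witt set \<Rightarrow> bool" where
  "open_witt U \<longleftrightarrow> (\<forall>x\<in>U. \<exists>n. \<forall>y. of_nat CARD('a) ^ n dvd y - x \<longrightarrow> y \<in> U)"
instance
proof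
  show "open (UNIV :: ('a, 'b) witt set)" by (simp add: open_witt_def)
next
  fix S T :: "('a, 'b) witt set"
  assume S: "open S" and T: "open T"
  show "open (S \<inter> T)"
    unfolding open_witt_def
  proof
    fix x assume x: "x \<in> S \<inter> T"
    then obtain m n where "\<forall>y. of_nat CARD('a) ^ m dvd y - x \<longrightarrow> y \<in> S"
      "\<forall>y. of_nat CARD('a) ^ n dvd y - x \<longrightarrow> y \<in> T"
      using S T unfolding open_witt_def by blast
    then show "\<exists>k. \<forall>y. of_nat CARD('a) ^ k dvd y - x \<longrightarrow> y \<in> S \<inter> T"
      by (intro exI[of _ "max m n"]) (meson IntI dvd_trans le_imp_power_dvd max.cobounded1 max.cobounded2)
  qed
next
  fix K :: "('a, 'b) witt set set"
  assume "\<forall>S\<in>K. open S"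
  then show "open (\<Union>K)"
    unfolding open_witt_def by (meson Union_iff)
qed
end

quotient_type qz = rat / "\<lambda>x y. x - y \<in> \<int>"
proof (rule equivpI)
  show "reflp (\<lambda>x y :: rat. x - y \<in> \<int>)" by (simp add: reflp_def)
  show "symp (\<lambda>x y :: rat. x - y \<in> \<int>)"
    by (metis (mono_tags, lifting) Ints_minus minus_diff_eq sympI)
  show "transp (\<lambda>x y :: rat. x - y \<in> \<int>)"
    by (rule transpI) (metis Ints_add diff_add_cancel diff_add_eq add_diff_eq)
qed

instantiation qz :: ab_group_add
begin
lift_definition zero_qz :: qz is 0 .
lift_definition plus_qz :: "qz \<Rightarrow> qz \<Rightarrow> qz" is "(+)"
  by (metis Ints_add add_diff_add)
lift_definition uminus_qz :: "qz \<Rightarrow> qz" is "uminus"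
  by (metis Ints_minus minus_diff_minus)
definition minus_qz :: "qz \<Rightarrow> qz \<Rightarrow> qz" where "x - y = x + (- y)" for x y :: qz
instance
  by standard (unfold minus_qz_def, (transfer, simp)+)
end

lift_definition qz_scale :: "nat \<Rightarrow> qz \<Rightarrow> qz" is "\<lambda>n x. of_nat n * x"
  by (metis Ints_mult Ints_of_nat right_diff_distrib)

type_synonym qz_ring = "qz \<Rightarrow>\<^sub>0 int"

definition ee :: "qz \<Rightarrow> qz_ring" where "ee \<gamma> = Poly_Mapping.single \<gamma> 1"

definition bc_sigma :: "num \<Rightarrow> qz_ring \<Rightarrow> qz_ring" where
  "bc_sigma n x = (\<Sum>\<gamma>\<in>Poly_Mapping.keys x. Poly_Mapping.single (qz_scale (numeral n) \<gamma>) (Poly_Mapping.lookup x \<gamma>))"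

definition bc_rho :: "num \<Rightarrow> qz_ring \<Rightarrow> qz_ring" where
  "bc_rho n x = (\<Sum>\<gamma>\<in>Poly_Mapping.keys x. \<Sum>\<gamma>' | qz_scale (numeral n) \<gamma>' = \<gamma>.
     Poly_Mapping.single \<gamma>' (Poly_Mapping.lookup x \<gamma>))"

text \<open>The Bost-Connes ring is given by generators and relations: \<open>bc_eq\<close> is the least ring congruence on
  formal expressions which makes \<open>Grp\<close> a unital ring homomorphism on \<open>\<int>[\<rat>/\<int>]\<close> and satisfies the defining
  relations. The indices of \<open>MuT\<close> and \<open>MuS\<close> have type \<^typ>\<open>num\<close>, i.e. they are the positive integers,
  and \<open>numeral n\<close> is the value of \<open>n\<close> in any (semi)ring.\<close>

datatype bc_term =
    Grp qz_ring | MuT num | MuS num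
  | Plus bc_term bc_term | Uminus bc_term | Times bc_term bc_term

inductive bc_eq :: "bc_term \<Rightarrow> bc_term \<Rightarrow> bool" where
  bc_refl: "bc_eq a a"
| bc_sym: "bc_eq a b \<Longrightarrow> bc_eq b a"
| bc_trans: "bc_eq a b \<Longrightarrow> bc_eq b c \<Longrightarrow> bc_eq a c"
| Plus_cong: "bc_eq a a' \<Longrightarrow> bc_eq b b' \<Longrightarrow> bc_eq (Plus a b) (Plus a' b')"
| Uminus_cong: "bc_eq a a' \<Longrightarrow> bc_eq (Uminus a) (Uminus a')"
| Times_cong: "bc_eq a a' \<Longrightarrow> bc_eq b b' \<Longrightarrow> bc_eq (Times a b) (Times a' b')"
| Plus_assoc: "bc_eq (Plus (Plus a b) c) (Plus a (Plus b c))"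
| Plus_commute: "bc_eq (Plus a b) (Plus b a)"
| Plus_zero: "bc_eq (Plus (Grp 0) a) a"
| Plus_uminus: "bc_eq (Plus (Uminus a) a) (Grp 0)"
| Times_assoc: "bc_eq (Times (Times a b) c) (Times a (Times b c))"
| Times_one: "bc_eq (Times (Grp 1) a) a"
| one_Times: "bc_eq (Times a (Grp 1)) a"
| distrib_r: "bc_eq (Times (Plus a b) c) (Plus (Times a c) (Times b c))"
| distrib_l: "bc_eq (Times a (Plus b c)) (Plus (Times a b) (Times a c))"
| Grp_Plus: "bc_eq (Grp (x + y)) (Plus (Grp x) (Grp y))"
| Grp_Times: "bc_eq (Grp (x * y)) (Times (Grp x) (Grp y))"
| MuT_x_MuS: "bc_eq (Times (Times (MuT n) (Grp x)) (MuS n)) (Grp (bc_rho n x))"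
| MuS_x: "bc_eq (Times (MuS n) (Grp x)) (Times (Grp (bc_sigma n x)) (MuS n))"
| x_MuT: "bc_eq (Times (Grp x) (MuT n)) (Times (MuT n) (Grp (bc_sigma n x)))"
| MuT_mult: "bc_eq (MuT (n * m)) (Times (MuT n) (MuT m))"
| MuS_mult: "bc_eq (MuS (n * m)) (Times (MuS n) (MuS m))"
| MuS_MuT: "bc_eq (Times (MuS n) (MuT n)) (Grp (numeral n))"
| MuT_MuS: "coprime (numeral n :: nat) (numeral m) \<Longrightarrow>
    bc_eq (Times (MuT n) (MuS m)) (Times (MuS m) (MuT n))"

text \<open>The augmentation \<open>e(\<gamma>) \<mapsto> 1\<close>, extended by \<open>\<mu>~\<^sub>n \<mapsto> n\<close> and \<open>\<mu>\<^sub>n\<^sup>* \<mapsto> 1\<close>; it is only used to show that the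
  rings defined below are non-trivial.\<close>

definition aug :: "qz_ring \<Rightarrow> int" where
  "aug x = (\<Sum>\<gamma>\<in>Poly_Mapping.keys x. Poly_Mapping.lookup x \<gamma>)"

lemma aug_superset: "finite A \<Longrightarrow> Poly_Mapping.keys x \<subseteq> A \<Longrightarrow> aug x = (\<Sum>\<gamma>\<in>A. Poly_Mapping.lookup x \<gamma>)"
  unfolding aug_def by (rule sum.mono_neutral_left) (auto simp: in_keys_iff)

lemma aug_add: "aug (x + y) = aug x + aug y"
proof -
  let ?A = "Poly_Mapping.keys x \<union> Poly_Mapping.keys y"
  have "Poly_Mapping.keys (x + y) \<subseteq> ?A" by (rule Poly_Mapping.keys_add)
  then show ?thesis
    by (simp add: aug_superset[of ?A] lookup_add sum.distrib)
qed

lemma aug_0 [simp]: "aug 0 = 0" by (simp add: aug_def)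

lemma aug_single [simp]: "aug (Poly_Mapping.single \<gamma> c) = c"
  by (subst aug_superset[of "{\<gamma>}"]) auto

lemma aug_mult: "aug (x * y) = aug x * aug y"
proof (induction x rule: poly_mapping_induct_add)
  case (single k c)
  show ?case
    by (induction y rule: poly_mapping_induct_add) (simp_all add: distrib_left aug_add mult_single)
qed (simp_all add: distrib_right aug_add)

lemma aug_sum: "aug (sum f A) = (\<Sum>a\<in>A. aug (f a))"
  by (induction A rule: infinite_finite_induct) (auto simp: aug_add)

lemma aug_1 [simp]: "aug 1 = 1" by (simp flip: single_one)

lemma aug_numeral [simp]: "aug (numeral n) = numeral n" by (simp flip: single_numeral)

lemma card_qz_scale:
  assumes n: "n > 0"
  shows "card {\<gamma>'. qz_scale n \<gamma>' = \<gamma>} = n"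
proof -
  obtain r where r: "\<gamma> = abs_qz r" by (metis Quotient3_abs_rep Quotient3_qz)
  define f where "f k = abs_qz ((r + of_nat k) / of_nat n)" for k
  have eq: "abs_qz x = abs_qz y \<longleftrightarrow> x - y \<in> \<int>" for x y by (simp add: qz.abs_eq_iff)
  have "bij_betw f {..<n} {\<gamma>'. qz_scale n \<gamma>' = \<gamma>}"
  proof (rule bij_betwI')
    fix i j assume ij: "i \<in> {..<n}" "j \<in> {..<n}"
    show "f i = f j \<longleftrightarrow> i = j"
    proof
      assume "f i = f j"
      then have "(r + of_nat i) / of_nat n - (r + of_nat j) / of_nat n \<in> \<int>" by (simp add: f_def eq)
      then obtain z where "(r + of_nat i) / of_nat n - (r + of_nat j) / of_nat n = of_int z" by (auto elim: Ints_cases)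
      then have "rat_of_int (int i - int j) = of_int (z * int n)" using n by (simp add: field_simps)
      then have "int i - int j = z * int n" by (simp only: of_int_eq_iff)
      then have "int n dvd int i - int j" by simp
      then have "int i mod int n = int j mod int n" by (simp add: mod_eq_dvd_iff)
      then show "i = j" using ij by simp
    qed simp
  next
    fix i assume "i \<in> {..<n}"
    show "f i \<in> {\<gamma>'. qz_scale n \<gamma>' = \<gamma>}"
      using n by (simp add: f_def r qz_scale.abs_eq eq)
  next
    fix \<gamma>' assume "\<gamma>' \<in> {\<gamma>'. qz_scale n \<gamma>' = \<gamma>}"
    moreover obtain s where s: "\<gamma>' = abs_qz s" by (metis Quotient3_abs_rep Quotient3_qz)
    ultimately have "of_nat n * s - r \<in> \<int>" by (simp add: r qz_scale.abs_eq eq)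
    then obtain z where z: "of_nat n * s - r = of_int z" by (auto elim: Ints_cases)
    define k where "k = nat (z mod int n)"
    have "z = (z div int n) * int n + int k" using n by (simp add: k_def)
    then have "rat_of_int z = of_int (z div int n) * of_nat n + of_nat k"
      by (metis of_int_add of_int_mult of_int_of_nat_eq)
    then have "s - (r + of_nat k) / of_nat n = of_int (z div int n)"
      using z n by (simp add: field_simps)
    then have "\<gamma>' = f k" by (simp add: f_def s eq)
    moreover have "k < n" using n by (simp add: k_def nat_less_iff)
    ultimately show "\<exists>k\<in>{..<n}. \<gamma>' = f k" by blast
  qed
  then show ?thesis by (metis bij_betw_same_card card_lessThan)
qed

lemma aug_sigma: "aug (bc_sigma n x) = aug x"
  by (simp add: bc_sigma_def aug_sum) (simp add: aug_def)

lemma aug_rho: "aug (bc_rho n x) = numeral n * aug x"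
  by (simp add: bc_rho_def aug_sum card_qz_scale) (simp add: aug_def sum_distrib_left)

primrec aug_term :: "bc_term \<Rightarrow> int" where
  "aug_term (Grp x) = aug x"
| "aug_term (MuT n) = numeral n"
| "aug_term (MuS n) = 1"
| "aug_term (Plus a b) = aug_term a + aug_term b"
| "aug_term (Uminus a) = - aug_term a"
| "aug_term (Times a b) = aug_term a * aug_term b"

lemma aug_term_cong: "bc_eq a b \<Longrightarrow> aug_term a = aug_term b"
  by (induction rule: bc_eq.induct)
     (simp_all add: aug_add aug_mult aug_sigma aug_rho algebra_simps)

quotient_type bc = bc_term / bc_eq
  by (rule equivpI) (auto intro!: reflpI sympI transpI intro: bc_eq.intros)

instantiation bc :: ring_1
begin
lift_definition zero_bc :: bc is "Grp 0" .
lift_definition one_bc :: bc is "Grp 1" .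
lift_definition plus_bc :: "bc \<Rightarrow> bc \<Rightarrow> bc" is Plus by (rule Plus_cong)
lift_definition uminus_bc :: "bc \<Rightarrow> bc" is Uminus by (rule Uminus_cong)
lift_definition times_bc :: "bc \<Rightarrow> bc \<Rightarrow> bc" is Times by (rule Times_cong)
definition minus_bc :: "bc \<Rightarrow> bc \<Rightarrow> bc" where "minus_bc a b = a + (- b)"
instance
proof
  fix a b c :: bc
  show "a + b + c = a + (b + c)" by transfer (rule Plus_assoc)
  show "a + b = b + a" by transfer (rule Plus_commute)
  show "0 + a = a" by transfer (rule Plus_zero)
  show "- a + a = 0" by transfer (rule Plus_uminus)
  show "a - b = a + - b" by (rule minus_bc_def)
  show "a * b * c = a * (b * c)" by transfer (rule Times_assoc)
  show "(a + b) * c = a * c + b * c" by transfer (rule distrib_r)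
  show "a * (b + c) = a * b + a * c" by transfer (rule distrib_l)
  show "1 * a = a" by transfer (rule Times_one)
  show "a * 1 = a" by transfer (rule one_Times)
  show "(0 :: bc) \<noteq> 1" by transfer (auto dest: aug_term_cong)
qed
end

lift_definition bc_grp :: "qz_ring \<Rightarrow> bc" is Grp .
lift_definition mu_tilde :: "num \<Rightarrow> bc" is MuT .
lift_definition mu_star :: "num \<Rightarrow> bc" is MuS .

lift_definition bc_aug :: "bc \<Rightarrow> int" is aug_term by (rule aug_term_cong)

lemma bc_aug_hom: "bc_aug 0 = 0" "bc_aug 1 = 1" "bc_aug (a + b) = bc_aug a + bc_aug b"
  "bc_aug (- a) = - bc_aug a" "bc_aug (a - b) = bc_aug a - bc_aug b" "bc_aug (a * b) = bc_aug a * bc_aug b"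
  "bc_aug (bc_grp x) = aug x"
  unfolding minus_bc_def by (transfer; simp)+

inductive_set bc_ideal :: "nat \<Rightarrow> bc set" for p where
  "k > 0 \<Longrightarrow> 1 - bc_grp (ee (abs_qz (1 / of_nat (p ^ k)))) \<in> bc_ideal p"
| "0 \<in> bc_ideal p"
| "a \<in> bc_ideal p \<Longrightarrow> b \<in> bc_ideal p \<Longrightarrow> a + b \<in> bc_ideal p"
| "a \<in> bc_ideal p \<Longrightarrow> c * a \<in> bc_ideal p"
| "a \<in> bc_ideal p \<Longrightarrow> a * c \<in> bc_ideal p"

inductive_set bc_subalgebra :: "nat \<Rightarrow> bc set" for p where
  "bc_grp x \<in> bc_subalgebra p"
| "coprime (numeral n) p \<Longrightarrow> mu_tilde n \<in> bc_subalgebra p"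
| "coprime (numeral n) p \<Longrightarrow> mu_star n \<in> bc_subalgebra p"
| "a \<in> bc_subalgebra p \<Longrightarrow> b \<in> bc_subalgebra p \<Longrightarrow> a + b \<in> bc_subalgebra p"
| "a \<in> bc_subalgebra p \<Longrightarrow> - a \<in> bc_subalgebra p"
| "a \<in> bc_subalgebra p \<Longrightarrow> b \<in> bc_subalgebra p \<Longrightarrow> a * b \<in> bc_subalgebra p"

lemma bc_ideal_uminus: "a \<in> bc_ideal p \<Longrightarrow> - a \<in> bc_ideal p"
  using bc_ideal.intros(4)[of a p "-1"] by simp

lemma bc_aug_ideal: "a \<in> bc_ideal p \<Longrightarrow> bc_aug a = 0"
  by (induction rule: bc_ideal.induct) (auto simp: bc_aug_hom ee_def)

lemma bc_subalgebra_01: "0 \<in> bc_subalgebra p" "1 \<in> bc_subalgebra p"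
  using bc_subalgebra.intros(1)[of 0 p] bc_subalgebra.intros(1)[of 1 p]
  by (simp_all add: bc_grp_def zero_bc_def one_bc_def)

text \<open>The subalgebra modulo the ideal: a class consists of those elements of the subalgebra which are
  congruent to a given one modulo the two-sided ideal of the whole ring.\<close>

typedef 'p bc_p = "{{b \<in> bc_subalgebra CARD('p::prime_card). a - b \<in> bc_ideal CARD('p)} | a.
    a \<in> bc_subalgebra CARD('p)}"
  using bc_subalgebra_01(1) by blast

definition bc_p_class :: "bc \<Rightarrow> 'p::prime_card bc_p" where
  "bc_p_class a = Abs_bc_p {b \<in> bc_subalgebra CARD('p). a - b \<in> bc_ideal CARD('p)}"

definition bc_p_rep :: "'p::prime_card bc_p \<Rightarrow> bc" where
  "bc_p_rep x = (SOME a. a \<in> Rep_bc_p x)"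

lemma bc_p_class_eq_iff:
  assumes "a \<in> bc_subalgebra CARD('p)" "b \<in> bc_subalgebra CARD('p)"
  shows "(bc_p_class a :: 'p::prime_card bc_p) = bc_p_class b \<longleftrightarrow> a - b \<in> bc_ideal CARD('p)"
proof -
  let ?K = "\<lambda>a. {b \<in> bc_subalgebra CARD('p). a - b \<in> bc_ideal CARD('p)}"
  have "(bc_p_class a :: 'p::prime_card bc_p) = bc_p_class b \<longleftrightarrow> ?K a = ?K b"
    unfolding bc_p_class_def by (rule Abs_bc_p_inject) (rule CollectI, rule exI, rule conjI[OF refl], fact assms)+
  also have "\<dots> \<longleftrightarrow> a - b \<in> bc_ideal CARD('p)"
  proof
    assume "?K a = ?K b"
    moreover have "b \<in> ?K b" using assms by (simp add: bc_ideal.intros)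
    ultimately show "a - b \<in> bc_ideal CARD('p)" by blast
  next
    assume ab: "a - b \<in> bc_ideal CARD('p)"
    have "a - c \<in> bc_ideal CARD('p) \<longleftrightarrow> b - c \<in> bc_ideal CARD('p)" for c
      using bc_ideal.intros(3)[OF ab, of "b - c"]
        bc_ideal.intros(3)[OF bc_ideal_uminus[OF ab], of "a - c"] by auto
    then show "?K a = ?K b" by simp
  qed
  finally show ?thesis .
qed

lemma bc_p_rep: "bc_p_rep x \<in> bc_subalgebra CARD('p)" "bc_p_class (bc_p_rep x) = x"
  for x :: "'p::prime_card bc_p"
proof -
  obtain a where a: "a \<in> bc_subalgebra CARD('p)"
    "Rep_bc_p x = {b \<in> bc_subalgebra CARD('p). a - b \<in> bc_ideal CARD('p)}"
    using Rep_bc_p[of x] by blast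
  then have "a \<in> Rep_bc_p x" by (simp add: bc_ideal.intros)
  then have "bc_p_rep x \<in> Rep_bc_p x" unfolding bc_p_rep_def by (rule someI)
  then have *: "bc_p_rep x \<in> bc_subalgebra CARD('p)" "a - bc_p_rep x \<in> bc_ideal CARD('p)" by (auto simp: a)
  then show "bc_p_rep x \<in> bc_subalgebra CARD('p)" by simp
  have "x = bc_p_class a" by (metis Rep_bc_p_inverse a(2) bc_p_class_def)
  moreover have "bc_p_class a = (bc_p_class (bc_p_rep x) :: 'p bc_p)"
    using bc_p_class_eq_iff[OF a(1) *(1)] *(2) by blast
  ultimately show "bc_p_class (bc_p_rep x) = x" by metis
qed

lemma bc_p_rep_class:
  assumes "a \<in> bc_subalgebra CARD('p)"
  shows "a - bc_p_rep (bc_p_class a :: 'p::prime_card bc_p) \<in> bc_ideal CARD('p)"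
  using assms bc_p_rep[of "bc_p_class a :: 'p bc_p"] by (simp flip: bc_p_class_eq_iff)

instantiation bc_p :: (prime_card) ring_1
begin
definition "0 = bc_p_class 0"
definition "1 = bc_p_class 1"
definition "x + y = bc_p_class (bc_p_rep x + bc_p_rep y)" for x y :: "'a bc_p"
definition "- x = bc_p_class (- bc_p_rep x)" for x :: "'a bc_p"
definition "x * y = bc_p_class (bc_p_rep x * bc_p_rep y)" for x y :: "'a bc_p"
definition "x - y = x + (- y)" for x y :: "'a bc_p"
instance
proof
  let ?A = "bc_subalgebra CARD('a)" and ?J = "bc_ideal CARD('a)"
  let ?c = "bc_p_class :: bc \<Rightarrow> 'a bc_p"
  note [simp] = bc_subalgebra.intros(4-6) bc_subalgebra_01 bc_p_rep(1)
  have add: "?c a + ?c b = ?c (a + b)" if "a \<in> ?A" "b \<in> ?A" for a b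
  proof -
    have "(a - bc_p_rep (?c a)) + (b - bc_p_rep (?c b)) \<in> ?J"
      by (intro bc_ideal.intros(3) bc_p_rep_class that)
    then have "?c (a + b) = ?c (bc_p_rep (?c a) + bc_p_rep (?c b))"
      using that by (subst bc_p_class_eq_iff) (simp_all add: algebra_simps)
    then show ?thesis by (simp add: plus_bc_p_def)
  qed
  have mult: "?c a * ?c b = ?c (a * b)" if "a \<in> ?A" "b \<in> ?A" for a b
  proof -
    have "(a - bc_p_rep (?c a)) * b + bc_p_rep (?c a) * (b - bc_p_rep (?c b)) \<in> ?J"
      by (intro bc_ideal.intros(3-5) bc_p_rep_class that)
    then have "?c (a * b) = ?c (bc_p_rep (?c a) * bc_p_rep (?c b))"
      using that by (subst bc_p_class_eq_iff) (simp_all add: algebra_simps)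
    then show ?thesis by (simp add: times_bc_p_def)
  qed
  have uminus: "- ?c a = ?c (- a)" if "a \<in> ?A" for a
  proof -
    have "- (a - bc_p_rep (?c a)) \<in> ?J"
      by (intro bc_ideal_uminus bc_p_rep_class that)
    then have "?c (- a) = ?c (- bc_p_rep (?c a))"
      using that by (subst bc_p_class_eq_iff) (simp_all add: algebra_simps)
    then show ?thesis by (simp add: uminus_bc_p_def)
  qed
  fix x y z :: "'a bc_p"
  obtain a b c where abc: "a \<in> ?A" "b \<in> ?A" "c \<in> ?A" "x = ?c a" "y = ?c b" "z = ?c c"
    by (metis bc_p_rep)
  note [simp] = abc(1-3) add mult uminus
  show "x + y + z = x + (y + z)" "x + y = y + x" "x * y * z = x * (y * z)"
    "(x + y) * z = x * z + y * z" "x * (y + z) = x * y + x * z"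
    unfolding abc(4-6) by (simp_all add: algebra_simps)
  show "0 + x = x" "- x + x = 0" "1 * x = x" "x * 1 = x"
    unfolding abc(4-6) zero_bc_p_def one_bc_p_def by simp_all
  show "x - y = x + - y" by (rule minus_bc_p_def)
  have "1 \<notin> ?J" using bc_aug_ideal[of 1] by (auto simp: bc_aug_hom)
  then show "(0 :: 'a bc_p) \<noteq> 1"
    unfolding zero_bc_p_def one_bc_p_def using bc_ideal_uminus[of "-1"]
    by (subst bc_p_class_eq_iff) auto
qed
end

text \<open>The index set \<open>I(p)\<close> of positive integers prime to \<open>p\<close>.\<close>

typedef 'p Ip = "{n :: num. coprime (numeral n) CARD('p::prime_card)}"
  by (rule exI[of _ num.One]) simp

setup_lifting type_definition_Ip

instantiation Ip :: (prime_card) times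
begin
lift_definition times_Ip :: "'a Ip \<Rightarrow> 'a Ip \<Rightarrow> 'a Ip" is "(*)"
  by (metis coprime_mult_left_iff numeral_mult)
instance ..
end

instance Ip :: (prime_card) Rings.dvd ..

type_synonym 'p Fpbar = "'p mod_ring alg_closure"
type_synonym 'p ring_O = "('p, 'p Fpbar) witt"
type_synonym 'p Zp = "('p, 'p mod_ring) witt"
type_synonym 'p O_Ip = "'p Ip \<Rightarrow> 'p ring_O"

definition teichmueller :: "'k::comm_ring_1 \<Rightarrow> ('p, 'k) witt" where
  "teichmueller a = Witt (\<lambda>n. if n = 0 then a else 0)"

definition Fr :: "'p::prime_card ring_O \<Rightarrow> 'p ring_O" where
  "Fr = witt_map (\<lambda>x. x ^ CARD('p))"

definition scaleO :: "'p::prime_card ring_O \<Rightarrow> 'p O_Ip \<Rightarrow> 'p O_Ip" where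
  "scaleO c x = (\<lambda>m. c * x m)"

text \<open>\<open>\<int>\<^sub>p\<close> is the ring of \<open>p\<close>-typical Witt vectors of the prime field; it acts through the map
  functorially induced by the inclusion of the prime field into its algebraic closure.\<close>

definition scaleZp :: "'p::prime_card Zp \<Rightarrow> 'p O_Ip \<Rightarrow> 'p O_Ip" where
  "scaleZp c x = (\<lambda>m. witt_map to_ac c * x m)"

definition eps :: "'p::prime_card Ip \<Rightarrow> 'p O_Ip" where
  "eps m = (\<lambda>k. if k = m then 1 else 0)"

definition is_rep :: "('h::ring_1 \<Rightarrow> 'v::{ab_group_add, topological_space} \<Rightarrow> 'v) \<Rightarrow> bool" where
  "is_rep \<pi> \<longleftrightarrow>
     (\<forall>a. Modules.additive (\<pi> a) \<and> continuous_on UNIV (\<pi> a)) \<and>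
     \<pi> 1 = id \<and>
     (\<forall>a b. \<pi> (a + b) = (\<lambda>v. \<pi> a v + \<pi> b v)) \<and>
     (\<forall>a b. \<pi> (a * b) = \<pi> a \<circ> \<pi> b)"

definition linear_rep ::
  "('c::comm_ring_1 \<Rightarrow> 'v \<Rightarrow> 'v) \<Rightarrow> ('h::ring_1 \<Rightarrow> 'v::{ab_group_add, topological_space} \<Rightarrow> 'v) \<Rightarrow> bool" where
  "linear_rep smul \<pi> \<longleftrightarrow> is_rep \<pi> \<and> (\<forall>a. Modules.module_hom smul smul (\<pi> a))"

definition subrep ::
  "('c::comm_ring_1 \<Rightarrow> 'v \<Rightarrow> 'v) \<Rightarrow> ('h::ring_1 \<Rightarrow> 'v::{ab_group_add, topological_space} \<Rightarrow> 'v) \<Rightarrow> 'v set \<Rightarrow> bool" where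
  "subrep smul \<pi> V \<longleftrightarrow> Modules.module.subspace smul V \<and> (\<forall>a. \<pi> a ` V \<subseteq> V)"

text \<open>Given \<open>V \<inter> W = {0}\<close>, the maps \<open>P\<close>, \<open>Q\<close> are necessarily the two projections.\<close>

definition top_direct_sum :: "'v::{ab_group_add, topological_space} set \<Rightarrow> 'v set \<Rightarrow> bool" where
  "top_direct_sum V W \<longleftrightarrow> V \<inter> W = {0} \<and>
     (\<exists>P Q. continuous_on UNIV P \<and> continuous_on UNIV Q \<and>
        (\<forall>v. P v \<in> V \<and> Q v \<in> W \<and> v = P v + Q v))"

definition indecomposable ::
  "('c::comm_ring_1 \<Rightarrow> 'v \<Rightarrow> 'v) \<Rightarrow> ('h::ring_1 \<Rightarrow> 'v::{ab_group_add, topological_space} \<Rightarrow> 'v) \<Rightarrow> bool" where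
  "indecomposable smul \<pi> \<longleftrightarrow>
     \<not> (\<exists>V W. subrep smul \<pi> V \<and> subrep smul \<pi> W \<and> V \<noteq> {0} \<and> W \<noteq> {0} \<and> top_direct_sum V W)"

definition equivalent_reps ::
  "('c::comm_ring_1 \<Rightarrow> 'v \<Rightarrow> 'v) \<Rightarrow> ('h::ring_1 \<Rightarrow> 'v::{ab_group_add, topological_space} \<Rightarrow> 'v)
    \<Rightarrow> ('h \<Rightarrow> 'v \<Rightarrow> 'v) \<Rightarrow> bool" where
  "equivalent_reps smul \<pi> \<pi>' \<longleftrightarrow>
     (\<exists>T T'. Modules.module_hom smul smul T \<and> homeomorphism UNIV UNIV T T' \<and>
        (\<forall>a v. T (\<pi> a v) = \<pi>' a (T v)))"

text \<open>Homomorphisms on the multiplicative group are functions on the whole field whose value at \<open>0\<close> is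
  irrelevant.\<close>

definition inj_unit_hom :: "('k::field \<Rightarrow> qz) \<Rightarrow> bool" where
  "inj_unit_hom \<sigma> \<longleftrightarrow>
     (\<forall>x y. x \<noteq> 0 \<longrightarrow> y \<noteq> 0 \<longrightarrow> \<sigma> (x * y) = \<sigma> x + \<sigma> y) \<and> inj_on \<sigma> (- {0})"

definition field_aut :: "('k::field \<Rightarrow> 'k) \<Rightarrow> bool" where
  "field_aut \<alpha> \<longleftrightarrow> bij \<alpha> \<and> (\<forall>x y. \<alpha> (x + y) = \<alpha> x + \<alpha> y) \<and> (\<forall>x y. \<alpha> (x * y) = \<alpha> x * \<alpha> y)"

definition qz_prime_to :: "nat \<Rightarrow> qz set" where
  "qz_prime_to p = {abs_qz (of_int a / of_nat n) | a n. n > 0 \<and> coprime n p}"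

text \<open>The finitely supported vectors are dense in the product, so these conditions determine \<open>\<pi>\<close> uniquely.
  \<open>Rep_Ip n\<close> is the element \<open>n\<close> of \<open>I(p)\<close> as a positive integer.\<close>

definition is_pi :: "('p::prime_card Fpbar \<Rightarrow> qz) \<Rightarrow> (bc \<Rightarrow> 'p O_Ip \<Rightarrow> 'p O_Ip) \<Rightarrow> bool" where
  "is_pi \<sigma> \<pi> \<longleftrightarrow>
     is_rep \<pi> \<and>
     (\<forall>n :: 'p Ip. Modules.module_hom scaleO scaleO (\<pi> (mu_tilde (Rep_Ip n)))) \<and>
     (\<forall>n :: 'p Ip. Modules.module_hom scaleO scaleO (\<pi> (mu_star (Rep_Ip n)))) \<and>
     (\<forall>x. Modules.module_hom scaleO scaleO (\<pi> (bc_grp x))) \<and>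
     (\<forall>n m :: 'p Ip. \<pi> (mu_tilde (Rep_Ip n)) (eps m) = scaleO (numeral (Rep_Ip n)) (eps (n * m))) \<and>
     (\<forall>n m :: 'p Ip. \<pi> (mu_star (Rep_Ip n)) (eps (n * m)) = eps m) \<and>
     (\<forall>n k :: 'p Ip. \<not> n dvd k \<longrightarrow> \<pi> (mu_star (Rep_Ip n)) (eps k) = 0) \<and>
     (\<forall>\<gamma>\<in>qz_prime_to CARD('p). \<forall>m.
        \<pi> (bc_grp (ee \<gamma>)) (eps m) =
          scaleO (teichmueller (the_inv_into (- {0}) \<sigma> \<gamma>) ^ numeral (Rep_Ip m)) (eps m)) \<and>
     (\<forall>\<gamma>. (\<exists>k. qz_scale (CARD('p) ^ k) \<gamma> = 0) \<longrightarrow> \<pi> (bc_grp (ee \<gamma>)) = id) \<and>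
     \<pi> (mu_star (num_of_nat CARD('p))) = (\<lambda>x m. Fr (x m)) \<and>
     \<pi> (mu_tilde (num_of_nat CARD('p))) = (\<lambda>x m. of_nat CARD('p) * inv_into UNIV Fr (x m))"

definition pi_rep :: "('p::prime_card Fpbar \<Rightarrow> qz) \<Rightarrow> bc \<Rightarrow> 'p O_Ip \<Rightarrow> 'p O_Ip" where
  "pi_rep \<sigma> = (THE \<pi>. is_pi \<sigma> \<pi>)"

text \<open>The choice of the representative does not matter since the ideal is contained in the kernel of
  \<open>pi_rep \<sigma>\<close>.\<close>

definition pi_rep_p :: "('p::prime_card Fpbar \<Rightarrow> qz) \<Rightarrow> 'p bc_p \<Rightarrow> 'p O_Ip \<Rightarrow> 'p O_Ip" where
  "pi_rep_p \<sigma> h = pi_rep \<sigma> (bc_p_rep h)"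

end

theory Submission
  imports Defs
begin

text \<open>
  Write \<open>k\<close> for the algebraic closure of the prime field, \<open>O\<close> for its ring of Witt vectors and \<open>\<tau>\<close> for the
  Teichmueller lift.

  The representation exists because all its operators have explicit coordinates. The embedding \<open>\<sigma>\<close> maps
  the units of \<open>k\<close> isomorphically onto the prime-to-\<open>p\<close> torsion of \<open>\<rat>/\<int>\<close>: every unit has finite order prime
  to \<open>p\<close>, and for \<open>n\<close> prime to \<open>p\<close> there are \<open>n\<close> roots of unity of order dividing \<open>n\<close> and \<open>n\<close> elements of
  \<open>\<rat>/\<int>\<close> killed by \<open>n\<close>. Hence \<open>\<tau> \<circ> \<sigma>\<^sup>-\<^sup>1\<close> extends to a character \<open>\<chi>\<close> of \<open>\<rat>/\<int>\<close> which is trivial on \<open>p\<close>-power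
  torsion, and \<open>e(\<gamma>)\<close> acts on the coordinate \<open>m\<close> by \<open>\<chi>(\<gamma>)\<^sup>m\<close>. The only defining relation that is not a
  matter of bookkeeping is \<open>\<mu>~\<^sub>n x \<mu>\<^sub>n\<^sup>* = \<rho>~\<^sub>n(x)\<close>, where orthogonality of characters enters. The
  representation is unique since finitely supported vectors are dense in the product.

  The four claims rest on one computation. Let \<open>T\<close> be additive and continuous, and let it intertwine
  the actions attached to \<open>\<sigma>\<close> and \<open>\<sigma>'\<close> of the \<open>e(\<gamma>)\<close> and of the \<open>\<mu>~\<^sub>n\<close> with \<open>n\<close> prime to \<open>p\<close>. Put
  \<open>\<theta> = \<sigma>'\<^sup>-\<^sup>1 \<circ> \<sigma>\<close>, an automorphism of the group of units, extended by \<open>\<theta>(0) = 0\<close>. The coordinate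
  \<open>\<phi>\<^sub>m(c)\<close> of \<open>T(c \<epsilon>\<^sub>1)\<close> is additive in \<open>c\<close> and satisfies \<open>\<phi>\<^sub>m(\<tau>(x)c) = \<tau>(\<theta>(x))\<^sup>m \<phi>\<^sub>m(c)\<close>.
  Teichmueller representatives generate a dense subgroup of \<open>O\<close>, so \<open>\<phi>\<^sub>m\<close> vanishes as soon as \<open>\<phi>\<^sub>m(1)\<close> does.
  If \<open>\<phi>\<^sub>m(1) \<noteq> 0\<close>, dividing \<open>\<phi>\<^sub>m\<close> by the largest power of \<open>p\<close> which divides \<open>\<phi>\<^sub>m(1)\<close> and reducing modulo
  \<open>p\<close> shows that \<open>x \<mapsto> \<theta>(x)\<^sup>m\<close> is additive (lemma \<open>teichmueller_twist_additive\<close>). It is then a field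
  endomorphism, hence injective, which is impossible for \<open>m \<noteq> 1\<close> as \<open>k\<close> contains non-trivial \<open>m\<close>-th roots of
  unity (lemma \<open>phi_off_diagonal\<close>). So \<open>T(c \<epsilon>\<^sub>1) = \<phi>\<^sub>1(c) \<epsilon>\<^sub>1\<close>, and if \<open>T \<noteq> 0\<close> then \<open>\<theta>\<close> is a field
  automorphism. Since \<open>\<mu>~\<^sub>n(c \<epsilon>\<^sub>1) = n c \<epsilon>\<^sub>n\<close> and \<open>O\<close> has no torsion, \<open>\<phi>\<^sub>1\<close> determines \<open>T\<close>.

  For \<open>\<sigma> = \<sigma>'\<close> this makes \<open>\<phi>\<^sub>1\<close> multiplication by a constant; if \<open>T\<close> is idempotent the constant is \<open>0\<close> or \<open>1\<close>
  because \<open>O\<close> is a domain. This gives both indecomposability statements. For an \<open>O\<close>-linear equivalence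
  \<open>\<phi>\<^sub>1\<close> is both linear and \<open>\<theta>\<close>-semilinear, so \<open>\<theta>\<close> is the identity and \<open>\<sigma> = \<sigma>'\<close>. An equivalence over
  \<open>\<int>\<^sub>p\<close> still makes \<open>\<theta>\<close> a field automorphism with \<open>\<sigma>' \<circ> \<theta> = \<sigma>\<close>; conversely a field automorphism acts
  on \<open>O\<close> by functoriality, and applying it to every coordinate is an equivalence.
\<close>

section \<open>Coordinates of Witt vectors\<close>

lemma wcoord_witt_map [simp]: "wcoord (witt_map h x) n = h (wcoord x n)"
  by (simp add: witt_map_def)

lemma wghost_at_0: "wghost x 0 = wcoord x 0"
  by (simp add: wghost_def ghost_def)

lemma rhom_wcoord_0: "rhom (\<lambda>x :: ('p::prime_card, 'k::comm_ring_1) witt. wcoord x 0)"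
  by standard (metis wghost_at_0 wghost_add wghost_mult wghost_1)+

lemma rhom_witt_map: "rhom h \<Longrightarrow> rhom (witt_map h :: ('p::prime_card, _) witt \<Rightarrow> _)"
  by (simp add: rhom_def rhom.witt_map_add rhom.witt_map_mult rhom.witt_map_1)

lemma witt_eqI: "(\<And>n. wcoord x n = wcoord y n) \<Longrightarrow> x = y"
  by (cases x; cases y) auto

lemma wcoord_0_witt [simp]: "wcoord 0 n = 0"
  by (simp add: zero_witt_def)

section \<open>Teichmueller representatives\<close>

lemma wcoord_teichmueller: "wcoord (teichmueller a) n = (if n = 0 then a else 0)"
  by (simp add: teichmueller_def)

lemma witt_map_teichmueller: "h 0 = 0 \<Longrightarrow> witt_map h (teichmueller a) = teichmueller (h a)"
  by (rule witt_eqI) (simp add: wcoord_teichmueller)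

lemma wghost_teichmueller:
  "wghost (teichmueller a :: ('p::prime_card, 'k::comm_ring_1) witt) n = a ^ (CARD('p) ^ n)"
proof -
  have "wghost (teichmueller a :: ('p, 'k) witt) n =
      (\<Sum>i\<le>n. if i = 0 then a ^ (CARD('p) ^ n) else 0)"
    unfolding wghost_def ghost_def
    by (rule sum.cong) (auto simp: wcoord_teichmueller power_0_left)
  then show ?thesis by simp
qed

lemma teichmueller_0 [simp]: "teichmueller 0 = 0"
  by (rule witt_eqI) (simp add: wcoord_teichmueller)

lemma teichmueller_1 [simp]: "teichmueller 1 = 1"
  by (rule witt_eqI) (simp add: wcoord_teichmueller one_witt_def)

text \<open>Identities between Witt vectors are proved for vectors of indeterminates, where ghost components are
  injective, and then specialised by a ring homomorphism.\<close>

lemma teichmueller_mult: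
  "teichmueller (a * b) = (teichmueller a * teichmueller b :: ('p::prime_card, 'k::comm_ring_1) witt)"
proof -
  let ?h = "zeval id :: 'k zpoly \<Rightarrow> 'k"
  have "teichmueller (zvar a * zvar b) = (teichmueller (zvar a) * teichmueller (zvar b) :: ('p, 'k zpoly) witt)"
    by (rule wghost_inj) (simp add: wghost_teichmueller power_mult_distrib)
  then have "witt_map ?h (teichmueller (zvar a * zvar b)) =
      witt_map ?h (teichmueller (zvar a) * teichmueller (zvar b) :: ('p, 'k zpoly) witt)" by simp
  then show ?thesis
    by (simp add: rhom.witt_map_mult[OF rhom_zeval] witt_map_teichmueller zeval_mult)
qed

lemma teichmueller_power:
  "teichmueller (a ^ n) = (teichmueller a ^ n :: ('p::prime_card, 'k::comm_ring_1) witt)"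
  by (induction n) (simp_all add: teichmueller_mult)

lemma teichmueller_eq_iff [simp]: "teichmueller a = teichmueller b \<longleftrightarrow> a = b"
  by (metis wcoord_teichmueller)

section \<open>Verschiebung and multiplication by p\<close>

definition verschiebung :: "('p, 'k::zero) witt \<Rightarrow> ('p, 'k) witt" where
  "verschiebung x = Witt (\<lambda>n. case n of 0 \<Rightarrow> 0 | Suc m \<Rightarrow> wcoord x m)"

lemma wcoord_verschiebung [simp]:
  "wcoord (verschiebung x) 0 = 0" "wcoord (verschiebung x) (Suc n) = wcoord x n"
  by (simp_all add: verschiebung_def)

lemma wghost_verschiebung:
  "wghost (verschiebung x :: ('p::prime_card, 'k::comm_ring_1) witt) n =
     (case n of 0 \<Rightarrow> 0 | Suc m \<Rightarrow> of_nat CARD('p) * wghost x m)"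
  by (cases n) (simp_all add: wghost_def ghost_def sum.atMost_Suc_shift power_0_left
      sum_distrib_left mult.assoc del: sum.atMost_Suc)

text \<open>Both sides have ghost components \<open>x\<^sub>0\<^bsup>p^n\<^esup> + p w\<^sub>n\<^sub>-\<^sub>1(x\<^sub>1, x\<^sub>2, \<dots>)\<close>.\<close>

lemma witt_teichmueller_decomp:
  fixes x :: "('p::prime_card, 'k::comm_ring_1) witt"
  shows "x = teichmueller (wcoord x 0) + verschiebung (Witt (\<lambda>n. wcoord x (Suc n)))"
proof -
  let ?h = "witt_map (zeval id) :: ('p, 'k zpoly) witt \<Rightarrow> ('p, 'k) witt"
  define A :: "('p, 'k zpoly) witt" where "A = Witt (\<lambda>n. zvar (wcoord x n))"
  define B :: "('p, 'k zpoly) witt" where "B = Witt (\<lambda>n. zvar (wcoord x (Suc n)))"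
  have "A = teichmueller (zvar (wcoord x 0)) + verschiebung B"
  proof (rule wghost_inj)
    fix n
    show "wghost A n = wghost (teichmueller (zvar (wcoord x 0)) + verschiebung B) n"
      by (cases n) (simp_all add: wghost_teichmueller wghost_verschiebung, 
         simp_all add: A_def B_def wghost_def ghost_def sum.atMost_Suc_shift sum_distrib_left mult.assoc del: sum.atMost_Suc)
  qed
  then have "?h A = ?h (teichmueller (zvar (wcoord x 0)) + verschiebung B)" by simp
  moreover have "?h A = x" by (simp add: A_def witt_lift)
  moreover have "?h (verschiebung B) = verschiebung (Witt (\<lambda>n. wcoord x (Suc n)))"
  proof (rule witt_eqI)
    show "wcoord (?h (verschiebung B)) n = wcoord (verschiebung (Witt (\<lambda>n. wcoord x (Suc n)))) n" for n
      by (cases n) (simp_all add: B_def)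
  qed
  ultimately show ?thesis
    by (simp add: rhom.witt_map_add[OF rhom_zeval] witt_map_teichmueller)
qed

lemma zpoly_dvd_cancel:
  fixes x y :: "'v zpoly"
  assumes "of_nat n * x dvd of_nat n * y" "n > 0"
  shows "x dvd y"
proof -
  obtain z where "of_nat n * y = of_nat n * x * z" using assms(1) by (elim dvdE)
  then have "of_nat n * (y - x * z) = 0" by (simp add: algebra_simps)
  then have "y = x * z" using zpoly_torsion_free[OF _ assms(2)] by fastforce
  then show ?thesis by simp
qed

text \<open>A quantitative form of the injectivity of ghost components: if the coordinates below \<open>n\<close> agree modulo
  \<open>p\<close>, their contributions to the ghost component \<open>n\<close> agree modulo \<open>p\<^bsup>n+1\<^esup>\<close>, and \<open>p\<^sup>n\<close> can be cancelled.\<close>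

lemma ghost_cong_imp_coord_cong:
  fixes x y :: "nat \<Rightarrow> 'v zpoly"
  assumes p: "p > 0" and g: "\<And>n. of_nat (p ^ Suc n) dvd ghost p x n - ghost p y n"
  shows "of_nat p dvd x n - y n"
proof (induction n rule: less_induct)
  case (less n)
  have "of_nat (p ^ Suc n) dvd (\<Sum>i<n. of_nat (p ^ i) * (x i ^ (p ^ (n - i)) - y i ^ (p ^ (n - i))))"
  proof (rule dvd_sum)
    fix i assume i: "i \<in> {..<n}"
    then have "of_nat (p ^ i) * of_nat (p ^ Suc (n - i)) dvd
        of_nat (p ^ i) * (x i ^ (p ^ (n - i)) - y i ^ (p ^ (n - i)))"
      by (intro mult_dvd_mono[OF dvd_refl] dvd_power_diff less) simp
    moreover have "of_nat (p ^ i) * of_nat (p ^ Suc (n - i)) = (of_nat (p ^ Suc n) :: 'v zpoly)"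
      using i by (simp flip: of_nat_mult power_add of_nat_power power_Suc)
    ultimately show "of_nat (p ^ Suc n) dvd of_nat (p ^ i) * (x i ^ (p ^ (n - i)) - y i ^ (p ^ (n - i)))"
      by simp
  qed
  from dvd_diff[OF g[of n] this]
  have "of_nat (p ^ Suc n) dvd of_nat (p ^ n) * (x n - y n)"
    by (simp add: ghost_split right_diff_distrib sum_subtractf)
  then have "of_nat (p ^ n) * of_nat p dvd of_nat (p ^ n) * (x n - y n)"
    by (simp add: mult.commute)
  then show ?case by (rule zpoly_dvd_cancel) (use p in simp)
qed

lemma wghost_of_nat [simp]: "wghost (of_nat m :: ('p::prime_card, 'k::comm_ring_1) witt) n = of_nat m"
  by (induction m) simp_all

text \<open>Multiplication by \<open>p\<close> is \<open>V F\<close> in characteristic \<open>p\<close>. For indeterminates the ghost components \<open>n\<close> of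
  \<open>p x\<close> and of \<open>V (x\<^sub>i\<^sup>p)\<close> differ exactly by \<open>p\<^bsup>n+1\<^esup> x\<^sub>n\<close>, so that the coordinates agree modulo \<open>p\<close>.\<close>

lemma p_times_eq_verschiebung_frobenius:
  fixes x :: "('p::prime_card, 'k::comm_ring_1) witt"
  assumes char: "of_nat CARD('p) = (0::'k)"
  shows "of_nat CARD('p) * x = verschiebung (witt_map (\<lambda>a. a ^ CARD('p)) x)"
proof (rule witt_eqI)
  fix n
  let ?p = "CARD('p)"
  let ?h = "zeval id :: 'k zpoly \<Rightarrow> 'k"
  define A :: "('p, 'k zpoly) witt" where "A = Witt (\<lambda>n. zvar (wcoord x n))"
  define B where "B = verschiebung (witt_map (\<lambda>a. a ^ ?p) A)"
  have gB: "\<exists>t. wghost (of_nat ?p * A) n - wghost B n = of_nat (?p ^ Suc n) * t" for n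
  proof (cases n)
    case 0
    then show ?thesis
      by (intro exI[of _ "wcoord A 0"]) (simp add: wghost_verschiebung B_def, simp add: wghost_at_0)
  next
    case (Suc m)
    have "wghost A (Suc m) - wghost (witt_map (\<lambda>a. a ^ ?p) A) m = of_nat (?p ^ Suc m) * wcoord A (Suc m)"
      by (simp add: wghost_def ghost_def Suc_diff_le flip: power_mult)
    then have "of_nat ?p * (wghost A (Suc m) - wghost (witt_map (\<lambda>a. a ^ ?p) A) m) = of_nat (?p ^ Suc (Suc m)) * wcoord A (Suc m)"
      by (simp add: mult.assoc)
    then show ?thesis unfolding Suc 
      by (intro exI[of _ "wcoord A (Suc m)"]) (simp add: wghost_verschiebung B_def right_diff_distrib)
  qed
  have "of_nat ?p dvd wcoord (of_nat ?p * A) n - wcoord B n"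
  proof (rule ghost_cong_imp_coord_cong)
    show "?p > 0" by simp
    show "of_nat (?p ^ Suc n) dvd ghost ?p (wcoord (of_nat ?p * A)) n - ghost ?p (wcoord B) n" for n
      using gB[of n] unfolding wghost_def by (metis dvd_triv_left)
  qed
  then obtain t where t: "wcoord (of_nat ?p * A) n - wcoord B n = of_nat ?p * t" by (elim dvdE)
  have "?h (wcoord (of_nat ?p * A) n) - ?h (wcoord B n) = ?h (of_nat ?p * t)"
    unfolding t[symmetric] by (simp add: rhom.diff[OF rhom_zeval])
  also have "\<dots> = 0" by (simp add: zeval_mult rhom.of_nat[OF rhom_zeval] char)
  finally have "?h (wcoord (of_nat ?p * A) n) = ?h (wcoord B n)" by simp
  moreover have "?h (wcoord (of_nat ?p * A) n) = wcoord (of_nat ?p * x) n"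
  proof -
    have "witt_map ?h (of_nat ?p * A) = of_nat ?p * x"
      by (simp add: rhom.mult[OF rhom_witt_map[OF rhom_zeval]] rhom.of_nat[OF rhom_witt_map[OF rhom_zeval]] A_def witt_lift)
    then show ?thesis by (metis wcoord_witt_map)
  qed
  moreover have "?h (wcoord B n) = wcoord (verschiebung (witt_map (\<lambda>a. a ^ ?p) x)) n"
    by (cases n) (simp_all add: B_def A_def rhom.power[OF rhom_zeval])
  ultimately show "wcoord (of_nat ?p * x) n = wcoord (verschiebung (witt_map (\<lambda>a. a ^ ?p) x)) n" by simp
qed

section \<open>The algebraic closure of the prime field\<close>

lemma rhom_frobenius:
  assumes "prime p" "of_nat p = (0 :: 'a::comm_ring_1)"
  shows "rhom (\<lambda>x :: 'a. x ^ p)"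
proof
  show "(x + y) ^ p = x ^ p + y ^ p" for x y :: 'a
    using prime_dvd_add_power[OF assms(1), of x y] by (simp add: assms(2))
qed (simp_all add: power_mult_distrib)

lemma of_nat_p_Fpbar [simp]: "of_nat CARD('p) = (0 :: 'p::prime_card Fpbar)"
  using of_nat_CHAR[where 'a="'p Fpbar"] by simp

lemma rhom_frobenius_Fpbar: "rhom (\<lambda>x :: 'p::prime_card Fpbar. x ^ CARD('p))"
  by (rule rhom_frobenius[OF prime_card of_nat_p_Fpbar])

lemma mod_ring_frobenius: "a ^ CARD('p) = (a :: 'p::prime_card mod_ring)"
proof -
  obtain i where "a = of_nat i" using surj_of_nat_mod_ring by blast
  then show ?thesis by (simp only: rhom.of_nat[OF rhom_frobenius[OF prime_card of_nat_card_eq_0]])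
qed

lemma bij_frobenius_Fpbar: "bij (\<lambda>x :: 'p::prime_card Fpbar. x ^ CARD('p))"
proof (rule bijI)
  show "inj (\<lambda>x :: 'p Fpbar. x ^ CARD('p))"
  proof (rule injI)
    fix x y :: "'p Fpbar" assume "x ^ CARD('p) = y ^ CARD('p)"
    then have "(x - y) ^ CARD('p) = 0" by (simp add: rhom.diff[OF rhom_frobenius_Fpbar])
    then show "x = y" by simp
  qed
  show "surj (\<lambda>x :: 'p Fpbar. x ^ CARD('p))"
    using nth_root_exists[of "CARD('p)"] by (metis surjI zero_less_card_finite)
qed

lemma Fpbar_pth_power_eq_1: "x ^ CARD('p) ^ k = 1 \<longleftrightarrow> x = (1 :: 'p::prime_card Fpbar)"
proof (induction k)
  case (Suc k)
  have "x ^ CARD('p) ^ Suc k = (x ^ CARD('p) ^ k) ^ CARD('p)" by (simp add: mult.commute flip: power_mult)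
  also have "\<dots> = 1 \<longleftrightarrow> x ^ CARD('p) ^ k = 1"
    using bij_is_inj[OF bij_frobenius_Fpbar] by (metis (no_types, lifting) injD power_one)
  finally show ?case using Suc by simp
qed simp

text \<open>An algebraic element has only finitely many powers, because modulo its equation they are values of
  polynomials of bounded degree over a finite field. The \<open>p\<close>-part of its order is trivial by injectivity
  of Frobenius.\<close>

lemma Fpbar_unit_torsion:
  fixes x :: "'p::prime_card Fpbar"
  assumes "x \<noteq> 0"
  shows "\<exists>n>0. coprime n CARD('p) \<and> x ^ n = 1"
proof -
  obtain f :: "'p mod_ring poly" where f: "f \<noteq> 0" "poly (map_poly to_ac f) x = 0"
    using alg_closure_algebraic by blast
  define E where "E g = poly (map_poly to_ac g) x" for g :: "'p mod_ring poly"
  have E_add: "E (g + h) = E g + E h" and E_mult: "E (g * h) = E g * E h" for g h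
    unfolding E_def poly_altdef
  proof -
    have *: "map_poly to_ac (g + h) = map_poly to_ac g + map_poly to_ac h"
      by (rule poly_eqI) (simp add: coeff_map_poly)
    have **: "map_poly to_ac (g * h) = map_poly to_ac g * map_poly to_ac h"
      by (rule poly_eqI) (simp add: coeff_map_poly coeff_mult to_ac_sum)
    show "(\<Sum>i\<le>degree (map_poly to_ac (g + h)). poly.coeff (map_poly to_ac (g + h)) i * x ^ i) =
      (\<Sum>i\<le>degree (map_poly to_ac g). poly.coeff (map_poly to_ac g) i * x ^ i) +
      (\<Sum>i\<le>degree (map_poly to_ac h). poly.coeff (map_poly to_ac h) i * x ^ i)"
      unfolding poly_altdef[symmetric] * by simp
    show "(\<Sum>i\<le>degree (map_poly to_ac (g * h)). poly.coeff (map_poly to_ac (g * h)) i * x ^ i) =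
      (\<Sum>i\<le>degree (map_poly to_ac g). poly.coeff (map_poly to_ac g) i * x ^ i) *
      (\<Sum>i\<le>degree (map_poly to_ac h). poly.coeff (map_poly to_ac h) i * x ^ i)"
      unfolding poly_altdef[symmetric] ** by simp
  qed
  \<comment> \<open>Powers of \<open>x\<close> are the values at \<open>x\<close> of the powers of the indeterminate reduced modulo \<open>f\<close>.\<close>
  have "E ([:0, 1:] ^ i) = x ^ i" for i
    by (induction i) (auto simp: E_mult, auto simp: E_def map_poly_pCons one_pCons)
  then have "x ^ i = E (([:0, 1:] ^ i) mod f)" for i
    using E_add[of "f * ([:0, 1:] ^ i div f)" "([:0, 1:] ^ i) mod f"] f(2)
    by (simp add: E_mult, simp add: E_def)
  moreover have "([:0, 1:] ^ i) mod f \<in> {g. degree g \<le> degree f}" for i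
    using degree_mod_less'[of f "[:0, 1:] ^ i"] f(1) by (cases "[:0, 1:] ^ i mod f = 0") auto
  ultimately have "range (\<lambda>i. x ^ i) \<subseteq> E ` {g. degree g \<le> degree f}" by blast
  moreover have "finite {g :: 'p mod_ring poly. degree g \<le> degree f}"
  proof (rule finite_subset)
    show "{g :: 'p mod_ring poly. degree g \<le> degree f} \<subseteq> Poly ` {xs. set xs \<subseteq> UNIV \<and> length xs \<le> Suc (degree f)}"
    proof
      fix g :: "'p mod_ring poly" assume "g \<in> {g. degree g \<le> degree f}"
      then have "length (coeffs g) \<le> Suc (degree f)" by (cases "g = 0") (auto simp: length_coeffs_degree)
      then show "g \<in> Poly ` {xs. set xs \<subseteq> UNIV \<and> length xs \<le> Suc (degree f)}"
        by (intro image_eqI[of _ _ "coeffs g"]) auto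
    qed
    show "finite (Poly ` {xs :: 'p mod_ring list. set xs \<subseteq> UNIV \<and> length xs \<le> Suc (degree f)})"
      by (intro finite_imageI finite_lists_length_le) simp
  qed
  ultimately have "finite (range (\<lambda>i. x ^ i))" using finite_surj by blast
  then have "\<not> inj (\<lambda>i. x ^ i)" using finite_imageD infinite_UNIV_nat by blast
  then obtain i j where ij: "i < j" "x ^ i = x ^ j" by (metis injI linorder_neqE_nat)
  have "x ^ i * x ^ (j - i) = x ^ j" using ij(1) by (subst power_add[symmetric]) simp
  then have "x ^ i * x ^ (j - i) = x ^ i * 1" using ij(2) by simp
  then have "x ^ (j - i) = 1" using assms by simp
  moreover define n where "n = j - i"
  ultimately have n: "n > 0" "x ^ n = 1" using ij by simp_all
  obtain k m where km: "n = CARD('p) ^ k * m" "\<not> CARD('p) dvd m"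
    using n(1) prime_power_canonical[OF prime_card, of n] 
    by (metis mult.commute)
  then have "(x ^ m) ^ (CARD('p) ^ k) = 1" using n(2) by (simp add: mult.commute flip: power_mult)
  then have "x ^ m = 1" by (simp add: Fpbar_pth_power_eq_1)
  moreover have "coprime m CARD('p)" using km(2) by (metis coprime_commute prime_card prime_imp_coprime)
  ultimately show ?thesis using km n(1) by (intro exI[of _ m]) (auto intro: Nat.gr0I)
qed

text \<open>The polynomial \<open>X\<^sup>n - 1\<close> splits, and it has no double root since its derivative \<open>n X\<^bsup>n-1\<^esup>\<close> vanishes only
  at \<open>0\<close>.\<close>

lemma card_roots_of_unity_Fpbar:
  assumes n: "n > 0" "coprime n CARD('p)"
  shows "card {x :: 'p::prime_card Fpbar. x ^ n = 1} = n"
proof -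
  let ?f = "monom 1 n - 1 :: 'p Fpbar poly"
  have "degree ?f = n"
    using n(1) degree_add_eq_left[of "-1" "monom 1 n :: 'p Fpbar poly"] by (simp add: degree_monom_eq)
  then have f: "?f \<noteq> 0" "degree ?f = n" using n(1) by (metis degree_0 less_irrefl, simp)
  have lead: "lead_coeff ?f \<noteq> 0" using f(1) by (simp only: leading_coeff_0_iff not_False_eq_True)
  obtain A where A: "size A = n" "?f = smult (lead_coeff ?f) (\<Prod>x\<in>#A. [:-x, 1:])"
    using alg_closed_imp_factorization[OF f(1)] f(2) by metis
  have nz: "of_nat n \<noteq> (0 :: 'p Fpbar)"
    using n prime_card[where 'a='p]
    by (auto simp: of_nat_eq_0_iff_char_dvd dest: coprime_common_divisor_nat prime_gt_1_nat)
  have simple: "\<not> [:-a, 1:] * [:-a, 1:] dvd ?f" for a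
  proof
    assume "[:-a, 1:] * [:-a, 1:] dvd ?f"
    then obtain g where g: "?f = [:-a, 1:] * ([:-a, 1:] * g)" by (metis dvdE mult.assoc)
    then have "poly ?f a = 0" by simp
    then have a: "a ^ n = 1" by (simp add: poly_monom)
    have "poly (pderiv ?f) a = 0" unfolding g by (simp only: pderiv_mult poly_add poly_mult) simp
    then have "of_nat n * a ^ (n - 1) = 0" by (simp add: pderiv_diff pderiv_monom poly_monom)
    then have "a = 0" using nz by simp
    with a show False using n(1) by (simp add: power_0_left)
  qed
  have "count A a \<le> 1" for a
  proof (rule ccontr)
    assume "\<not> count A a \<le> 1"
    then have "{#a, a#} \<subseteq># A" by (simp add: subseteq_mset_def)
    then obtain B where "A = {#a, a#} + B" by (metis subset_mset.le_iff_add)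
    then have "(\<Prod>x\<in>#A. [:-x, 1:]) = [:-a, 1:] * [:-a, 1:] * (\<Prod>x\<in>#B. [:-x, 1:])"
      by (simp del: mult_pCons_left add: mult.assoc)
    then have "[:-a, 1:] * [:-a, 1:] dvd (\<Prod>x\<in>#A. [:-x, 1:])" by (metis dvd_triv_left)
    then show False using simple[of a] by (metis A(2) dvd_smult)
  qed
  then have "count A a = (if a \<in># A then 1 else 0)" for a
    using count_greater_zero_iff[of A a] by (metis One_nat_def Suc_leI le_antisym not_in_iff)
  then have "A = mset_set (set_mset A)" by (intro multiset_eqI) (simp add: count_mset_set')
  then have "card (set_mset A) = n" using A(1) by (metis size_mset_set)
  moreover have "set_mset A = {x. x ^ n = 1}"
  proof (rule Set.set_eqI)
    fix x
    have "x \<in># A \<longleftrightarrow> poly ?f x = 0"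
      unfolding arg_cong[OF A(2), of "\<lambda>g. poly g x"] using lead
      by (auto simp: poly_prod_mset prod_mset_zero_iff image_iff)
    then show "x \<in># A \<longleftrightarrow> x \<in> {x. x ^ n = 1}" by (simp add: poly_monom)
  qed
  ultimately show ?thesis by simp
qed

section \<open>The ring of Witt vectors of the algebraic closure of the prime field\<close>

lemma rhom_Fr: "rhom (Fr :: 'p::prime_card ring_O \<Rightarrow> _)"
  unfolding Fr_def by (rule rhom_witt_map[OF rhom_frobenius_Fpbar])

lemma bij_Fr: "bij (Fr :: 'p::prime_card ring_O \<Rightarrow> _)"
proof (rule o_bij)
  let ?g = "inv_into UNIV (\<lambda>x :: 'p Fpbar. x ^ CARD('p))"
  show "witt_map ?g \<circ> Fr = (id :: 'p ring_O \<Rightarrow> _)"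
    by (rule ext, rule witt_eqI) (simp add: Fr_def inv_into_f_f[OF bij_is_inj[OF bij_frobenius_Fpbar]])
  show "Fr \<circ> witt_map ?g = (id :: 'p ring_O \<Rightarrow> _)"
    by (rule ext, rule witt_eqI) 
      (simp add: Fr_def surj_f_inv_f[OF bij_is_surj[OF bij_frobenius_Fpbar]])
qed

lemma Fr_teichmueller: "Fr (teichmueller a) = teichmueller (a ^ CARD('p) :: 'p::prime_card Fpbar)"
  unfolding Fr_def by (rule witt_map_teichmueller) (simp add: power_0_left)

lemma wcoord_p_times [simp]:
  fixes x :: "'p::prime_card ring_O"
  shows "wcoord (of_nat CARD('p) * x) 0 = 0"
    and "wcoord (of_nat CARD('p) * x) (Suc n) = wcoord x n ^ CARD('p)"
  by (simp_all add: p_times_eq_verschiebung_frobenius[OF of_nat_p_Fpbar])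

text \<open>The field is perfect, so \<open>F\<close> is invertible and \<open>V = p F\<^sup>-\<^sup>1\<close>.\<close>

lemma verschiebung_divisible:
  fixes x :: "'p::prime_card ring_O"
  shows "\<exists>y. verschiebung x = of_nat CARD('p) * y"
proof
  let ?g = "inv_into UNIV (\<lambda>x :: 'p Fpbar. x ^ CARD('p))"
  show "verschiebung x = of_nat CARD('p) * witt_map ?g x"
  proof (rule witt_eqI)
    show "wcoord (verschiebung x) n = wcoord (of_nat CARD('p) * witt_map ?g x) n" for n
      by (cases n) (simp_all add: surj_f_inv_f[OF bij_is_surj[OF bij_frobenius_Fpbar]])
  qed
qed

lemma ring_O_decomp:
  fixes x :: "'p::prime_card ring_O"
  shows "\<exists>y. x = teichmueller (wcoord x 0) + of_nat CARD('p) * y"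
  using witt_teichmueller_decomp[of x] verschiebung_divisible by metis

lemma p_dvd_ring_O_iff: "of_nat CARD('p) dvd x \<longleftrightarrow> wcoord x 0 = 0" for x :: "'p::prime_card ring_O"
  using ring_O_decomp[of x] by (auto simp: dvd_def)

lemma p_torsion_free_ring_O:
  fixes x :: "'p::prime_card ring_O"
  assumes "of_nat CARD('p) * x = 0"
  shows "x = 0"
proof (rule witt_eqI)
  fix n
  have "wcoord x n ^ CARD('p) = 0" unfolding wcoord_p_times(2)[symmetric] by (simp add: assms)
  then show "wcoord x n = wcoord 0 n" by simp
qed

lemma wcoord_p_power_times:
  fixes x :: "'p::prime_card ring_O"
  shows "n < k \<Longrightarrow> wcoord (of_nat CARD('p) ^ k * x) n = 0"
proof (induction k arbitrary: n)
  case (Suc k)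
  then show ?case by (cases n) (simp_all add: mult.assoc power_0_left)
qed simp

lemma ring_O_separated:
  fixes x :: "'p::prime_card ring_O"
  assumes "\<And>k. of_nat CARD('p) ^ k dvd x"
  shows "x = 0"
proof (rule witt_eqI)
  show "wcoord x n = wcoord 0 n" for n
    using assms[of "Suc n"] wcoord_p_power_times[of n "Suc n"] by (auto simp: dvd_def)
qed

text \<open>The exponent \<open>i\<close> is the index of the first non-zero coordinate.\<close>

lemma ring_O_unit_part:
  fixes x :: "'p::prime_card ring_O"
  assumes "x \<noteq> 0"
  shows "\<exists>i u. x = of_nat CARD('p) ^ i * u \<and> wcoord u 0 \<noteq> 0"
proof -
  have *: "\<exists>i u. x = of_nat CARD('p) ^ i * u \<and> wcoord u 0 \<noteq> 0" if "wcoord x n \<noteq> 0"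
    for n and x :: "'p ring_O"
    using that
  proof (induction n arbitrary: x)
    case 0
    then show ?case by (intro exI[of _ 0] exI[of _ x]) simp
  next
    case (Suc n)
    show ?case
    proof (cases "wcoord x 0 = 0")
      case True
      then obtain y where y: "x = of_nat CARD('p) * y" using p_dvd_ring_O_iff by (metis dvdE)
      then have "wcoord y n \<noteq> 0" using Suc.prems by (auto simp: power_0_left)
      then obtain i u where "y = of_nat CARD('p) ^ i * u" "wcoord u 0 \<noteq> 0" using Suc.IH by blast
      then show ?thesis by (intro exI[of _ "Suc i"] exI[of _ u]) (simp add: y mult.assoc)
    qed (intro exI[of _ 0] exI[of _ x], simp)
  qed
  then show ?thesis using assms by (metis witt_eqI wcoord_0_witt)
qed

lemma p_power_torsion_free_ring_O:
  fixes x :: "'p::prime_card ring_O"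
  shows "of_nat CARD('p) ^ k * x = 0 \<Longrightarrow> x = 0"
  by (induction k) (auto simp: mult.assoc dest: p_torsion_free_ring_O)

lemma ring_O_mult_eq_0_iff:
  fixes x y :: "'p::prime_card ring_O"
  shows "x * y = 0 \<longleftrightarrow> x = 0 \<or> y = 0"
proof
  assume xy: "x * y = 0"
  show "x = 0 \<or> y = 0"
  proof (rule ccontr)
    assume "\<not> (x = 0 \<or> y = 0)"
    then obtain i u j v where uv: "x = of_nat CARD('p) ^ i * u" "wcoord u 0 \<noteq> 0"
      "y = of_nat CARD('p) ^ j * v" "wcoord v 0 \<noteq> 0"
      using ring_O_unit_part by metis
    then have "of_nat CARD('p) ^ (i + j) * (u * v) = 0" using xy by (simp add: power_add mult_ac)
    then have "u * v = 0" by (rule p_power_torsion_free_ring_O)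
    then have "wcoord u 0 * wcoord v 0 = 0" by (metis rhom.mult[OF rhom_wcoord_0] wcoord_0_witt)
    with uv show False by simp
  qed
qed auto

lemma of_nat_ring_O_neq_0:
  assumes "n > 0"
  shows "of_nat n \<noteq> (0 :: 'p::prime_card ring_O)"
proof
  assume n0: "of_nat n = (0 :: 'p ring_O)"
  obtain k m where km: "n = CARD('p) ^ k * m" "\<not> CARD('p) dvd m"
    using assms prime_power_canonical[OF prime_card, of n] by (metis mult.commute)
  then have "of_nat CARD('p) ^ k * of_nat m = (0 :: 'p ring_O)" using n0 by simp
  then have "of_nat m = (0 :: 'p ring_O)" by (rule p_power_torsion_free_ring_O)
  then have "of_nat m = (0 :: 'p Fpbar)" by (metis rhom.of_nat[OF rhom_wcoord_0] wcoord_0_witt)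
  then show False using km(2) by (simp add: of_nat_eq_0_iff_char_dvd)
qed

lemma additive_of_nat_mult:
  fixes f :: "'a::comm_ring_1 \<Rightarrow> 'b::comm_ring_1"
  assumes "Modules.additive f"
  shows "f (of_nat n * x) = of_nat n * f x"
  by (induction n) (simp_all add: additive.zero[OF assms] additive.add[OF assms] distrib_right)

text \<open>Teichmueller representatives span a dense subgroup, and additive maps are automatically \<open>p\<close>-adically
  continuous. Concretely, writing \<open>x = \<tau>(x\<^sub>0) + p y\<close> gives \<open>f x = p f y\<close>, and iterating shows that \<open>f x\<close> is divisible by
  every power of \<open>p\<close>.\<close>

lemma additive_ring_O_eq_0:
  fixes f :: "'p::prime_card ring_O \<Rightarrow> 'p ring_O"
  assumes f: "Modules.additive f" and tau: "\<And>a. f (teichmueller a) = 0"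
  shows "f x = 0"
proof (rule ring_O_separated)
  show "of_nat CARD('p) ^ k dvd f x" for k
  proof (induction k arbitrary: x)
    case (Suc k)
    obtain y where "x = teichmueller (wcoord x 0) + of_nat CARD('p) * y" using ring_O_decomp by blast
    then have "f x = of_nat CARD('p) * f y"
      by (metis add_0 additive.add[OF f] additive_of_nat_mult[OF f] tau)
    then show ?case using Suc by (simp add: mult_dvd_mono)
  qed simp
qed

section \<open>The product of the p-adic topologies\<close>

lemma open_O_Ip_imp_cylinder:
  fixes U :: "'p::prime_card O_Ip set"
  assumes "open U" "x \<in> U"
  shows "\<exists>A k. finite A \<and> (\<forall>y. (\<forall>m\<in>A. of_nat CARD('p) ^ k dvd y m - x m) \<longrightarrow> y \<in> U)"
proof -
  have "openin (product_topology (\<lambda>i. euclidean) UNIV) U"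
    using assms(1) by (simp add: open_fun_def)
  from product_topology_open_contains_basis[OF this assms(2)]
  have "\<exists>B. (\<forall>i. x i \<in> B i) \<and> (\<forall>i. open (B i)) \<and> finite {i. B i \<noteq> UNIV} \<and> (\<forall>y. (\<forall>i. y i \<in> B i) \<longrightarrow> y \<in> U)"
    by (auto simp: PiE_UNIV_domain Pi_iff subset_iff)
  then obtain B where B: "\<And>i. x i \<in> B i" "\<And>i. open (B i)" "finite {i. B i \<noteq> UNIV}"
    "\<And>y. (\<And>i. y i \<in> B i) \<Longrightarrow> y \<in> U"
    by blast
  have "\<forall>i. \<exists>k. \<forall>z. of_nat CARD('p) ^ k dvd z - x i \<longrightarrow> z \<in> B i"
    using B(1,2) unfolding open_witt_def by auto
  then obtain k where k: "\<And>i z. of_nat CARD('p) ^ k i dvd z - x i \<Longrightarrow> z \<in> B i" by metis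
  let ?A = "{i. B i \<noteq> UNIV}"
  define K where "K = Max (insert 0 (k ` ?A))"
  have "y \<in> U" if y: "\<forall>m\<in>?A. of_nat CARD('p) ^ K dvd y m - x m" for y
  proof -
    have "y i \<in> B i" for i
    proof (cases "i \<in> ?A")
      case True
      then have "k i \<le> K" using B(3) by (simp add: K_def)
      then show ?thesis using y True by (meson dvd_trans k le_imp_power_dvd)
    qed simp
    then show ?thesis by (rule B(4))
  qed
  then show ?thesis using B(3) by blast
qed

lemma open_p_adic_ball: "open {z :: ('p::prime_card, 'k::comm_ring_1) witt. of_nat CARD('p) ^ k dvd z - c}"
  unfolding open_witt_def
proof (intro ballI exI allI impI)
  fix x y assume "x \<in> {z :: ('p, 'k) witt. of_nat CARD('p) ^ k dvd z - c}" "of_nat CARD('p) ^ k dvd y - x"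
  then have "of_nat CARD('p) ^ k dvd (x - c) + (y - x)" by (intro dvd_add) auto
  then show "y \<in> {z. of_nat CARD('p) ^ k dvd z - c}" by simp
qed

lemma open_p_adic_cylinder: "open {y :: 'p::prime_card O_Ip. of_nat CARD('p) ^ k dvd y m - c}"
proof -
  have "open ((\<lambda>y :: 'p O_Ip. y m) -` {z. of_nat CARD('p) ^ k dvd z - c})"
    by (rule open_vimage[OF open_p_adic_ball]) simp
  then show ?thesis by (simp add: vimage_def)
qed

text \<open>Continuity at \<open>0\<close> with the same exponent \<open>k\<close> in source and target; all operators below satisfy this stronger
  condition, which is stable under composition.\<close>

definition p_adic_map :: "('p::prime_card O_Ip \<Rightarrow> 'p O_Ip) \<Rightarrow> bool" where
  "p_adic_map f \<longleftrightarrow> (\<forall>m k. \<exists>A. finite A \<and>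
     (\<forall>x. (\<forall>i\<in>A. of_nat CARD('p) ^ k dvd x i) \<longrightarrow> of_nat CARD('p) ^ k dvd f x m))"

lemma continuous_p_adic_map:
  fixes f :: "'p::prime_card O_Ip \<Rightarrow> 'p O_Ip"
  assumes f: "Modules.additive f" "p_adic_map f"
  shows "continuous_on UNIV f"
proof (rule continuous_on_coordinatewise_then_product)
  fix m
  show "continuous_on UNIV (\<lambda>x. f x m)"
    unfolding continuous_on_open_vimage[OF open_UNIV]
  proof (intro allI impI)
    fix B :: "'p ring_O set" assume B: "open B"
    show "open ((\<lambda>x. f x m) -` B \<inter> UNIV)"
    proof (subst open_subopen, intro ballI)
      fix x assume "x \<in> (\<lambda>x. f x m) -` B \<inter> UNIV"
      then obtain k where k: "\<And>z. of_nat CARD('p) ^ k dvd z - f x m \<Longrightarrow> z \<in> B"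
        using B unfolding open_witt_def by auto
      obtain A where A: "finite A"
        "\<And>y. (\<forall>i\<in>A. of_nat CARD('p) ^ k dvd y i) \<Longrightarrow> of_nat CARD('p) ^ k dvd f y m"
        using f(2) unfolding p_adic_map_def by metis
      let ?T = "\<Inter>i\<in>A. {y. of_nat CARD('p) ^ k dvd y i - x i}"
      have "y \<in> (\<lambda>x. f x m) -` B" if "y \<in> ?T" for y
      proof -
        have "of_nat CARD('p) ^ k dvd f (y - x) m" using that by (intro A(2)) auto
        then show ?thesis using k by (simp add: additive.diff[OF f(1)])
      qed
      moreover have "open ?T" using A(1) by (intro open_INT ballI open_p_adic_cylinder)
      moreover have "x \<in> ?T" by simp
      ultimately show "\<exists>T. open T \<and> x \<in> T \<and> T \<subseteq> (\<lambda>x. f x m) -` B \<inter> UNIV" by blast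
    qed
  qed
qed

lemma sum_scaleO_eps:
  assumes "finite A"
  shows "(\<Sum>i\<in>A. scaleO (x i) (eps i)) = (\<lambda>m. if m \<in> A then x m else 0)"
  using assms
proof (induction)
  case empty
  then show ?case by (simp add: fun_eq_iff zero_fun_def)
next
  case (insert a A)
  then show ?case by (auto simp: fun_eq_iff scaleO_def eps_def)
qed

text \<open>Finitely supported vectors are dense and the topology is Hausdorff.\<close>

lemma continuous_additive_eqI:
  fixes f g :: "'p::prime_card O_Ip \<Rightarrow> 'p O_Ip"
  assumes f: "Modules.additive f" "continuous_on UNIV f" and g: "Modules.additive g" "continuous_on UNIV g"
    and eq: "\<And>m c. f (scaleO c (eps m)) = g (scaleO c (eps m))"
  shows "f = g"
proof (intro ext)
  fix x m
  have "f x m - g x m = 0"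
  proof (rule ring_O_separated)
    fix k
    let ?U = "f -` {y. of_nat CARD('p) ^ k dvd y m - f x m} \<inter> g -` {y. of_nat CARD('p) ^ k dvd y m - g x m}"
    have "open ?U"
      by (intro open_Int open_vimage open_p_adic_cylinder f g)
    then obtain A j where A: "finite A" "\<And>y. (\<forall>m\<in>A. of_nat CARD('p) ^ j dvd y m - x m) \<Longrightarrow> y \<in> ?U"
      using open_O_Ip_imp_cylinder[of ?U x] by auto
    define y where "y = (\<Sum>i\<in>A. scaleO (x i) (eps i))"
    have "y \<in> ?U" by (rule A(2)) (simp add: y_def sum_scaleO_eps[OF A(1)])
    moreover have "f y = g y"
      unfolding y_def by (simp add: additive.sum[OF f(1)] additive.sum[OF g(1)] eq)
    ultimately have *: "of_nat CARD('p) ^ k dvd g y m - g x m" "of_nat CARD('p) ^ k dvd g y m - f x m"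
      by auto
    from dvd_diff[OF *] show "of_nat CARD('p) ^ k dvd f x m - g x m" by simp
  qed
  then show "f x m = g x m" by simp
qed

lemma rhom_funpow:
  fixes f :: "'a::comm_ring_1 \<Rightarrow> 'a"
  assumes "rhom f" shows "rhom (f ^^ a)"
proof (induction a)
  case 0
  show ?case by (simp add: rhom_def)
next
  case (Suc a)
  then show ?case
    by (auto intro!: rhom.intro simp: rhom.add[OF assms] rhom.mult[OF assms] rhom.one[OF assms]
        rhom.add[OF Suc] rhom.mult[OF Suc] rhom.one[OF Suc])
qed

section \<open>Torsion in \<open>\<rat>/\<int>\<close>\<close>

lemma qz_scale_add [simp]: "qz_scale n (x + y) = qz_scale n x + qz_scale n y"
  by transfer (simp add: algebra_simps)

lemma qz_scale_0 [simp]: "qz_scale n 0 = 0" "qz_scale 0 x = 0"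
  by (transfer, simp)+

lemma qz_scale_1 [simp]: "qz_scale 1 x = x" "qz_scale (Suc 0) x = x"
  by (transfer, simp)+

lemma qz_scale_add_left: "qz_scale (m + n) x = qz_scale m x + qz_scale n x"
  by transfer (simp add: algebra_simps)

lemma qz_scale_qz_scale: "qz_scale m (qz_scale n x) = qz_scale (m * n) x"
  by transfer (simp add: mult.assoc)

lemma qz_scale_diff [simp]: "qz_scale n (x - y) = qz_scale n x - qz_scale n y"
  by (metis add_diff_cancel_right' diff_add_cancel qz_scale_add)

lemma qz_eq_0_iff: "abs_qz r = 0 \<longleftrightarrow> r \<in> \<int>"
  by (simp add: zero_qz_def qz.abs_eq_iff)

lemma qz_torsion_iff:
  assumes n: "n > 0"
  shows "qz_scale n \<gamma> = 0 \<longleftrightarrow> (\<exists>a. \<gamma> = abs_qz (of_int a / of_nat n))"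
proof
  assume *: "qz_scale n \<gamma> = 0"
  obtain r where r: "\<gamma> = abs_qz r" by (metis Quotient3_abs_rep Quotient3_qz)
  then have "of_nat n * r \<in> \<int>" using * by (simp add: qz_scale.abs_eq qz_eq_0_iff)
  then obtain a where "of_nat n * r = of_int a" by (auto elim: Ints_cases)
  then have "r = of_int a / of_nat n" using n by (simp add: field_simps)
  then show "\<exists>a. \<gamma> = abs_qz (of_int a / of_nat n)" using r by blast
qed (use n in \<open>auto simp: qz_scale.abs_eq qz_eq_0_iff\<close>)

lemma qz_torsion: "\<exists>n>0. qz_scale n \<gamma> = 0"
proof -
  obtain r where r: "\<gamma> = abs_qz r" by (metis Quotient3_abs_rep Quotient3_qz)
  obtain a b where ab: "quotient_of r = (a, b)" by fastforce
  then have b: "b > 0" "r = of_int a / of_int b" by (simp_all add: quotient_of_denom_pos quotient_of_div)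
  then have "of_nat (nat b) * r = of_int a" by simp
  then show ?thesis using b(1) by (intro exI[of _ "nat b"]) (simp add: r qz_scale.abs_eq qz_eq_0_iff)
qed

lemma qz_prime_to_iff: "\<gamma> \<in> qz_prime_to p \<longleftrightarrow> (\<exists>n>0. coprime n p \<and> qz_scale n \<gamma> = 0)"
  unfolding qz_prime_to_def using qz_torsion_iff by blast

lemma qz_scale_coprime_inj:
  assumes "coprime m n" "qz_scale m \<gamma> = 0" "qz_scale n \<gamma> = 0"
  shows "\<gamma> = 0"
proof -
  obtain r where r: "\<gamma> = abs_qz r" by (metis Quotient3_abs_rep Quotient3_qz)
  have mn: "of_nat m * r \<in> \<int>" "of_nat n * r \<in> \<int>"
    using assms(2,3) by (simp_all add: r qz_scale.abs_eq qz_eq_0_iff)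
  obtain u v where uv: "u * int m + v * int n = 1"
    using assms(1) by (metis bezout_int coprime_iff_gcd_eq_1 coprime_int_iff)
  have "r = of_int (u * int m + v * int n) * r" unfolding uv by simp
  also have "\<dots> = of_int u * (of_nat m * r) + of_int v * (of_nat n * r)" by (simp add: algebra_simps)
  finally have "r \<in> \<int>" using mn by (metis Ints_add Ints_mult Ints_of_int)
  then show ?thesis by (simp add: r qz_eq_0_iff)
qed

section \<open>The character of \<open>\<rat>/\<int>\<close> attached to an embedding of the units\<close>

locale unit_embedding =
  fixes \<sigma> :: "'p::prime_card Fpbar \<Rightarrow> qz"
  assumes inj_unit_hom: "inj_unit_hom \<sigma>"
begin

lemma sigma_mult: "x \<noteq> 0 \<Longrightarrow> y \<noteq> 0 \<Longrightarrow> \<sigma> (x * y) = \<sigma> x + \<sigma> y"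
  using inj_unit_hom by (simp add: inj_unit_hom_def)

lemma sigma_inj: "x \<noteq> 0 \<Longrightarrow> y \<noteq> 0 \<Longrightarrow> \<sigma> x = \<sigma> y \<longleftrightarrow> x = y"
  using inj_unit_hom by (auto simp: inj_unit_hom_def inj_on_def)

lemma sigma_1: "\<sigma> 1 = 0"
  using sigma_mult[of 1 1] by simp

lemma sigma_power: "x \<noteq> 0 \<Longrightarrow> \<sigma> (x ^ n) = qz_scale n (\<sigma> x)"
proof (induction n)
  case (Suc n)
  then show ?case using qz_scale_add_left[of 1 n "\<sigma> x"] by (simp add: sigma_mult)
qed (simp add: sigma_1)

lemma sigma_prime_to: "x \<noteq> 0 \<Longrightarrow> \<sigma> x \<in> qz_prime_to CARD('p)"
  using Fpbar_unit_torsion[of x] by (metis qz_prime_to_iff sigma_1 sigma_power)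

text \<open>The embedding maps the \<open>n\<close>-th roots of unity injectively into the elements killed by \<open>n\<close>; both sets have
  \<open>n\<close> elements.\<close>

lemma sigma_surj:
  assumes "\<gamma> \<in> qz_prime_to CARD('p)"
  shows "\<exists>x. x \<noteq> 0 \<and> \<sigma> x = \<gamma>"
proof -
  obtain n where n: "n > 0" "coprime n CARD('p)" "qz_scale n \<gamma> = 0"
    using assms qz_prime_to_iff by blast
  let ?R = "{x :: 'p Fpbar. x ^ n = 1}"
  have R: "x \<noteq> 0" if "x \<in> ?R" for x using that n(1) by (auto simp: power_0_left)
  have "inj_on \<sigma> ?R" by (rule inj_onI) (use R sigma_inj in blast)
  then have "card (\<sigma> ` ?R) = card {\<gamma>'. qz_scale n \<gamma>' = 0}"
    by (simp add: card_image card_roots_of_unity_Fpbar[OF n(1,2)] card_qz_scale[OF n(1)])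
  moreover have "\<sigma> ` ?R \<subseteq> {\<gamma>'. qz_scale n \<gamma>' = 0}"
    using R by (auto simp: sigma_1 simp flip: sigma_power)
  moreover have "finite {\<gamma>'. qz_scale n \<gamma>' = 0}"
    using card_qz_scale[OF n(1)] n(1) by (metis card.infinite less_irrefl)
  ultimately have "\<sigma> ` ?R = {\<gamma>'. qz_scale n \<gamma>' = 0}" by (intro card_subset_eq) auto
  then show ?thesis using n(3) R by (metis (mono_tags, lifting) image_iff mem_Collect_eq)
qed

lemma the_inv_sigma: "x \<noteq> 0 \<Longrightarrow> the_inv_into (- {0}) \<sigma> (\<sigma> x) = x"
  using inj_unit_hom by (intro the_inv_into_f_f) (auto simp: inj_unit_hom_def)

text \<open>The composite of the projection of \<open>\<rat>/\<int>\<close> onto its prime-to-\<open>p\<close> part with the inverse of \<open>\<sigma>\<close>. Two elements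
  have the same prime-to-\<open>p\<close> part iff they agree after multiplication by a power of \<open>p\<close>, which avoids
  choosing a decomposition.\<close>

definition sigma_inv :: "qz \<Rightarrow> 'p Fpbar" where
  "sigma_inv \<gamma> = (THE x. x \<noteq> 0 \<and> (\<exists>k. qz_scale (CARD('p) ^ k) (\<sigma> x) = qz_scale (CARD('p) ^ k) \<gamma>))"

lemma sigma_inv_unique:
  assumes "x \<noteq> 0" "qz_scale (CARD('p) ^ k) (\<sigma> x) = qz_scale (CARD('p) ^ k) \<gamma>"
    "y \<noteq> 0" "qz_scale (CARD('p) ^ l) (\<sigma> y) = qz_scale (CARD('p) ^ l) \<gamma>"
  shows "x = y"
proof -
  have "qz_scale (CARD('p) ^ (k + l)) (\<sigma> x) = qz_scale (CARD('p) ^ (k + l)) \<gamma>"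
    using arg_cong[OF assms(2), of "qz_scale (CARD('p) ^ l)"]
    by (simp add: qz_scale_qz_scale power_add mult.commute)
  moreover have "qz_scale (CARD('p) ^ (k + l)) (\<sigma> y) = qz_scale (CARD('p) ^ (k + l)) \<gamma>"
    using arg_cong[OF assms(4), of "qz_scale (CARD('p) ^ k)"]
    by (simp add: qz_scale_qz_scale power_add mult.commute)
  ultimately have "\<sigma> (x ^ (CARD('p) ^ (k + l))) = \<sigma> (y ^ (CARD('p) ^ (k + l)))"
    using assms(1,3) by (simp only: sigma_power[OF assms(1)] sigma_power[OF assms(3)])
  then have "x ^ (CARD('p) ^ (k + l)) = y ^ (CARD('p) ^ (k + l))" using assms(1,3) by (simp add: sigma_inj)
  then have "(x / y) ^ (CARD('p) ^ (k + l)) = 1" using assms(3) by (simp add: power_divide)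
  then show "x = y" using assms(3) by (simp add: Fpbar_pth_power_eq_1)
qed

text \<open>For large \<open>k\<close> the element \<open>p\<^sup>k \<gamma>\<close> is some \<open>\<sigma> y\<close>; take the \<open>p\<^sup>k\<close>-th root of \<open>y\<close>.\<close>

lemma sigma_inv_exists: "\<exists>x. x \<noteq> 0 \<and> (\<exists>k. qz_scale (CARD('p) ^ k) (\<sigma> x) = qz_scale (CARD('p) ^ k) \<gamma>)"
proof -
  obtain n where n: "n > 0" "qz_scale n \<gamma> = 0" using qz_torsion by blast
  obtain k m where km: "n = CARD('p) ^ k * m" "\<not> CARD('p) dvd m"
    using n(1) prime_power_canonical[OF prime_card, of n] by (metis mult.commute)
  have m: "coprime m CARD('p)" using km(2) by (metis coprime_commute prime_card prime_imp_coprime)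
  have "m > 0" using n(1) km by (cases m) auto
  then have "qz_scale (CARD('p) ^ k) \<gamma> \<in> qz_prime_to CARD('p)"
    using m n(2) by (auto simp: qz_prime_to_iff qz_scale_qz_scale km mult.commute)
  then obtain y where y: "y \<noteq> 0" "\<sigma> y = qz_scale (CARD('p) ^ k) \<gamma>" using sigma_surj by blast
  obtain x where x: "x ^ (CARD('p) ^ k) = y" using nth_root_exists[of "CARD('p) ^ k" y] by auto
  then have "x \<noteq> 0" using y by (auto simp: power_0_left)
  then show ?thesis using x y by (intro exI[of _ x]) (auto simp flip: sigma_power)
qed

lemma sigma_inv_spec: "sigma_inv \<gamma> \<noteq> 0" "\<exists>k. qz_scale (CARD('p) ^ k) (\<sigma> (sigma_inv \<gamma>)) = qz_scale (CARD('p) ^ k) \<gamma>"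
proof -
  have "\<exists>!x. x \<noteq> 0 \<and> (\<exists>k. qz_scale (CARD('p) ^ k) (\<sigma> x) = qz_scale (CARD('p) ^ k) \<gamma>)"
    by (rule ex_ex1I[OF sigma_inv_exists]) (elim conjE exE, rule sigma_inv_unique)
  from theI'[OF this] show "sigma_inv \<gamma> \<noteq> 0"
    "\<exists>k. qz_scale (CARD('p) ^ k) (\<sigma> (sigma_inv \<gamma>)) = qz_scale (CARD('p) ^ k) \<gamma>"
    by (simp_all add: sigma_inv_def)
qed

lemma sigma_inv_eqI:
  assumes "x \<noteq> 0" "qz_scale (CARD('p) ^ k) (\<sigma> x) = qz_scale (CARD('p) ^ k) \<gamma>"
  shows "sigma_inv \<gamma> = x"
proof -
  obtain l where "qz_scale (CARD('p) ^ l) (\<sigma> (sigma_inv \<gamma>)) = qz_scale (CARD('p) ^ l) \<gamma>" using sigma_inv_spec(2) by blast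
  then show ?thesis by (rule sigma_inv_unique[OF sigma_inv_spec(1) _ assms])
qed

lemma sigma_inv_sigma: "x \<noteq> 0 \<Longrightarrow> sigma_inv (\<sigma> x) = x"
  by (rule sigma_inv_eqI) simp_all

lemma sigma_inv_add: "sigma_inv (\<gamma> + \<delta>) = sigma_inv \<gamma> * sigma_inv \<delta>"
proof -
  obtain k where k: "qz_scale (CARD('p) ^ k) (\<sigma> (sigma_inv \<gamma>)) = qz_scale (CARD('p) ^ k) \<gamma>" using sigma_inv_spec by blast
  obtain l where l: "qz_scale (CARD('p) ^ l) (\<sigma> (sigma_inv \<delta>)) = qz_scale (CARD('p) ^ l) \<delta>" using sigma_inv_spec by blast
  have "qz_scale (CARD('p) ^ (k + l)) (\<sigma> (sigma_inv \<gamma>)) = qz_scale (CARD('p) ^ (k + l)) \<gamma>"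
    using arg_cong[OF k, of "qz_scale (CARD('p) ^ l)"] by (simp add: qz_scale_qz_scale power_add mult.commute)
  moreover have "qz_scale (CARD('p) ^ (k + l)) (\<sigma> (sigma_inv \<delta>)) = qz_scale (CARD('p) ^ (k + l)) \<delta>"
    using arg_cong[OF l, of "qz_scale (CARD('p) ^ k)"] by (simp add: qz_scale_qz_scale power_add mult.commute)
  ultimately show ?thesis
    by (intro sigma_inv_eqI[of _ "k + l"]) (simp_all add: sigma_inv_spec sigma_mult)
qed

lemma sigma_inv_0: "sigma_inv 0 = 1"
  by (rule sigma_inv_eqI) (simp_all add: sigma_1)

lemma sigma_inv_scale: "sigma_inv (qz_scale n \<gamma>) = sigma_inv \<gamma> ^ n"
proof (induction n)
  case (Suc n)
  then show ?case using qz_scale_add_left[of 1 n \<gamma>] by (simp add: sigma_inv_add)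
qed (simp add: sigma_inv_0)

lemma sigma_inv_p_torsion: "qz_scale (CARD('p) ^ k) \<gamma> = 0 \<Longrightarrow> sigma_inv \<gamma> = 1"
  by (rule sigma_inv_eqI[of _ k]) (simp_all add: sigma_1)

lemma sigma_inv_prime_to: "\<gamma> \<in> qz_prime_to CARD('p) \<Longrightarrow> sigma_inv \<gamma> = the_inv_into (- {0}) \<sigma> \<gamma>"
  using sigma_surj[of \<gamma>] sigma_inv_sigma the_inv_sigma by force

definition chi :: "qz \<Rightarrow> 'p ring_O" where
  "chi \<gamma> = teichmueller (sigma_inv \<gamma>)"

lemma chi_add: "chi (\<gamma> + \<delta>) = chi \<gamma> * chi \<delta>"
  by (simp add: chi_def sigma_inv_add teichmueller_mult)

lemma chi_scale: "chi (qz_scale n \<gamma>) = chi \<gamma> ^ n"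
  by (simp add: chi_def sigma_inv_scale teichmueller_power)

lemma chi_0: "chi 0 = 1"
  by (simp add: chi_def sigma_inv_0)

lemma Fr_power_chi: "(Fr ^^ a) (chi \<gamma>) = chi \<gamma> ^ (CARD('p) ^ a)"
proof (induction a)
  case (Suc a)
  have "Fr (chi \<gamma> ^ n) = (chi \<gamma> ^ n) ^ CARD('p)" for n
    by (simp add: chi_def Fr_teichmueller flip: teichmueller_power)
  then show ?case by (simp add: Suc mult.commute flip: power_mult)
qed simp

text \<open>Orthogonality: translating the fibre by \<open>\<delta> = 1/n'\<close> multiplies the sum by \<open>\<chi>(\<delta>)\<^sup>m\<close>, which is not \<open>1\<close> since
  \<open>\<delta>\<close> has order exactly \<open>n'\<close>, a number prime to \<open>p\<close>.\<close>

lemma chi_sum_fibre_0: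
  assumes n: "n > 0" "n = CARD('p) ^ a * n'" and m: "\<not> n' dvd m"
    and cop: "coprime n' CARD('p)"
  shows "(\<Sum>\<gamma>' | qz_scale n \<gamma>' = \<gamma>. chi \<gamma>' ^ m) = 0"
proof -
  let ?F = "{\<gamma>'. qz_scale n \<gamma>' = \<gamma>}" and ?\<delta> = "abs_qz (1 / of_nat n')"
  have n': "n' > 0" using n by (cases n') auto
  have \<delta>: "qz_scale n' ?\<delta> = 0" using n' by (simp add: qz_scale.abs_eq qz_eq_0_iff)
  then have \<delta>n: "qz_scale n ?\<delta> = 0" by (simp add: n flip: qz_scale_qz_scale)
  have "bij_betw (\<lambda>\<gamma>'. \<gamma>' + ?\<delta>) ?F ?F"
    by (rule bij_betw_byWitness[where f'="\<lambda>\<gamma>'. \<gamma>' - ?\<delta>"]) (auto simp: \<delta>n)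
  then have "(\<Sum>\<gamma>'\<in>?F. chi \<gamma>' ^ m) = (\<Sum>\<gamma>'\<in>?F. chi (\<gamma>' + ?\<delta>) ^ m)"
    by (rule sum.reindex_bij_betw[symmetric])
  also have "\<dots> = chi ?\<delta> ^ m * (\<Sum>\<gamma>'\<in>?F. chi \<gamma>' ^ m)"
    by (simp add: chi_add power_mult_distrib sum_distrib_left mult.commute)
  finally have "(chi ?\<delta> ^ m - 1) * (\<Sum>\<gamma>'\<in>?F. chi \<gamma>' ^ m) = 0" by (simp add: algebra_simps)
  moreover have "chi ?\<delta> ^ m - 1 \<noteq> 0"
  proof
    assume "chi ?\<delta> ^ m - 1 = 0"
    then have "teichmueller (sigma_inv (qz_scale m ?\<delta>)) = (teichmueller 1 :: 'p ring_O)"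
      by (simp add: chi_def sigma_inv_scale teichmueller_power)
    then have "sigma_inv (qz_scale m ?\<delta>) = 1" by (simp only: teichmueller_eq_iff)
    then obtain k where "qz_scale (CARD('p) ^ k) (qz_scale m ?\<delta>) = 0"
      using sigma_inv_spec(2)[of "qz_scale m ?\<delta>"] by (auto simp: sigma_1)
    moreover have "qz_scale n' (qz_scale m ?\<delta>) = 0"
      using \<delta> by (metis mult.commute qz_scale_0(1) qz_scale_qz_scale)
    moreover have "coprime (CARD('p) ^ k) n'" using cop by (simp add: coprime_commute)
    ultimately have "qz_scale m ?\<delta> = 0" using qz_scale_coprime_inj by blast
    then have "of_nat m / of_nat n' \<in> (\<int> :: rat set)" by (simp add: qz_scale.abs_eq qz_eq_0_iff)
    then obtain z where "of_nat m / of_nat n' = (of_int z :: rat)" by (auto elim: Ints_cases)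
    then have "(of_int (int m) :: rat) = of_int (z * int n')" using n' by (simp add: field_simps)
    then have "int m = z * int n'" by (simp only: of_int_eq_iff)
    then have "int n' dvd int m" by simp
    then show False using m by simp
  qed
  ultimately show ?thesis by (simp add: ring_O_mult_eq_0_iff)
qed

text \<open>The complementary case, in which every summand is the same. It is stated after applying \<open>Fr\<^sup>a\<close> because
  \<open>\<chi>(\<gamma>)\<close> itself is the \<open>p\<^sup>a\<close>-th power of the common value of \<open>\<chi>(\<gamma>')\<^bsup>n'\<^esup>\<close>.\<close>

lemma chi_sum_fibre:
  assumes n: "n > 0" "n = CARD('p) ^ a * n'"
  shows "(Fr ^^ a) (\<Sum>\<gamma>' | qz_scale n \<gamma>' = \<gamma>. chi \<gamma>' ^ (n' * j)) = of_nat n * chi \<gamma> ^ j"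
proof -
  note h = rhom_funpow[OF rhom_Fr, of a]
  have "(Fr ^^ a) (chi \<gamma>' ^ (n' * j)) = chi \<gamma> ^ j" if "qz_scale n \<gamma>' = \<gamma>" for \<gamma>'
    unfolding that[symmetric] chi_scale rhom.power[OF h] Fr_power_chi n(2) by (simp flip: power_mult add: mult.assoc)
  then show ?thesis
    by (simp add: rhom.sum[OF h] card_qz_scale[OF n(1)])
qed

end

section \<open>Prime-to-p parts and the index set\<close>

definition pfree :: "nat \<Rightarrow> nat \<Rightarrow> nat" where
  "pfree p n = n div p ^ multiplicity p n"

lemma pfree_decomp: "n = p ^ multiplicity p n * pfree p n"
  by (simp add: pfree_def multiplicity_dvd)

lemma pfree_pos: "n > 0 \<Longrightarrow> pfree p n > 0"
  using pfree_decomp[of n p] by (cases "pfree p n") auto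

lemma coprime_pfree:
  assumes "prime p" "n > 0"
  shows "coprime (pfree p n) p"
proof -
  have "\<not> p dvd pfree p n"
    unfolding pfree_def using assms by (intro multiplicity_decompose) auto
  then show ?thesis using assms(1) by (metis coprime_commute prime_imp_coprime)
qed

lemma pfree_mult:
  assumes "prime p" "n > 0" "m > 0"
  shows "pfree p (n * m) = pfree p n * pfree p m"
    and "multiplicity p (n * m) = multiplicity p n + multiplicity p m"
proof -
  show *: "multiplicity p (n * m) = multiplicity p n + multiplicity p m"
    using assms by (intro prime_elem_multiplicity_mult_distrib) auto
  show "pfree p (n * m) = pfree p n * pfree p m"
    unfolding pfree_def * power_add by (rule div_mult_div_if_dvd[symmetric]) (rule multiplicity_dvd)+
qed

lemma pfree_coprime:
  assumes "prime p" "coprime n p"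
  shows "pfree p n = n" "multiplicity p n = 0"
proof -
  have "\<not> p dvd n" using assms by (metis coprime_common_divisor_nat dvd_refl not_prime_1)
  then show "multiplicity p n = 0" by (rule not_dvd_imp_multiplicity_0)
  then show "pfree p n = n" by (simp add: pfree_def)
qed

lemma pfree_self:
  assumes "prime p"
  shows "pfree p p = 1" "multiplicity p p = 1"
proof -
  show "multiplicity p p = 1" using assms by (intro multiplicity_self) auto
  then show "pfree p p = 1" using assms by (simp add: pfree_def prime_gt_0_nat)
qed

text \<open>The index set is identified with the set of positive natural numbers prime to \<open>p\<close>, where division is
  available; \<open>imk\<close> is meaningful only on such numbers.\<close>

definition ival :: "'p::prime_card Ip \<Rightarrow> nat" where "ival m = numeral (Rep_Ip m)"

definition imk :: "nat \<Rightarrow> 'p::prime_card Ip" where "imk n = Abs_Ip (num_of_nat n)"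

lemma ival_pos [simp]: "ival m > 0" "ival m \<noteq> 0"
  by (simp_all add: ival_def)

lemma coprime_ival: "coprime (ival m) CARD('p)" for m :: "'p::prime_card Ip"
  using Rep_Ip[of m] by (simp add: ival_def)

lemma ival_imk: "n > 0 \<Longrightarrow> coprime n CARD('p) \<Longrightarrow> ival (imk n :: 'p::prime_card Ip) = n"
  by (simp add: ival_def imk_def Abs_Ip_inverse numeral_num_of_nat)

lemma ival_inject: "ival m = ival n \<longleftrightarrow> m = n"
  by (simp add: ival_def Rep_Ip_inject numeral_eq_iff)

lemma imk_ival [simp]: "imk (ival m) = m"
  by (simp add: ival_imk coprime_ival flip: ival_inject)

lemma ival_times: "ival (m * n) = ival m * ival n"
  by (simp add: ival_def times_Ip.rep_eq)

lemma dvd_Ip_iff: "n dvd k \<longleftrightarrow> ival n dvd ival k" for n k :: "'p::prime_card Ip"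
proof
  assume "ival n dvd ival k"
  then obtain j where j: "ival k = ival n * j" by (elim dvdE)
  then have "j > 0" "coprime j CARD('p)"
    using ival_pos[of k] coprime_ival[of k] by (auto intro: Nat.gr0I)
  then have "k = n * imk j" by (simp add: j ival_times ival_imk flip: ival_inject)
  then show "n dvd k" by (rule dvdI)
qed (auto simp: ival_times elim!: dvdE)

lemma ival_imk_times:
  assumes "n > 0"
  shows "ival (imk (pfree CARD('p) n * ival m) :: 'p Ip) = pfree CARD('p) n * ival (m :: 'p::prime_card Ip)"
  using assms coprime_ival[of m] by (intro ival_imk) (auto simp: pfree_pos coprime_pfree prime_card)

lemma ival_imk_div:
  assumes "d dvd ival (m :: 'p::prime_card Ip)"
  shows "ival (imk (ival m div d) :: 'p Ip) = ival m div d"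
proof (rule ival_imk)
  show "ival m div d > 0" using assms by (metis dvd_div_eq_0_iff ival_pos(2) neq0_conv)
  show "coprime (ival m div d) CARD('p)" using assms coprime_ival[of m]
    by (metis coprime_mult_left_iff dvd_div_mult_self)
qed

definition Fr_inv :: "'p::prime_card ring_O \<Rightarrow> 'p ring_O" where "Fr_inv = inv_into UNIV Fr"

lemma Fr_Fr_inv [simp]: "Fr (Fr_inv x) = x"
  unfolding Fr_inv_def by (rule f_inv_into_f) (simp add: bij_is_surj[OF bij_Fr])

lemma Fr_inv_Fr [simp]: "Fr_inv (Fr x) = x"
  unfolding Fr_inv_def by (rule inv_into_f_f) (simp_all add: bij_is_inj[OF bij_Fr])

lemma Fr_eq_iff: "Fr x = Fr y \<longleftrightarrow> x = y"
  by (metis Fr_inv_Fr)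

lemma rhom_Fr_inv: "rhom Fr_inv"
  by standard (simp_all add: rhom.add[OF rhom_Fr] rhom.mult[OF rhom_Fr] rhom.one[OF rhom_Fr] flip: Fr_eq_iff)

lemma Fr_Fr_inv_power [simp]: "(Fr ^^ a) ((Fr_inv ^^ a) x) = x"
  by (induction a arbitrary: x) (simp_all add: funpow_swap1)

lemma Fr_inv_Fr_power [simp]: "(Fr_inv ^^ a) ((Fr ^^ a) x) = x"
  by (induction a arbitrary: x) (simp_all add: funpow_swap1)

lemma Fr_inv_Fr_power_commute: "(Fr_inv ^^ a) ((Fr ^^ b) x) = (Fr ^^ b) ((Fr_inv ^^ a) x)"
proof -
  have *: "(Fr_inv ^^ a) (Fr x) = Fr ((Fr_inv ^^ a) x)" for x :: "'a ring_O"
    by (induction a) simp_all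
  show ?thesis by (induction b) (simp_all add: *)
qed

lemmas rhom_Fr_power = rhom_funpow[OF rhom_Fr]
lemmas rhom_Fr_inv_power = rhom_funpow[OF rhom_Fr_inv]

lemma (in rhom) dvd_of_nat_power: "of_nat n ^ k dvd x \<Longrightarrow> of_nat n ^ k dvd h x"
  by (auto simp: dvd_def mult power of_nat)

section \<open>The operators of the generators\<close>

text \<open>For \<open>n = p\<^sup>a n'\<close> with \<open>n'\<close> prime to \<open>p\<close>, the operator of \<open>\<mu>~\<^sub>n\<close> is forced to be the composite of \<open>\<mu>~\<^bsub>n'\<^esub>\<close> and
  \<open>(p Fr\<^sup>-\<^sup>1)\<^sup>a\<close>, and that of \<open>\<mu>\<^sub>n\<^sup>*\<close> the composite of \<open>\<mu>\<^bsub>n'\<^esub>\<^sup>*\<close> and \<open>Fr\<^sup>a\<close>.\<close>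

definition opT :: "nat \<Rightarrow> 'p::prime_card O_Ip \<Rightarrow> 'p O_Ip" where
  "opT n v = (\<lambda>m. if pfree CARD('p) n dvd ival m
     then of_nat n * (Fr_inv ^^ multiplicity CARD('p) n) (v (imk (ival m div pfree CARD('p) n))) else 0)"

definition opS :: "nat \<Rightarrow> 'p::prime_card O_Ip \<Rightarrow> 'p O_Ip" where
  "opS n v = (\<lambda>m. (Fr ^^ multiplicity CARD('p) n) (v (imk (pfree CARD('p) n * ival m))))"

lemma opS_mult:
  fixes v :: "'p::prime_card O_Ip"
  assumes "n > 0" "k > 0"
  shows "opS (n * k) v = opS n (opS k v)"
proof
  fix m :: "'p Ip"
  show "opS (n * k) v m = opS n (opS k v) m"
    using assms
    by (simp add: opS_def pfree_mult prime_card ival_imk_times funpow_add mult.assoc mult.left_commute)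
qed

lemma opT_mult:
  fixes v :: "'p::prime_card O_Ip"
  assumes "n > 0" "k > 0"
  shows "opT (n * k) v = opT n (opT k v)"
proof
  fix m :: "'p Ip"
  let ?n = "pfree CARD('p) n" and ?k = "pfree CARD('p) k"
  have pos: "?n > 0" using assms pfree_pos by simp
  show "opT (n * k) v m = opT n (opT k v) m"
  proof (cases "?n * ?k dvd ival m")
    case True
    then have "?n dvd ival m" "?k dvd ival m div ?n"
      using pos by (auto elim: dvd_mult_left)
    then show ?thesis using True assms
      by (simp add: opT_def pfree_mult prime_card ival_imk_div div_mult2_eq funpow_add
          rhom.mult[OF rhom_Fr_inv_power] rhom.of_nat[OF rhom_Fr_inv_power] mult.assoc)
  next
    case False
    moreover have "\<not> ?k dvd ival m div ?n" if "?n dvd ival m"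
      using False that pos by (auto elim!: dvdE)
    ultimately show ?thesis using assms
      by (simp add: opT_def pfree_mult prime_card ival_imk_div rhom.zero[OF rhom_Fr_inv_power])
  qed
qed

lemma opS_opT: "n > 0 \<Longrightarrow> opS n (opT n v) = (\<lambda>m. of_nat n * v m)"
  by (simp add: opS_def opT_def fun_eq_iff ival_imk_times pfree_pos
      rhom.mult[OF rhom_Fr_power] rhom.of_nat[OF rhom_Fr_power])

lemma opT_opS_commute:
  fixes v :: "'p::prime_card O_Ip"
  assumes "n > 0" "k > 0" "coprime n k"
  shows "opT n (opS k v) = opS k (opT n v)"
proof
  fix m :: "'p Ip"
  let ?n = "pfree CARD('p) n" and ?k = "pfree CARD('p) k"
  have "coprime ?n ?k"
    using assms(3) by (metis coprime_mult_left_iff coprime_mult_right_iff pfree_decomp)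
  then have iff: "?n dvd ?k * ival m \<longleftrightarrow> ?n dvd ival m"
    by (simp add: coprime_dvd_mult_right_iff)
  show "opT n (opS k v) m = opS k (opT n v) m"
  proof (cases "?n dvd ival m")
    case True
    then show ?thesis using assms iff
      by (simp add: opT_def opS_def ival_imk_div ival_imk_times Fr_inv_Fr_power_commute
        rhom.mult[OF rhom_Fr_power] rhom.of_nat[OF rhom_Fr_power] div_mult_swap)
  next
    case False
    then show ?thesis using assms iff
      by (simp add: opT_def opS_def ival_imk_times rhom.zero[OF rhom_Fr_power])
  qed
qed

lemma p_adic_mapE:
  fixes f :: "'p::prime_card O_Ip \<Rightarrow> 'p O_Ip"
  assumes "p_adic_map f"
  obtains A where "finite A"
    "\<And>v. (\<forall>i\<in>A. of_nat CARD('p) ^ k dvd v i) \<Longrightarrow> of_nat CARD('p) ^ k dvd f v m"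
proof -
  from assms have "\<exists>A. finite A \<and> (\<forall>v. (\<forall>i\<in>A. of_nat CARD('p) ^ k dvd v i) \<longrightarrow> of_nat CARD('p) ^ k dvd f v m)"
    by (simp add: p_adic_map_def)
  then obtain A where A: "finite A" "\<forall>v. (\<forall>i\<in>A. of_nat CARD('p) ^ k dvd v i) \<longrightarrow> of_nat CARD('p) ^ k dvd f v m"
    by (elim exE conjE)
  show thesis by (rule that[OF A(1)]) (rule A(2)[rule_format], blast)
qed

context unit_embedding
begin

text \<open>The scalar by which an element of the group ring acts on the coordinate \<open>m\<close>.\<close>

definition weight :: "nat \<Rightarrow> qz_ring \<Rightarrow> 'p ring_O" where
  "weight m x = (\<Sum>\<gamma>\<in>Poly_Mapping.keys x. of_int (Poly_Mapping.lookup x \<gamma>) * chi \<gamma> ^ m)"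

lemma weight_superset:
  "finite A \<Longrightarrow> Poly_Mapping.keys x \<subseteq> A \<Longrightarrow>
    weight m x = (\<Sum>\<gamma>\<in>A. of_int (Poly_Mapping.lookup x \<gamma>) * chi \<gamma> ^ m)"
  unfolding weight_def by (rule sum.mono_neutral_left) (auto simp: in_keys_iff)

lemma weight_add: "weight m (x + y) = weight m x + weight m y"
proof -
  let ?A = "Poly_Mapping.keys x \<union> Poly_Mapping.keys y"
  have "Poly_Mapping.keys (x + y) \<subseteq> ?A" by (rule Poly_Mapping.keys_add)
  then show ?thesis
    by (simp add: weight_superset[of ?A] lookup_add sum.distrib distrib_right)
qed

lemma weight_0 [simp]: "weight m 0 = 0" by (simp add: weight_def)

lemma weight_single: "weight m (Poly_Mapping.single \<gamma> c) = of_int c * chi \<gamma> ^ m"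
  by (subst weight_superset[of "{\<gamma>}"]) auto

lemma weight_mult: "weight m (x * y) = weight m x * weight m y"
proof (induction x rule: poly_mapping_induct_add)
  case (single k c)
  have "weight m (Poly_Mapping.single k c * Poly_Mapping.single l d) =
      weight m (Poly_Mapping.single k c) * weight m (Poly_Mapping.single l d)" for l d
    unfolding mult_single weight_single chi_add power_mult_distrib of_int_mult by (simp only: mult_ac)
  then show ?case
    by (induction y rule: poly_mapping_induct_add) (simp_all add: distrib_left weight_add)
qed (simp_all add: distrib_right weight_add)

lemma rhom_weight: "rhom (weight m)"
  by standard (simp_all add: weight_add weight_mult weight_single chi_0 flip: single_one)

lemma weight_sigma:
  "weight m (bc_sigma n x) = (Fr ^^ multiplicity CARD('p) (numeral n)) (weight (pfree CARD('p) (numeral n) * m) x)"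
proof -
  let ?n = "numeral n :: nat"
  have "chi \<gamma> ^ (?n * m) = (Fr ^^ multiplicity CARD('p) ?n) (chi \<gamma> ^ (pfree CARD('p) ?n * m))" for \<gamma>
  proof -
    have "?n * m = CARD('p) ^ multiplicity CARD('p) ?n * (pfree CARD('p) ?n * m)"
      unfolding mult.assoc[symmetric] by (simp only: flip: pfree_decomp)
    then have "chi \<gamma> ^ (?n * m) = chi \<gamma> ^ (CARD('p) ^ multiplicity CARD('p) ?n * (pfree CARD('p) ?n * m))"
      by (rule arg_cong)
    then show ?thesis by (simp only: rhom.power[OF rhom_Fr_power] Fr_power_chi power_mult)
  qed
  then show ?thesis
    by (simp add: bc_sigma_def rhom.sum[OF rhom_weight] weight_single chi_scale flip: power_mult)
      (simp add: weight_def rhom.sum[OF rhom_Fr_power] rhom.mult[OF rhom_Fr_power] rhom.of_int[OF rhom_Fr_power])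
qed

text \<open>This is the relation \<open>\<mu>~\<^sub>n x \<mu>\<^sub>n\<^sup>* = \<rho>~\<^sub>n(x)\<close> on one coordinate.\<close>

lemma weight_rho:
  "weight m (bc_rho n x) = (if pfree CARD('p) (numeral n) dvd m
     then of_nat (numeral n) * (Fr_inv ^^ multiplicity CARD('p) (numeral n)) (weight (m div pfree CARD('p) (numeral n)) x) else 0)"
proof -
  let ?n = "numeral n :: nat" and ?n' = "pfree CARD('p) (numeral n)" and ?a = "multiplicity CARD('p) (numeral n :: nat)"
  have w: "weight m (bc_rho n x) = (\<Sum>\<gamma>\<in>Poly_Mapping.keys x. of_int (Poly_Mapping.lookup x \<gamma>) *
      (\<Sum>\<gamma>' | qz_scale ?n \<gamma>' = \<gamma>. chi \<gamma>' ^ m))"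
    by (simp add: bc_rho_def rhom.sum[OF rhom_weight] weight_single sum_distrib_left)
  have dec: "?n > 0" "?n = CARD('p) ^ ?a * ?n'" using pfree_decomp by simp_all
  show ?thesis
  proof (cases "?n' dvd m")
    case False
    then show ?thesis
      by (simp add: w chi_sum_fibre_0[OF dec False coprime_pfree[OF prime_card dec(1)]])
  next
    case True
    then obtain j where j: "m = ?n' * j" by (elim dvdE)
    have "(Fr ^^ ?a) (weight m (bc_rho n x)) = of_nat ?n * weight j x"
      unfolding w
      by (subst rhom.sum[OF rhom_Fr_power],
          simp only: rhom.mult[OF rhom_Fr_power] rhom.of_int[OF rhom_Fr_power] j chi_sum_fibre[OF dec])
        (simp add: weight_def sum_distrib_left mult.left_commute)
    then have "(Fr_inv ^^ ?a) ((Fr ^^ ?a) (weight m (bc_rho n x))) = (Fr_inv ^^ ?a) (of_nat ?n * weight j x)" by simp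
    then show ?thesis
      by (simp add: rhom.mult[OF rhom_Fr_inv_power] rhom.of_nat[OF rhom_Fr_inv_power] j pfree_pos del: of_nat_numeral)
  qed
qed

definition opG :: "qz_ring \<Rightarrow> 'p O_Ip \<Rightarrow> 'p O_Ip" where
  "opG x v = (\<lambda>m. weight (ival m) x * v m)"

lemma opT_opG_opS: "opT (numeral n) (opG x (opS (numeral n) v)) = opG (bc_rho n x) v"
proof
  fix m
  show "opT (numeral n) (opG x (opS (numeral n) v)) m = opG (bc_rho n x) v m"
    by (cases "pfree CARD('p) (numeral n) dvd ival m")
      (simp_all add: opT_def opG_def opS_def weight_rho ival_imk_div rhom.mult[OF rhom_Fr_inv_power] mult_ac)
qed

lemma opS_opG: "opS (numeral n) (opG x v) = opG (bc_sigma n x) (opS (numeral n) v)"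
  by (simp add: fun_eq_iff opS_def opG_def weight_sigma ival_imk_times rhom.mult[OF rhom_Fr_power])

lemma opG_opT: "opG x (opT (numeral n) v) = opT (numeral n) (opG (bc_sigma n x) v)"
proof
  fix m
  show "opG x (opT (numeral n) v) m = opT (numeral n) (opG (bc_sigma n x) v) m"
    by (cases "pfree CARD('p) (numeral n) dvd ival m")
      (simp_all add: opT_def opG_def weight_sigma ival_imk_div rhom.mult[OF rhom_Fr_inv_power] mult_ac)
qed

primrec pi_term :: "bc_term \<Rightarrow> 'p O_Ip \<Rightarrow> 'p O_Ip" where
  "pi_term (Grp x) = opG x"
| "pi_term (MuT n) = opT (numeral n)"
| "pi_term (MuS n) = opS (numeral n)"
| "pi_term (Plus a b) = (\<lambda>v. pi_term a v + pi_term b v)"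
| "pi_term (Uminus a) = (\<lambda>v. - pi_term a v)"
| "pi_term (Times a b) = pi_term a \<circ> pi_term b"

lemma pi_term_add: "pi_term t (v + w) = pi_term t v + pi_term t w"
proof (induction t arbitrary: v w)
  case (Times a b)
  then show ?case by simp
next
  case (Plus a b)
  then show ?case by (simp add: add_ac)
qed (auto simp: fun_eq_iff opG_def opT_def opS_def distrib_left rhom.add[OF rhom_Fr_power]
    rhom.add[OF rhom_Fr_inv_power])

lemma additive_pi_term: "Modules.additive (pi_term t)"
  by (rule additive.intro) (rule pi_term_add)

lemma p_adic_pi_term: "p_adic_map (pi_term t)"
proof (induction t)
  case (Grp x)
  show ?case unfolding p_adic_map_def
  proof (intro allI)
    show "\<exists>A. finite A \<and> (\<forall>v. (\<forall>i\<in>A. of_nat CARD('p) ^ k dvd v i) \<longrightarrow> of_nat CARD('p) ^ k dvd pi_term (Grp x) v m)" for m k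
      by (intro exI[of _ "{m}"]) (simp add: opG_def)
  qed
next
  case (MuT n)
  show ?case unfolding p_adic_map_def
  proof (intro allI)
    show "\<exists>A. finite A \<and> (\<forall>v. (\<forall>i\<in>A. of_nat CARD('p) ^ k dvd v i) \<longrightarrow> of_nat CARD('p) ^ k dvd pi_term (MuT n) v m)" for m k
      by (intro exI[of _ "{imk (ival m div pfree CARD('p) (numeral n))}"])
        (simp add: opT_def rhom.dvd_of_nat_power[OF rhom_Fr_inv_power])
  qed
next
  case (MuS n)
  show ?case unfolding p_adic_map_def
  proof (intro allI)
    show "\<exists>A. finite A \<and> (\<forall>v. (\<forall>i\<in>A. of_nat CARD('p) ^ k dvd v i) \<longrightarrow> of_nat CARD('p) ^ k dvd pi_term (MuS n) v m)" for m k
      by (intro exI[of _ "{imk (pfree CARD('p) (numeral n) * ival m)}"])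
        (simp add: opS_def rhom.dvd_of_nat_power[OF rhom_Fr_power])
  qed
next
  case (Plus a b)
  show ?case unfolding p_adic_map_def
  proof (intro allI)
    fix m k
    obtain A where A: "finite A" "\<And>v. (\<forall>i\<in>A. of_nat CARD('p) ^ k dvd v i) \<Longrightarrow> of_nat CARD('p) ^ k dvd pi_term a v m"
      by (rule p_adic_mapE[OF Plus(1), of k m]) blast
    obtain B where B: "finite B" "\<And>v. (\<forall>i\<in>B. of_nat CARD('p) ^ k dvd v i) \<Longrightarrow> of_nat CARD('p) ^ k dvd pi_term b v m"
      by (rule p_adic_mapE[OF Plus(2), of k m]) blast
    show "\<exists>A. finite A \<and> (\<forall>v. (\<forall>i\<in>A. of_nat CARD('p) ^ k dvd v i) \<longrightarrow> of_nat CARD('p) ^ k dvd pi_term (Plus a b) v m)"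
    proof (intro exI[of _ "A \<union> B"] conjI allI impI)
      fix v :: "'p O_Ip" assume "\<forall>i\<in>A \<union> B. of_nat CARD('p) ^ k dvd v i"
      then show "of_nat CARD('p) ^ k dvd pi_term (Plus a b) v m" using dvd_add[OF A(2) B(2)] by simp
    qed (simp add: A B)
  qed
next
  case (Uminus a)
  then show ?case by (simp add: p_adic_map_def)
next
  case (Times a b)
  show ?case unfolding p_adic_map_def
  proof (intro allI)
    fix m k
    obtain A where A: "finite A" "\<And>v. (\<forall>i\<in>A. of_nat CARD('p) ^ k dvd v i) \<Longrightarrow> of_nat CARD('p) ^ k dvd pi_term a v m"
      by (rule p_adic_mapE[OF Times(1), of k m]) blast
    have "\<forall>j. \<exists>B. finite B \<and> (\<forall>v. (\<forall>i\<in>B. of_nat CARD('p) ^ k dvd v i) \<longrightarrow> of_nat CARD('p) ^ k dvd pi_term b v j)"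
      using Times(2) by (simp add: p_adic_map_def)
    from choice[OF this] obtain B where B: "\<forall>j. finite (B j) \<and>
        (\<forall>v. (\<forall>i\<in>B j. of_nat CARD('p) ^ k dvd v i) \<longrightarrow> of_nat CARD('p) ^ k dvd pi_term b v j)" ..
    show "\<exists>A. finite A \<and> (\<forall>v. (\<forall>i\<in>A. of_nat CARD('p) ^ k dvd v i) \<longrightarrow> of_nat CARD('p) ^ k dvd pi_term (Times a b) v m)"
    proof (intro exI[of _ "\<Union>j\<in>A. B j"] conjI allI impI)
      fix v :: "'p O_Ip" assume "\<forall>i\<in>\<Union>j\<in>A. B j. of_nat CARD('p) ^ k dvd v i"
      then have "\<forall>j\<in>A. of_nat CARD('p) ^ k dvd pi_term b v j" using B by simp
      then show "of_nat CARD('p) ^ k dvd pi_term (Times a b) v m" using A(2) by simp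
    qed (simp add: A B)
  qed
qed

lemma pi_term_cong: "bc_eq a b \<Longrightarrow> pi_term a = pi_term b"
proof (induction rule: bc_eq.induct)
  case (Plus_zero a)
  show ?case by (auto simp: fun_eq_iff opG_def)
next
  case (Plus_uminus a)
  show ?case by (auto simp: fun_eq_iff opG_def)
next
  case (Times_one a)
  show ?case by (auto simp: fun_eq_iff opG_def rhom.one[OF rhom_weight])
next
  case (one_Times a)
  have "opG 1 = id" by (auto simp: fun_eq_iff opG_def rhom.one[OF rhom_weight])
  then show ?case by simp
next
  case (distrib_l a b c)
  show ?case by (simp add: fun_eq_iff pi_term_add)
next
  case (Grp_Plus x y)
  show ?case by (auto simp: fun_eq_iff opG_def weight_add distrib_right)
next
  case (Grp_Times x y)
  show ?case by (auto simp: fun_eq_iff opG_def weight_mult mult.assoc)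
next
  case (MuT_x_MuS n x)
  show ?case by (rule ext) (simp add: opT_opG_opS)
next
  case (MuS_x n x)
  show ?case by (rule ext) (simp add: opS_opG)
next
  case (x_MuT x n)
  show ?case by (rule ext) (simp add: opG_opT)
next
  case (MuT_mult n m)
  have "opT (numeral (n * m)) v = opT (numeral n) (opT (numeral m) v)" for v :: "'p O_Ip"
    using opT_mult[of "numeral n" "numeral m" v] by simp
  then show ?case by (intro ext) (simp only: pi_term.simps o_apply)
next
  case (MuS_mult n m)
  have "opS (numeral (n * m)) v = opS (numeral n) (opS (numeral m) v)" for v :: "'p O_Ip"
    using opS_mult[of "numeral n" "numeral m" v] by simp
  then show ?case by (intro ext) (simp only: pi_term.simps o_apply)
next
  case (MuS_MuT n)
  have "weight m (numeral n) = numeral n" for m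
    using rhom.of_nat[OF rhom_weight, of m "numeral n"] by simp
  then show ?case by (intro ext) (simp add: opS_opT opG_def)
next
  case (MuT_MuS n m)
  then show ?case by (intro ext) (simp add: opT_opS_commute)
qed (simp_all add: add_ac o_def)

end

section \<open>Existence of the representation\<close>

lemma abs_bc_surj: "\<exists>t. a = abs_bc t"
  by (metis Quotient3_abs_rep Quotient3_bc)

context unit_embedding
begin

definition pi_bc :: "bc \<Rightarrow> 'p O_Ip \<Rightarrow> 'p O_Ip" where
  "pi_bc a = pi_term (rep_bc a)"

lemma pi_bc_abs: "pi_bc (abs_bc t) = pi_term t"
proof -
  have "abs_bc (rep_bc (abs_bc t)) = abs_bc t" by (metis Quotient3_abs_rep Quotient3_bc)
  then have "bc_eq (rep_bc (abs_bc t)) t" by (simp add: bc.abs_eq_iff)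
  then show ?thesis unfolding pi_bc_def by (rule pi_term_cong)
qed

lemma pi_bc_simps:
  "pi_bc (bc_grp x) = opG x" "pi_bc (mu_tilde n) = opT (numeral n)" "pi_bc (mu_star n) = opS (numeral n)"
  by (simp_all add: bc_grp.abs_eq mu_tilde.abs_eq mu_star.abs_eq pi_bc_abs)

lemma is_rep_pi_bc: "is_rep pi_bc"
proof -
  have "Modules.additive (pi_bc a)" "continuous_on UNIV (pi_bc a)" for a
    unfolding pi_bc_def using additive_pi_term p_adic_pi_term by (auto intro: continuous_p_adic_map)
  moreover have "pi_bc 1 = id"
    by (simp add: one_bc_def pi_bc_abs fun_eq_iff opG_def rhom.one[OF rhom_weight])
  moreover have "pi_bc (a + b) = (\<lambda>v. pi_bc a v + pi_bc b v)" for a b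
  proof -
    obtain s t where "a = abs_bc s" "b = abs_bc t" using abs_bc_surj by metis
    then show ?thesis by (simp add: plus_bc.abs_eq pi_bc_abs)
  qed
  moreover have "pi_bc (a * b) = pi_bc a \<circ> pi_bc b" for a b
  proof -
    obtain s t where "a = abs_bc s" "b = abs_bc t" using abs_bc_surj by metis
    then show ?thesis by (simp add: times_bc.abs_eq pi_bc_abs)
  qed
  ultimately show ?thesis by (simp add: is_rep_def)
qed

end

lemma module_scaleO: "Modules.module (scaleO :: 'p::prime_card ring_O \<Rightarrow> _)"
  by standard (auto simp: scaleO_def fun_eq_iff algebra_simps)

lemma module_hom_scaleOI:
  assumes "\<And>v w. f (v + w) = f v + f w" "\<And>c v. f (scaleO c v) = scaleO c (f v)"
  shows "Modules.module_hom scaleO scaleO f"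
  unfolding module_hom_iff using assms module_scaleO by simp

lemma scaleO_scaleO: "scaleO c (scaleO d v) = scaleO (c * d) v"
  by (simp add: scaleO_def fun_eq_iff mult.assoc)

lemma ival_coprime_simps [simp]:
  "multiplicity CARD('p) (ival (n :: 'p::prime_card Ip)) = 0" "pfree CARD('p) (ival (n :: 'p::prime_card Ip)) = ival n"
  using pfree_coprime[OF prime_card coprime_ival] by auto

lemma numeral_Rep_Ip: "numeral (Rep_Ip n) = (of_nat (ival n) :: 'a::semiring_1)"
  by (simp add: ival_def)

lemma dvd_Ip_triv [simp]: "n dvd n * (m :: 'p::prime_card Ip)"
  by (rule dvdI[OF refl])

lemma opT_ival:
  fixes v :: "'p::prime_card O_Ip"
  shows "opT (ival n) v = (\<lambda>m. if n dvd m then of_nat (ival n) * v (imk (ival m div ival n)) else 0)"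
  by (simp add: opT_def dvd_Ip_iff cong: if_cong)

lemma opS_ival:
  fixes v :: "'p::prime_card O_Ip"
  shows "opS (ival n) v = (\<lambda>m. v (n * m))"
  by (simp add: opS_def flip: ival_times)

lemma opT_eps:
  fixes n :: "'p::prime_card Ip"
  shows "opT (ival n) (scaleO c (eps m)) = scaleO (of_nat (ival n) * c) (eps (n * m))"
proof
  fix k
  have "n * (imk (ival k div ival n)) = k" if "n dvd k"
    using that by (simp add: dvd_Ip_iff ival_times ival_imk_div flip: ival_inject)
  moreover have "imk (ival (n * m) div ival n) = m" by (simp add: ival_times)
  ultimately show "opT (ival n) (scaleO c (eps m)) k = scaleO (of_nat (ival n) * c) (eps (n * m)) k"
    by (auto simp: opT_ival scaleO_def eps_def mult_ac)
qed

context unit_embedding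
begin

lemma is_pi_pi_bc: "is_pi \<sigma> pi_bc"
  unfolding is_pi_def
proof (intro conjI allI ballI impI)
  have num: "numeral (Rep_Ip n) = ival n" for n :: "'p Ip" by (simp add: ival_def)
  show "is_rep pi_bc" by (rule is_rep_pi_bc)
  have add: "pi_bc a (v + w) = pi_bc a v + pi_bc a w" for a v w
    using is_rep_pi_bc by (simp add: is_rep_def additive.add)
  show "Modules.module_hom scaleO scaleO (pi_bc (mu_tilde (Rep_Ip n)))" for n :: "'p Ip"
    by (rule module_hom_scaleOI[OF add])
      (auto simp: pi_bc_simps num opT_ival scaleO_def fun_eq_iff mult_ac)
  show "Modules.module_hom scaleO scaleO (pi_bc (mu_star (Rep_Ip n)))" for n :: "'p Ip"
    by (rule module_hom_scaleOI[OF add]) (auto simp: pi_bc_simps num opS_ival scaleO_def fun_eq_iff)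
  show "Modules.module_hom scaleO scaleO (pi_bc (bc_grp x))" for x
    by (rule module_hom_scaleOI[OF add]) (auto simp: pi_bc_simps opG_def scaleO_def fun_eq_iff mult_ac)
  show "pi_bc (mu_tilde (Rep_Ip n)) (eps m) = scaleO (numeral (Rep_Ip n)) (eps (n * m))" for n m :: "'p Ip"
    using opT_eps[of n 1 m] by (simp add: pi_bc_simps num numeral_Rep_Ip scaleO_def)
  show "pi_bc (mu_star (Rep_Ip n)) (eps (n * m)) = eps m" for n m :: "'p Ip"
    by (auto simp: pi_bc_simps num opS_ival eps_def fun_eq_iff ival_times simp flip: ival_inject)
  show "pi_bc (mu_star (Rep_Ip n)) (eps k) = 0" if "\<not> n dvd k" for n k :: "'p Ip"
    using that by (auto simp: pi_bc_simps num opS_ival eps_def fun_eq_iff)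
  show "pi_bc (bc_grp (ee \<gamma>)) (eps m) =
      scaleO (teichmueller (the_inv_into (- {0}) \<sigma> \<gamma>) ^ numeral (Rep_Ip m)) (eps m)"
    if "\<gamma> \<in> qz_prime_to CARD('p)" for \<gamma> m
    using that
    by (auto simp: pi_bc_simps opG_def ee_def weight_single chi_def sigma_inv_prime_to scaleO_def fun_eq_iff eps_def num)
  show "pi_bc (bc_grp (ee \<gamma>)) = id" if "\<exists>k. qz_scale (CARD('p) ^ k) \<gamma> = 0" for \<gamma>
    using that sigma_inv_p_torsion[of _ \<gamma>]
    by (auto simp: pi_bc_simps opG_def ee_def weight_single chi_def fun_eq_iff)
  show "pi_bc (mu_star (num_of_nat CARD('p))) = (\<lambda>x m. Fr (x m))"
    by (simp add: pi_bc_simps fun_eq_iff numeral_num_of_nat opS_def pfree_self prime_card)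
  show "pi_bc (mu_tilde (num_of_nat CARD('p))) = (\<lambda>x m. of_nat CARD('p) * inv_into UNIV Fr (x m))"
    by (simp add: pi_bc_simps fun_eq_iff numeral_num_of_nat opT_def pfree_self prime_card Fr_inv_def)
qed

end

section \<open>Uniqueness of the representation\<close>

lemma is_rep_D:
  assumes "is_rep \<pi>"
  shows "\<pi> a (v + w) = \<pi> a v + \<pi> a w" "continuous_on UNIV (\<pi> a)" "Modules.additive (\<pi> a)" "\<pi> 1 = id"
    "\<pi> (a + b) = (\<lambda>v. \<pi> a v + \<pi> b v)" "\<pi> (a * b) = \<pi> a \<circ> \<pi> b"
  using assms by (simp_all add: is_rep_def additive.add)

lemma is_rep_zero: "is_rep \<pi> \<Longrightarrow> \<pi> 0 = (\<lambda>v. 0)"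
  using is_rep_D(5)[of \<pi> 0 0] by (simp add: fun_eq_iff)

lemma is_rep_uminus:
  assumes "is_rep \<pi>" shows "\<pi> (- a) = (\<lambda>v. - \<pi> a v)"
proof
  fix v
  have "\<pi> (- a + a) v = 0" using is_rep_zero[OF assms] by simp
  then show "\<pi> (- a) v = - \<pi> a v" unfolding is_rep_D(5)[OF assms] by (simp add: add_eq_0_iff2)
qed

lemma mu_mult: "mu_tilde (n * m) = mu_tilde n * mu_tilde m" "mu_star (n * m) = mu_star n * mu_star m"
  by (simp_all add: mu_tilde.abs_eq mu_star.abs_eq times_bc.abs_eq bc.abs_eq_iff MuT_mult MuS_mult)

lemma bc_grp_simps: "bc_grp (x + y) = bc_grp x + bc_grp y" "bc_grp (x * y) = bc_grp x * bc_grp y"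
  "bc_grp 0 = 0" "bc_grp 1 = 1"
  by (simp_all add: bc_grp.abs_eq plus_bc.abs_eq times_bc.abs_eq zero_bc_def one_bc_def bc.abs_eq_iff
      Grp_Plus Grp_Times)

lemma bc_grp_uminus: "bc_grp (- x) = - bc_grp x"
  using bc_grp_simps(1)[of "- x" x] by (simp add: bc_grp_simps(3) eq_neg_iff_add_eq_0)

lemma ee_add: "ee (\<gamma> + \<delta>) = ee \<gamma> * ee \<delta>"
  by (simp add: ee_def mult_single)

text \<open>Strips factors \<open>p\<close>: since \<open>\<mu>~\<close> and \<open>\<mu>\<^sup>*\<close> are multiplicative, the prescribed operators for \<open>n = p\<close> and for
  \<open>n\<close> prime to \<open>p\<close> determine all others.\<close>

lemma num_p_induct [case_names coprime step]:
  assumes "\<And>n. coprime (numeral n) p \<Longrightarrow> P n"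
    and "\<And>n. P n \<Longrightarrow> P (num_of_nat p * n)" and p: "prime p"
  shows "P (n :: num)"
proof (induction "numeral n :: nat" arbitrary: n rule: less_induct)
  case less
  show ?case
  proof (cases "coprime (numeral n) p")
    case False
    then have "p dvd numeral n" using p by (metis coprime_commute prime_imp_coprime)
    then obtain j where j: "numeral n = p * j" by (elim dvdE)
    then have j0: "j > 0" by (cases j) auto
    have "numeral (num_of_nat p * num_of_nat j) = (numeral n :: nat)"
      unfolding numeral_mult using j j0 p by (simp add: numeral_num_of_nat prime_gt_0_nat)
    then have n: "n = num_of_nat p * num_of_nat j" by (simp only: numeral_eq_iff)
    have "numeral (num_of_nat j) < (numeral n :: nat)"
      using j j0 mult_less_mono1[OF prime_gt_1_nat[OF p] j0] by (simp add: numeral_num_of_nat)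
    then have "P (num_of_nat j)" by (rule less)
    then show ?thesis unfolding n by (rule assms(2))
  qed (rule assms(1))
qed

lemma coprime_num_Ip: "coprime (numeral n) CARD('p) \<Longrightarrow> \<exists>m :: 'p::prime_card Ip. n = Rep_Ip m"
  by (metis Abs_Ip_inverse mem_Collect_eq)

context unit_embedding
begin

lemma is_pi_unique_grp_ee:
  assumes 1: "is_pi \<sigma> \<pi>" and 2: "is_pi \<sigma> \<pi>'"
  shows "\<pi> (bc_grp (ee \<gamma>)) = \<pi>' (bc_grp (ee \<gamma>))"
proof -
  note r = 1[unfolded is_pi_def, THEN conjunct1] and r' = 2[unfolded is_pi_def, THEN conjunct1]
  obtain k where k: "qz_scale (CARD('p) ^ k) (\<sigma> (sigma_inv \<gamma>)) = qz_scale (CARD('p) ^ k) \<gamma>"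
    using sigma_inv_spec(2) by blast
  \<comment> \<open>Split \<open>\<gamma>\<close> into its prime-to-\<open>p\<close> part and a \<open>p\<close>-power torsion part.\<close>
  define \<delta> where "\<delta> = \<gamma> - \<sigma> (sigma_inv \<gamma>)"
  have \<gamma>: "\<gamma> = \<sigma> (sigma_inv \<gamma>) + \<delta>" by (simp add: \<delta>_def)
  have "qz_scale (CARD('p) ^ k) \<delta> = 0" using k by (simp add: \<delta>_def)
  then have \<delta>: "\<pi> (bc_grp (ee \<delta>)) = id" "\<pi>' (bc_grp (ee \<delta>)) = id"
    using 1 2 by (auto simp: is_pi_def)
  have s: "\<sigma> (sigma_inv \<gamma>) \<in> qz_prime_to CARD('p)" by (rule sigma_prime_to[OF sigma_inv_spec(1)])
  have "\<pi> (bc_grp (ee (\<sigma> (sigma_inv \<gamma>)))) = \<pi>' (bc_grp (ee (\<sigma> (sigma_inv \<gamma>))))"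
  proof (rule continuous_additive_eqI)
    fix m c
    have "Modules.module_hom scaleO scaleO (\<pi> (bc_grp (ee (\<sigma> (sigma_inv \<gamma>)))))"
      "Modules.module_hom scaleO scaleO (\<pi>' (bc_grp (ee (\<sigma> (sigma_inv \<gamma>)))))"
      using 1 2 by (simp_all add: is_pi_def)
    note h = this[THEN module_hom.scale]
    show "\<pi> (bc_grp (ee (\<sigma> (sigma_inv \<gamma>)))) (scaleO c (eps m)) = \<pi>' (bc_grp (ee (\<sigma> (sigma_inv \<gamma>)))) (scaleO c (eps m))"
      unfolding h using 1 2 s by (simp add: is_pi_def)
  qed (use is_rep_D[OF r] is_rep_D[OF r'] in auto)
  then show ?thesis
    by (subst (1 2) \<gamma>) (simp only: ee_add bc_grp_simps is_rep_D(6)[OF r] is_rep_D(6)[OF r'] \<delta>)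
qed

lemma is_pi_unique:
  assumes 1: "is_pi \<sigma> \<pi>" and 2: "is_pi \<sigma> \<pi>'"
  shows "\<pi> = \<pi>'"
proof -
  note r = 1[unfolded is_pi_def, THEN conjunct1] and r' = 2[unfolded is_pi_def, THEN conjunct1]
  have "\<pi> (bc_grp (Poly_Mapping.single \<gamma> c)) = \<pi>' (bc_grp (Poly_Mapping.single \<gamma> c))" for \<gamma> c
  proof (induction c rule: int_induct[where k=0])
    case base
    show ?case by (simp add: bc_grp_simps is_rep_zero[OF r] is_rep_zero[OF r'])
  next
    case (step1 i)
    have e: "Poly_Mapping.single \<gamma> (i + 1) = Poly_Mapping.single \<gamma> i + ee \<gamma>" by (simp add: ee_def single_add)
    show ?case unfolding e bc_grp_simps is_rep_D(5)[OF r] is_rep_D(5)[OF r'] 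
      using step1(2) is_pi_unique_grp_ee[OF 1 2] by simp
  next
    case (step2 i)
    have e: "Poly_Mapping.single \<gamma> (i - 1) = Poly_Mapping.single \<gamma> i + (- ee \<gamma>)"
      by (simp add: ee_def single_diff)
    show ?case unfolding e bc_grp_simps bc_grp_uminus is_rep_D(5)[OF r] is_rep_D(5)[OF r']
        is_rep_uminus[OF r] is_rep_uminus[OF r']
      using step2(2) is_pi_unique_grp_ee[OF 1 2] by simp
  qed
  then have grp: "\<pi> (bc_grp x) = \<pi>' (bc_grp x)" for x
    by (induction x rule: poly_mapping_induct_add)
      (simp_all add: bc_grp_simps is_rep_zero[OF r] is_rep_zero[OF r'] is_rep_D(5)[OF r] is_rep_D(5)[OF r'])
  have tilde: "\<pi> (mu_tilde n) = \<pi>' (mu_tilde n)" for n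
  proof (induction n rule: num_p_induct[where p="CARD('p)"])
    case (coprime n)
    then obtain k :: "'p Ip" where k: "n = Rep_Ip k" using coprime_num_Ip by blast
    show ?case
    proof (rule continuous_additive_eqI)
      fix m c
      have "Modules.module_hom scaleO scaleO (\<pi> (mu_tilde n))" "Modules.module_hom scaleO scaleO (\<pi>' (mu_tilde n))"
        using 1 2 by (simp_all add: is_pi_def k)
      note h = this[THEN module_hom.scale]
      show "\<pi> (mu_tilde n) (scaleO c (eps m)) = \<pi>' (mu_tilde n) (scaleO c (eps m))"
        unfolding h using 1 2 by (simp add: is_pi_def k)
    qed (use is_rep_D[OF r] is_rep_D[OF r'] in auto)
  next
    case (step n)
    have "\<pi> (mu_tilde (num_of_nat CARD('p))) = \<pi>' (mu_tilde (num_of_nat CARD('p)))"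
      using 1 2 by (simp add: is_pi_def)
    with step show ?case by (simp add: mu_mult is_rep_D(6)[OF r] is_rep_D(6)[OF r'])
  qed (rule prime_card)
  have star: "\<pi> (mu_star n) = \<pi>' (mu_star n)" for n
  proof (induction n rule: num_p_induct[where p="CARD('p)"])
    case (coprime n)
    then obtain k :: "'p Ip" where k: "n = Rep_Ip k" using coprime_num_Ip by blast
    show ?case
    proof (rule continuous_additive_eqI)
      fix m c
      have "Modules.module_hom scaleO scaleO (\<pi> (mu_star n))" "Modules.module_hom scaleO scaleO (\<pi>' (mu_star n))"
        using 1 2 by (simp_all add: is_pi_def k)
      note h = this[THEN module_hom.scale]
      show "\<pi> (mu_star n) (scaleO c (eps m)) = \<pi>' (mu_star n) (scaleO c (eps m))"
        unfolding h using 1 2 by (cases "k dvd m") (auto simp: is_pi_def k elim!: dvdE)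
    qed (use is_rep_D[OF r] is_rep_D[OF r'] in auto)
  next
    case (step n)
    have "\<pi> (mu_star (num_of_nat CARD('p))) = \<pi>' (mu_star (num_of_nat CARD('p)))"
      using 1 2 by (simp add: is_pi_def)
    with step show ?case by (simp add: mu_mult is_rep_D(6)[OF r] is_rep_D(6)[OF r'])
  qed (rule prime_card)
  have "\<pi> (abs_bc t) = \<pi>' (abs_bc t)" for t
    by (induction t)
      (simp_all add: grp tilde star is_rep_D(5,6)[OF r] is_rep_D(5,6)[OF r'] is_rep_uminus[OF r] is_rep_uminus[OF r']
        flip: bc_grp.abs_eq mu_tilde.abs_eq mu_star.abs_eq plus_bc.abs_eq uminus_bc.abs_eq times_bc.abs_eq)
  then show ?thesis by (intro ext) (metis abs_bc_surj)
qed

lemma pi_rep_eq: "pi_rep \<sigma> = pi_bc"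
  unfolding pi_rep_def 
proof (rule the_equality)
  show "is_pi \<sigma> pi_bc" by (rule is_pi_pi_bc)
  show "\<pi> = pi_bc" if "is_pi \<sigma> \<pi>" for \<pi>
    using that is_pi_pi_bc by (rule is_pi_unique)
qed

end

section \<open>Passage to the quotient algebra, linearity\<close>

context unit_embedding
begin

lemma pi_bc_hom:
  "pi_bc (a + b) v = pi_bc a v + pi_bc b v" "pi_bc (a * b) v = pi_bc a (pi_bc b v)"
  "pi_bc 1 v = v" "pi_bc 0 v = 0" "pi_bc (- a) v = - pi_bc a v" "pi_bc (a - b) v = pi_bc a v - pi_bc b v"
  "pi_bc a (v + w) = pi_bc a v + pi_bc a w" "pi_bc a 0 = 0"
proof -
  note r = is_rep_pi_bc
  show add: "pi_bc (a + b) v = pi_bc a v + pi_bc b v" for a b by (simp only: is_rep_D(5)[OF r])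
  show "pi_bc (a * b) v = pi_bc a (pi_bc b v)" by (simp only: is_rep_D(6)[OF r] o_apply)
  show "pi_bc 1 v = v" by (simp only: is_rep_D(4)[OF r] id_apply)
  show "pi_bc 0 v = 0" by (simp only: is_rep_zero[OF r])
  show uminus: "pi_bc (- a) v = - pi_bc a v" for a by (simp only: is_rep_uminus[OF r])
  show "pi_bc (a - b) v = pi_bc a v - pi_bc b v" by (simp only: minus_bc_def add uminus diff_conv_add_uminus)
  show "pi_bc a (v + w) = pi_bc a v + pi_bc a w" by (rule is_rep_D(1)[OF r])
  show "pi_bc a 0 = 0" by (rule additive.zero[OF is_rep_D(3)[OF r]])
qed

lemma opG_p_torsion: "qz_scale (CARD('p) ^ k) \<gamma> = 0 \<Longrightarrow> opG (ee \<gamma>) v = v"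
  by (simp add: opG_def ee_def weight_single chi_def sigma_inv_p_torsion)

lemma pi_bc_ideal: "a \<in> bc_ideal CARD('p) \<Longrightarrow> pi_bc a v = 0"
proof (induction arbitrary: v rule: bc_ideal.induct)
  case (1 k)
  have "qz_scale (CARD('p) ^ k) (abs_qz (1 / of_nat (CARD('p) ^ k))) = 0"
    by (simp add: qz_scale.abs_eq qz_eq_0_iff)
  then show ?case by (simp add: pi_bc_hom pi_bc_simps opG_p_torsion)
qed (simp_all add: pi_bc_hom)

lemma pi_rep_p_class:
  assumes "a \<in> bc_subalgebra CARD('p)"
  shows "pi_rep_p \<sigma> (bc_p_class a) = pi_bc a"
  using pi_bc_ideal[OF bc_p_rep_class[OF assms]]
  by (simp add: pi_rep_p_def pi_rep_eq pi_bc_hom fun_eq_iff)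

lemma is_rep_pi_rep_p: "is_rep (pi_rep_p \<sigma>)"
proof -
  note c = bc_p_rep(1) bc_subalgebra_01 bc_subalgebra.intros
  have "Modules.additive (pi_rep_p \<sigma> a)" "continuous_on UNIV (pi_rep_p \<sigma> a)" for a
    by (simp_all add: pi_rep_p_def pi_rep_eq is_rep_D[OF is_rep_pi_bc])
  moreover have "pi_rep_p \<sigma> 1 = id"
    by (simp add: one_bc_p_def pi_rep_p_class c pi_bc_hom fun_eq_iff)
  moreover have "pi_rep_p \<sigma> (a + b) = (\<lambda>v. pi_rep_p \<sigma> a v + pi_rep_p \<sigma> b v)" for a b
    by (simp add: plus_bc_p_def pi_rep_p_class c fun_eq_iff) (simp add: pi_rep_p_def pi_rep_eq pi_bc_hom)
  moreover have "pi_rep_p \<sigma> (a * b) = pi_rep_p \<sigma> a \<circ> pi_rep_p \<sigma> b" for a b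
    by (simp add: times_bc_p_def pi_rep_p_class c fun_eq_iff) (simp add: pi_rep_p_def pi_rep_eq pi_bc_hom)
  ultimately show ?thesis by (simp add: is_rep_def)
qed

lemma pi_bc_O_linear:
  "a \<in> bc_subalgebra CARD('p) \<Longrightarrow> pi_bc a (scaleO c v) = scaleO c (pi_bc a v)"
proof (induction arbitrary: v rule: bc_subalgebra.induct)
  case (1 x)
  show ?case by (simp add: pi_bc_simps opG_def scaleO_def mult_ac)
next
  case (2 n)
  then obtain k :: "'p Ip" where "n = Rep_Ip k" using coprime_num_Ip by blast
  then have n: "numeral n = ival k" by (simp add: ival_def)
  show ?case unfolding pi_bc_simps n opT_ival scaleO_def by (auto simp: fun_eq_iff mult_ac)
next
  case (3 n)
  then obtain k :: "'p Ip" where "n = Rep_Ip k" using coprime_num_Ip by blast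
  then have n: "numeral n = ival k" by (simp add: ival_def)
  show ?case unfolding pi_bc_simps n opS_ival scaleO_def by simp
next
  case (4 a b)
  then show ?case by (simp add: pi_bc_hom) (simp add: scaleO_def fun_eq_iff distrib_left)
next
  case (5 a)
  then show ?case by (simp add: pi_bc_hom) (simp add: scaleO_def fun_eq_iff)
qed (simp add: pi_bc_hom)

lemma linear_rep_pi_rep_p: "linear_rep scaleO (pi_rep_p \<sigma>)"
  unfolding linear_rep_def
proof (intro conjI allI)
  show "is_rep (pi_rep_p \<sigma>)" by (rule is_rep_pi_rep_p)
  show "Modules.module_hom scaleO scaleO (pi_rep_p \<sigma> a)" for a
    by (rule module_hom_scaleOI) (simp_all add: pi_rep_p_def pi_rep_eq pi_bc_hom pi_bc_O_linear bc_p_rep(1))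
qed

text \<open>The operators of \<open>\<mu>~\<^sub>p\<close> and \<open>\<mu>\<^sub>p\<^sup>*\<close> are only Frobenius-semilinear, so the whole algebra commutes with the
  scalars fixed by \<open>Fr\<close>, to which \<open>\<int>\<^sub>p\<close> belongs.\<close>

lemma pi_term_Fr_invariant_linear: "Fr c = c \<Longrightarrow> pi_term t (scaleO c v) = scaleO c (pi_term t v)"
proof (induction t arbitrary: v)
  case (Grp x)
  show ?case by (simp add: opG_def scaleO_def mult_ac)
next
  case (MuT n)
  have "Fr_inv c = c" using MuT by (metis Fr_inv_Fr)
  then have "(Fr_inv ^^ a) c = c" for a by (induction a) simp_all
  then show ?case by (auto simp: opT_def scaleO_def fun_eq_iff rhom.mult[OF rhom_Fr_inv_power] mult_ac)
next
  case (MuS n)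
  have "(Fr ^^ a) c = c" for a using MuS by (induction a) simp_all
  then show ?case by (auto simp: opS_def scaleO_def fun_eq_iff rhom.mult[OF rhom_Fr_power])
next
  case (Plus a b)
  then show ?case by simp (simp add: scaleO_def fun_eq_iff distrib_left)
next
  case (Uminus a)
  then show ?case by simp (simp add: scaleO_def fun_eq_iff)
qed simp

end

lemma rhom_to_ac: "rhom (to_ac :: 'a::field \<Rightarrow> _)"
  by standard simp_all

lemmas rhom_Zp = rhom_witt_map[OF rhom_to_ac]

lemma scaleZp_eq: "scaleZp c v = scaleO (witt_map to_ac c) v"
  by (simp add: scaleZp_def scaleO_def)

lemma module_scaleZp: "Modules.module (scaleZp :: 'p::prime_card Zp \<Rightarrow> _)"
  by standard (auto simp: scaleZp_def fun_eq_iff algebra_simps rhom.add[OF rhom_Zp] rhom.mult[OF rhom_Zp] rhom.one[OF rhom_Zp])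

lemma Fr_Zp: "Fr (witt_map to_ac c) = witt_map to_ac (c :: 'p::prime_card Zp)"
  by (rule witt_eqI) (simp add: Fr_def mod_ring_frobenius flip: to_ac_power)

lemma (in unit_embedding) linear_rep_pi_rep: "linear_rep scaleZp (pi_rep \<sigma>)"
  unfolding linear_rep_def module_hom_iff pi_rep_eq
proof (intro conjI allI)
  show "is_rep pi_bc" by (rule is_rep_pi_bc)
  show "pi_bc a (scaleZp c v) = scaleZp c (pi_bc a v)" for a c v
    unfolding pi_bc_def scaleZp_eq by (rule pi_term_Fr_invariant_linear[OF Fr_Zp])
qed (simp_all add: module_scaleZp pi_bc_hom)

section \<open>Direct sum decompositions and idempotents\<close>

text \<open>The projections of a decomposition are determined by the summands; by uniqueness they are additive,
  idempotent and commute with the action.\<close>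

lemma indecomposableI:
  fixes \<pi> :: "'h::ring_1 \<Rightarrow> 'v::{ab_group_add, topological_space} \<Rightarrow> 'v"
    and smul :: "'c::comm_ring_1 \<Rightarrow> 'v \<Rightarrow> 'v"
  assumes m: "Modules.module smul" and rep: "is_rep \<pi>"
    and idem: "\<And>P. Modules.additive P \<Longrightarrow> continuous_on UNIV P \<Longrightarrow> (\<And>v. P (P v) = P v) \<Longrightarrow>
      (\<And>a v. P (\<pi> a v) = \<pi> a (P v)) \<Longrightarrow> P = (\<lambda>v. 0) \<or> P = (\<lambda>v. v)"
  shows "indecomposable smul \<pi>"
  unfolding indecomposable_def
proof (intro notI, elim exE conjE)
  fix V W assume V: "subrep smul \<pi> V" and W: "subrep smul \<pi> W" and VW0: "V \<noteq> {0}" "W \<noteq> {0}"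
    and sum: "top_direct_sum V W"
  have diff: "x - y \<in> U" if "subrep smul \<pi> U" "x \<in> U" "y \<in> U" for U x y
    using that module.subspace_diff[OF m] by (auto simp: subrep_def)
  have add: "x + y \<in> U" if "subrep smul \<pi> U" "x \<in> U" "y \<in> U" for U x y
    using that module.subspace_add[OF m] by (auto simp: subrep_def)
  have act: "\<pi> a x \<in> U" if "subrep smul \<pi> U" "x \<in> U" for U x a
    using that by (auto simp: subrep_def)
  obtain P Q where PQ: "continuous_on UNIV P" "\<And>v. P v \<in> V" "\<And>v. Q v \<in> W" "\<And>v. v = P v + Q v"
    and VW: "V \<inter> W = {0}"
    using sum by (auto simp: top_direct_sum_def)
  have unique: "P v = x" if "x \<in> V" "y \<in> W" "v = x + y" for v x y
  proof -
    have "P v - x = y - Q v" using that(3) PQ(4)[of v] by (simp add: algebra_simps)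
    then have "P v - x \<in> V \<inter> W" using diff[OF V PQ(2)[of v] that(1)] diff[OF W that(2) PQ(3)[of v]] by simp
    then show ?thesis using VW by simp
  qed
  have P_add: "P (v + w) = P v + P w" for v w
  proof (rule unique)
    show "P v + P w \<in> V" "Q v + Q w \<in> W" using add V W PQ by auto
    show "v + w = P v + P w + (Q v + Q w)" using PQ(4)[of v] PQ(4)[of w] by (metis add.assoc add.left_commute)
  qed
  have "P = (\<lambda>v. 0) \<or> P = (\<lambda>v. v)"
  proof (rule idem)
    show "Modules.additive P" by (rule additive.intro) (rule P_add)
    show "P (P v) = P v" for v
      by (rule unique[of _ 0]) (use PQ(2) VW in auto)
    show "P (\<pi> a v) = \<pi> a (P v)" for a v
    proof (rule unique)
      show "\<pi> a (P v) \<in> V" "\<pi> a (Q v) \<in> W" using act V W PQ by auto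
      show "\<pi> a v = \<pi> a (P v) + \<pi> a (Q v)" using PQ(4)[of v] is_rep_D(1)[OF rep] by metis
    qed
  qed (rule PQ(1))
  then show False
  proof
    assume "P = (\<lambda>v. 0)"
    then have "v \<in> W" for v using PQ(3,4)[of v] by simp
    then show False using VW VW0(1) by blast
  next
    assume "P = (\<lambda>v. v)"
    then have "v \<in> V" for v using PQ(2)[of v] by simp
    then show False using VW VW0(2) by blast
  qed
qed

section \<open>Additive maps which are semilinear for Teichmueller representatives\<close>

text \<open>By induction on the exponent, from \<open>f x = \<tau>(\<alpha>(x\<^sub>0)) f 1 + p f y\<close> for \<open>x = \<tau>(x\<^sub>0) + p y\<close>.\<close>

lemma teichmueller_twist_divisible:
  fixes f :: "'p::prime_card ring_O \<Rightarrow> 'p ring_O"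
  assumes f: "Modules.additive f" "\<And>x. f (teichmueller x) = teichmueller (\<alpha> x) * f 1"
    and "of_nat CARD('p) ^ i dvd f 1"
  shows "of_nat CARD('p) ^ i dvd f x"
proof -
  have "of_nat CARD('p) ^ j dvd f x" if "j \<le> i" for j x
    using that
  proof (induction j arbitrary: x)
    case (Suc j)
    obtain y where "x = teichmueller (wcoord x 0) + of_nat CARD('p) * y" using ring_O_decomp by blast
    then have "f x = teichmueller (\<alpha> (wcoord x 0)) * f 1 + of_nat CARD('p) * f y"
      by (metis additive.add[OF f(1)] additive_of_nat_mult[OF f(1)] f(2))
    moreover have "of_nat CARD('p) ^ Suc j dvd f 1"
      using Suc.prems assms(3) by (meson dvd_trans le_imp_power_dvd)
    moreover have "of_nat CARD('p) ^ Suc j dvd of_nat CARD('p) * f y"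
      using Suc by (simp add: mult_dvd_mono)
    ultimately show ?case by simp
  qed simp
  then show ?thesis by simp
qed

text \<open>Let \<open>f 1 = p\<^sup>i u\<close> with \<open>u\<close> not divisible by \<open>p\<close>. All values of \<open>f\<close> are divisible by \<open>p\<^sup>i\<close>. Apply \<open>f\<close> to
  \<open>\<tau>(x) + \<tau>(y) - \<tau>(x + y)\<close>, a multiple of \<open>p\<close>, cancel \<open>p\<^sup>i\<close> and read the result modulo \<open>p\<close>.\<close>

lemma teichmueller_twist_additive:
  fixes f :: "'p::prime_card ring_O \<Rightarrow> 'p ring_O"
  assumes f: "Modules.additive f" "\<And>x. f (teichmueller x) = teichmueller (\<alpha> x) * f 1"
    and nz: "f 1 \<noteq> 0"
  shows "\<alpha> (x + y) = \<alpha> x + \<alpha> y"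
proof -
  let ?p = "of_nat CARD('p) :: 'p ring_O"
  obtain i u where u: "f 1 = ?p ^ i * u" "wcoord u 0 \<noteq> 0" using ring_O_unit_part[OF nz] by blast
  have "wcoord (teichmueller x + teichmueller y - teichmueller (x + y) :: 'p ring_O) 0 = 0"
    by (simp add: rhom.add[OF rhom_wcoord_0] rhom.diff[OF rhom_wcoord_0] wcoord_teichmueller)
  then obtain z where z: "teichmueller x + teichmueller y - teichmueller (x + y) = ?p * z"
    by (metis p_dvd_ring_O_iff dvdE)
  have "?p ^ i dvd f z" by (rule teichmueller_twist_divisible[OF f]) (simp add: u)
  then obtain w where w: "f z = ?p ^ i * w" by (elim dvdE)
  have "f (teichmueller x + teichmueller y - teichmueller (x + y)) = ?p * f z"
    unfolding z by (rule additive_of_nat_mult[OF f(1)])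
  then have "?p ^ i * ((teichmueller (\<alpha> x) + teichmueller (\<alpha> y) - teichmueller (\<alpha> (x + y))) * u - ?p * w) = 0"
    by (simp add: additive.add[OF f(1)] additive.diff[OF f(1)] f(2)[of x] f(2)[of y] f(2)[of "x + y"] u(1) w algebra_simps)
  then have "(teichmueller (\<alpha> x) + teichmueller (\<alpha> y) - teichmueller (\<alpha> (x + y))) * u = ?p * w"
    using p_power_torsion_free_ring_O by fastforce
  then have "wcoord ((teichmueller (\<alpha> x) + teichmueller (\<alpha> y) - teichmueller (\<alpha> (x + y))) * u) 0 = 0"
    by simp
  then have "(\<alpha> x + \<alpha> y - \<alpha> (x + y)) * wcoord u 0 = 0"
    by (simp add: rhom.mult[OF rhom_wcoord_0] rhom.add[OF rhom_wcoord_0] rhom.diff[OF rhom_wcoord_0] wcoord_teichmueller)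
  then show ?thesis using u(2) by simp
qed

lemma rhom_field_inj:
  assumes "rhom (h :: 'a::field \<Rightarrow> 'b::field)"
  shows "inj h"
proof (rule injI)
  fix x y assume "h x = h y"
  then have "h (x - y) = 0" by (simp add: rhom.diff[OF assms])
  moreover have "h (x - y) * h (inverse (x - y)) = 1" if "x \<noteq> y"
    using that by (simp add: rhom.one[OF assms] flip: rhom.mult[OF assms])
  ultimately show "x = y" by auto
qed

section \<open>Intertwiners\<close>

text \<open>Intertwiners are taken to be additive, which covers the \<open>O\<close>-linear and the \<open>\<int>\<^sub>p\<close>-linear ones at
  once.\<close>

locale intertwiner = s: unit_embedding \<sigma> + s': unit_embedding \<sigma>'
  for \<sigma> \<sigma>' :: "'p::prime_card Fpbar \<Rightarrow> qz" +
  fixes T :: "'p O_Ip \<Rightarrow> 'p O_Ip"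
  assumes additive: "Modules.additive T" and continuous: "continuous_on UNIV T"
    and opG: "\<And>x v. T (s.opG x v) = s'.opG x (T v)"
    and opT: "\<And>n v. T (opT (ival (n :: 'p Ip)) v) = opT (ival n) (T v)"
begin

definition theta :: "'p Fpbar \<Rightarrow> 'p Fpbar" where
  "theta x = (if x = 0 then 0 else s'.sigma_inv (\<sigma> x))"

lemma sigma'_theta:
  assumes "x \<noteq> 0"
  shows "\<sigma>' (theta x) = \<sigma> x"
proof -
  obtain z where z: "z \<noteq> 0" "\<sigma>' z = \<sigma> x" using s'.sigma_surj[OF s.sigma_prime_to[OF assms]] by blast
  then show ?thesis using s'.sigma_inv_sigma[OF z(1)] assms by (simp add: theta_def)
qed

lemma theta_eq_0_iff: "theta x = 0 \<longleftrightarrow> x = 0"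
  by (simp add: theta_def s'.sigma_inv_spec)

lemma theta_mult: "theta (x * y) = theta x * theta y"
  by (simp add: theta_def s.sigma_mult s'.sigma_inv_add)

lemma theta_1: "theta 1 = 1"
  by (simp add: theta_def s.sigma_1 s'.sigma_inv_0)

lemma bij_theta: "bij theta"
proof (rule bijI)
  show "inj theta"
  proof (rule injI)
    fix x y assume "theta x = theta y"
    then show "x = y" using sigma'_theta s.sigma_inj theta_eq_0_iff by metis
  qed
  show "surj theta"
    unfolding surj_def
  proof
    fix y
    show "\<exists>x. y = theta x"
    proof (cases "y = 0")
      case False
      obtain x where "x \<noteq> 0" "\<sigma> x = \<sigma>' y" using s.sigma_surj s'.sigma_prime_to[OF False] by metis
      then have "y = theta x" using s'.sigma_inv_sigma[OF False] by (simp add: theta_def)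
      then show ?thesis ..
    qed (auto simp: theta_def)
  qed
qed

text \<open>The matrix coefficients of \<open>T\<close> on the line \<open>O \<epsilon>\<^sub>1\<close>, which generates the finitely supported vectors under the
  \<open>\<mu>~\<^sub>n\<close> up to torsion.\<close>

definition phi :: "'p Ip \<Rightarrow> 'p ring_O \<Rightarrow> 'p ring_O" where
  "phi m c = T (scaleO c (eps (imk 1))) m"

lemma ival_one [simp]: "ival (imk (Suc 0) :: 'p Ip) = 1"
  by (simp add: ival_imk)

lemma phi_additive: "Modules.additive (phi m)"
proof (rule additive.intro)
  show "phi m (c + d) = phi m c + phi m d" for c d
    using additive.add[OF additive] by (simp add: phi_def scaleO_def distrib_right plus_fun_def)
qed

lemma phi_teichmueller: "phi m (teichmueller x * c) = teichmueller (theta x ^ ival m) * phi m c"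
proof (cases "x = 0")
  case True
  then show ?thesis by (simp add: theta_def additive.zero[OF phi_additive] power_0_left)
next
  case False
  have 1: "s.opG (ee (\<sigma> x)) (scaleO c (eps (imk 1))) = scaleO (teichmueller x * c) (eps (imk 1))"
    using False
    by (auto simp: s.opG_def ee_def s.weight_single s.chi_def s.sigma_inv_sigma scaleO_def eps_def fun_eq_iff)
  show ?thesis unfolding phi_def 1[symmetric] opG using False
    by (simp add: s'.opG_def ee_def s'.weight_single s'.chi_def theta_def teichmueller_power)
qed

lemma phi_teichmueller_1: "phi m (teichmueller x) = teichmueller (theta x ^ ival m) * phi m 1"
  using phi_teichmueller[of m x 1] by simp

lemma phi_eq_0: "phi m 1 = 0 \<Longrightarrow> phi m c = 0"
  by (rule additive_ring_O_eq_0[OF phi_additive]) (simp add: phi_teichmueller_1)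

lemma theta_power_additive:
  assumes "phi m 1 \<noteq> 0"
  shows "theta (x + y) ^ ival m = theta x ^ ival m + theta y ^ ival m"
  using teichmueller_twist_additive[OF phi_additive phi_teichmueller_1 assms] .

text \<open>Otherwise \<open>x \<mapsto> \<theta>(x)\<^sup>m\<close> would be an injective field endomorphism, but it maps
  \<open>\<theta>\<^sup>-\<^sup>1\<close> of a non-trivial \<open>m\<close>-th root of unity to \<open>1\<close>.\<close>

lemma phi_off_diagonal:
  assumes "m \<noteq> imk 1"
  shows "phi m c = 0"
proof (rule ccontr)
  assume "phi m c \<noteq> 0"
  then have nz: "phi m 1 \<noteq> 0" using phi_eq_0 by blast
  have "rhom (\<lambda>x. theta x ^ ival m)"
    by standard (simp_all add: theta_power_additive[OF nz] theta_mult theta_1 power_mult_distrib)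
  note inj = rhom_field_inj[OF this]
  have "ival m \<noteq> 1" using assms by (metis ival_inject ival_one One_nat_def)
  have card: "card {x :: 'p Fpbar. x ^ ival m = 1} = ival m"
    by (rule card_roots_of_unity_Fpbar[OF ival_pos(1) coprime_ival])
  have "{x :: 'p Fpbar. x ^ ival m = 1} \<noteq> {1}" using card \<open>ival m \<noteq> 1\<close> by auto
  then obtain x :: "'p Fpbar" where x: "x ^ ival m = 1" "x \<noteq> 1" by fastforce
  obtain y where y: "x = theta y" using bij_theta by (metis bij_pointE)
  have "theta y ^ ival m = theta 1 ^ ival m" using x y by (simp add: theta_1)
  then have "y = 1" using inj by (auto dest: injD)
  then show False using x y theta_1 by simp
qed

lemma intertwiner_line: "T (scaleO c (eps (imk 1))) = scaleO (phi (imk 1) c) (eps (imk 1))"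
proof
  show "T (scaleO c (eps (imk 1))) m = scaleO (phi (imk 1) c) (eps (imk 1)) m" for m
    using phi_off_diagonal[of m c] by (auto simp: phi_def scaleO_def eps_def)
qed

text \<open>Commutation with \<open>\<mu>~\<^sub>n\<close> and \<open>\<mu>~\<^sub>n(c \<epsilon>\<^sub>1) = n c \<epsilon>\<^sub>n\<close> determine \<open>T\<close> on all \<open>c \<epsilon>\<^sub>n\<close> by its restriction to
  \<open>O \<epsilon>\<^sub>1\<close>.\<close>

lemma intertwiner_line_determines: 
  "of_nat (ival n) * T (scaleO c (eps n)) m = opT (ival n) (T (scaleO c (eps (imk 1)))) m"
proof -
  have n1: "n * imk 1 = n" by (simp add: ival_times flip: ival_inject)
  have "opT (ival n) (T (scaleO c (eps (imk 1)))) = T (scaleO (of_nat (ival n) * c) (eps n))"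
    by (simp only: opT[symmetric] opT_eps n1)
  also have "\<dots> = T (\<lambda>k. of_nat (ival n) * scaleO c (eps n) k)"
    by (simp add: scaleO_def mult.assoc)
  \<comment> \<open>An integer factor passes through \<open>T\<close> as a repeated sum.\<close>
  also have "(\<lambda>k. of_nat (ival n) * scaleO c (eps n) k) = (\<Sum>i<ival n. scaleO c (eps n))"
    by (induction "ival n") (simp_all add: fun_eq_iff distrib_right)
  also have "T \<dots> = (\<Sum>i<ival n. T (scaleO c (eps n)))"
    by (rule additive.sum[OF additive])
  finally have *: "opT (ival n) (T (scaleO c (eps (imk 1)))) = (\<Sum>i<ival n. T (scaleO c (eps n)))" .
  show ?thesis unfolding * by simp
qed

lemma intertwiner_eq_0: "phi (imk 1) 1 = 0 \<Longrightarrow> T = (\<lambda>v. 0)"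
proof (rule continuous_additive_eqI[OF additive continuous])
  fix n c assume "phi (imk 1) 1 = 0"
  then have "T (scaleO c (eps (imk 1))) = 0"
    unfolding intertwiner_line using phi_eq_0 by (simp add: scaleO_def fun_eq_iff)
  then have "of_nat (ival n) * T (scaleO c (eps n)) m = 0" for m
    unfolding intertwiner_line_determines by (simp add: opT_def rhom.zero[OF rhom_Fr_inv_power])
  then show "T (scaleO c (eps n)) = 0"
    by (simp add: fun_eq_iff ring_O_mult_eq_0_iff of_nat_ring_O_neq_0)
qed (auto intro: additive.intro)

lemma field_aut_theta:
  assumes "T v \<noteq> 0"
  shows "field_aut theta"
proof -
  have "phi (imk 1) 1 \<noteq> 0" using assms intertwiner_eq_0 by metis
  from theta_power_additive[OF this] show ?thesis
    by (simp add: field_aut_def bij_theta theta_mult)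
qed

lemma phi_id:
  assumes "\<sigma> = \<sigma>'"
  shows "phi (imk 1) c = c * phi (imk 1) 1"
proof -
  have "theta x = x" for x
    unfolding theta_def using s'.sigma_inv_sigma[of x] by (simp add: assms)
  then have "phi (imk 1) (teichmueller x) - teichmueller x * phi (imk 1) 1 = 0" for x
    by (simp add: phi_teichmueller_1)
  moreover have "Modules.additive (\<lambda>c. phi (imk 1) c - c * phi (imk 1) 1)"
    by (rule additive.intro) (simp add: additive.add[OF phi_additive] algebra_simps)
  ultimately have "phi (imk 1) c - c * phi (imk 1) 1 = 0" using additive_ring_O_eq_0 by blast
  then show ?thesis by simp
qed

lemma idempotent_trivial:
  assumes "\<sigma> = \<sigma>'" "\<And>v. T (T v) = T v"
  shows "T = (\<lambda>v. 0) \<or> T = (\<lambda>v. v)"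
proof -
  let ?e = "phi (imk 1) 1"
  have line: "T (scaleO c (eps (imk 1))) = scaleO (c * ?e) (eps (imk 1))" for c
    by (subst intertwiner_line, subst phi_id[OF assms(1)]) (rule refl)
  have "scaleO (1 * ?e * ?e) (eps (imk 1)) = scaleO (1 * ?e) (eps (imk 1))"
    using assms(2)[of "scaleO 1 (eps (imk 1))"] by (simp only: line)
  then have "?e * ?e = ?e" by (simp add: scaleO_def eps_def fun_eq_iff split: if_splits)
  then have "?e * (?e - 1) = 0" by (simp add: algebra_simps)
  then consider "?e = 0" | "?e = 1" by (auto simp: ring_O_mult_eq_0_iff)
  then show ?thesis
  proof cases
    case 1
    then show ?thesis using intertwiner_eq_0 by blast
  next
    case 2
    have "T = (\<lambda>v. v)"
    proof (rule continuous_additive_eqI[OF additive continuous])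
      fix n :: "'p Ip" and c
      have n1: "n * imk 1 = n" by (simp add: ival_times flip: ival_inject)
      have "of_nat (ival n) * T (scaleO c (eps n)) m = of_nat (ival n) * scaleO c (eps n) m" for m
        unfolding intertwiner_line_determines line 2 opT_eps n1 by (simp add: scaleO_def mult.assoc)
      then have "of_nat (ival n) * (T (scaleO c (eps n)) m - scaleO c (eps n) m) = 0" for m
        by (simp add: right_diff_distrib)
      then show "T (scaleO c (eps n)) = scaleO c (eps n)"
        by (simp add: fun_eq_iff ring_O_mult_eq_0_iff of_nat_ring_O_neq_0)
    qed (auto intro: additive.intro)
    then show ?thesis ..
  qed
qed

end

lemma intertwinerI:
  assumes "inj_unit_hom \<sigma>" "inj_unit_hom \<sigma>'" "Modules.additive T" "continuous_on UNIV T"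
    "\<And>a v. a \<in> bc_subalgebra CARD('p::prime_card) \<Longrightarrow> T (unit_embedding.pi_bc \<sigma> a v) = unit_embedding.pi_bc \<sigma>' a (T v)"
  shows "intertwiner \<sigma> \<sigma>' (T :: 'p O_Ip \<Rightarrow> _)"
proof -
  interpret s: unit_embedding \<sigma> by standard fact
  interpret s': unit_embedding \<sigma>' by standard fact
  show ?thesis
  proof
    show "T (s.opG x v) = s'.opG x (T v)" for x v
      using assms(5)[OF bc_subalgebra.intros(1)] by (simp add: s.pi_bc_simps s'.pi_bc_simps)
    show "T (opT (ival n) v) = opT (ival n) (T v)" for n :: "'p Ip" and v
      using assms(5)[OF bc_subalgebra.intros(2), of "Rep_Ip n"] coprime_ival[of n]
      by (simp add: s.pi_bc_simps s'.pi_bc_simps ival_def)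
  qed (rule additive.add[OF assms(3)], rule assms(4))
qed


section \<open>Galois twists\<close>

lemma field_aut_rhom:
  assumes "field_aut (\<alpha> :: 'k::field \<Rightarrow> 'k)"
  shows "rhom \<alpha>"
proof
  show "\<alpha> (x + y) = \<alpha> x + \<alpha> y" "\<alpha> (x * y) = \<alpha> x * \<alpha> y" for x y using assms by (auto simp: field_aut_def)
  obtain y where y: "\<alpha> y = 1" using assms by (metis field_aut_def bij_pointE)
  have "\<alpha> y = \<alpha> (1 * y)" by simp
  also have "\<dots> = \<alpha> 1 * \<alpha> y" using assms by (simp only: field_aut_def)
  finally show "\<alpha> 1 = 1" by (simp add: y)
qed

lemma field_aut_inv:
  assumes "field_aut (\<alpha> :: 'k::field \<Rightarrow> 'k)"
  shows "field_aut (inv_into UNIV \<alpha>)"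
proof -
  have b: "bij \<alpha>" using assms by (simp add: field_aut_def)
  note [simp] = inv_into_f_f[OF bij_is_inj[OF b] UNIV_I] surj_f_inv_f[OF bij_is_surj[OF b]]
  have "inv_into UNIV \<alpha> x = y \<longleftrightarrow> x = \<alpha> y" for x y by auto
  then show ?thesis using assms bij_imp_bij_inv[OF b] by (auto simp: field_aut_def)
qed

definition galois_map :: "('p::prime_card Fpbar \<Rightarrow> 'p Fpbar) \<Rightarrow> 'p O_Ip \<Rightarrow> 'p O_Ip" where
  "galois_map \<beta> v = (\<lambda>m. witt_map \<beta> (v m))"

lemma continuous_galois_map:
  assumes "rhom \<beta>"
  shows "continuous_on UNIV (galois_map \<beta>)"
proof (rule continuous_p_adic_map)
  note h = rhom_witt_map[OF assms]
  show "Modules.additive (galois_map \<beta>)"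
    by (rule additive.intro) (simp add: galois_map_def rhom.add[OF h] fun_eq_iff)
  show "p_adic_map (galois_map \<beta>)"
    unfolding p_adic_map_def
  proof (intro allI)
    show "\<exists>A. finite A \<and> (\<forall>x. (\<forall>i\<in>A. of_nat CARD('a) ^ k dvd x i) \<longrightarrow> of_nat CARD('a) ^ k dvd galois_map \<beta> x m)" for m k
      by (intro exI[of _ "{m}"]) (simp add: galois_map_def rhom.dvd_of_nat_power[OF h])
  qed
qed

lemma rhom_commutes_Fr:
  assumes "rhom \<beta>"
  shows "witt_map \<beta> ((Fr ^^ a) x) = (Fr ^^ a) (witt_map \<beta> x)"
    and "witt_map \<beta> ((Fr_inv ^^ a) x) = (Fr_inv ^^ a) (witt_map \<beta> x)"
proof -
  have *: "witt_map \<beta> (Fr x) = Fr (witt_map \<beta> x)" for x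
    by (rule witt_eqI) (simp add: Fr_def rhom.power[OF assms])
  have **: "witt_map \<beta> (Fr_inv x) = Fr_inv (witt_map \<beta> x)" for x
    by (rule Fr_eq_iff[THEN iffD1]) (simp flip: *)
  show "witt_map \<beta> ((Fr ^^ a) x) = (Fr ^^ a) (witt_map \<beta> x)" by (induction a) (simp_all add: *)
  show "witt_map \<beta> ((Fr_inv ^^ a) x) = (Fr_inv ^^ a) (witt_map \<beta> x)" by (induction a) (simp_all add: **)
qed

text \<open>The condition \<open>\<sigma>' \<circ> \<beta> = \<sigma>\<close> makes the functorial map induced by \<open>\<beta>\<close> carry the character of \<open>\<sigma>\<close> to that of
  \<open>\<sigma>'\<close>, and it commutes with Frobenius.\<close>

lemma galois_map_intertwines:
  fixes \<sigma> \<sigma>' :: "'p::prime_card Fpbar \<Rightarrow> qz"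
  assumes \<sigma>: "inj_unit_hom \<sigma>" and \<sigma>': "inj_unit_hom \<sigma>'" and \<beta>: "rhom \<beta>" "\<And>x. x \<noteq> 0 \<Longrightarrow> \<beta> x \<noteq> 0"
    and eq: "\<And>x. x \<noteq> 0 \<Longrightarrow> \<sigma>' (\<beta> x) = \<sigma> x"
  shows "galois_map \<beta> (unit_embedding.pi_bc \<sigma> a v) = unit_embedding.pi_bc \<sigma>' a (galois_map \<beta> v)"
proof -
  interpret s: unit_embedding \<sigma> by standard fact
  interpret s': unit_embedding \<sigma>' by standard fact
  note h = rhom_witt_map[OF \<beta>(1)]
  have "\<beta> (s.sigma_inv \<gamma>) = s'.sigma_inv \<gamma>" for \<gamma>
  proof -
    obtain k where "qz_scale (CARD('p) ^ k) (\<sigma> (s.sigma_inv \<gamma>)) = qz_scale (CARD('p) ^ k) \<gamma>"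
      using s.sigma_inv_spec(2) by blast
    then have "s'.sigma_inv \<gamma> = \<beta> (s.sigma_inv \<gamma>)"
      by (intro s'.sigma_inv_eqI[of _ k]) (simp_all add: \<beta>(2) eq s.sigma_inv_spec(1))
    then show ?thesis ..
  qed
  then have "witt_map \<beta> (s.chi \<gamma>) = s'.chi \<gamma>" for \<gamma>
    by (simp add: s.chi_def s'.chi_def witt_map_teichmueller rhom.zero[OF \<beta>(1)])
  then have w: "witt_map \<beta> (s.weight m x) = s'.weight m x" for m x
    by (simp add: s.weight_def s'.weight_def rhom.sum[OF h] rhom.mult[OF h] rhom.of_int[OF h] rhom.power[OF h])
  have "galois_map \<beta> (s.pi_term t v) = s'.pi_term t (galois_map \<beta> v)" for t
  proof (induction t arbitrary: v)
    case (Grp x)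
    show ?case by (simp add: galois_map_def s.opG_def s'.opG_def rhom.mult[OF h] w)
  next
    case (MuT n)
    show ?case
      by (auto simp: galois_map_def opT_def rhom.mult[OF h] rhom.of_nat[OF h] rhom.zero[OF h]
          rhom_commutes_Fr[OF \<beta>(1)] fun_eq_iff simp del: of_nat_numeral)
  next
    case (MuS n)
    show ?case by (simp add: galois_map_def opS_def rhom_commutes_Fr[OF \<beta>(1)])
  next
    case (Plus a b)
    then show ?case by (simp add: galois_map_def fun_eq_iff rhom.add[OF h])
  next
    case (Uminus a)
    then show ?case by (simp add: galois_map_def fun_eq_iff rhom.uminus[OF h])
  qed simp
  then show ?thesis by (simp add: s.pi_bc_def s'.pi_bc_def)
qed

lemma rhom_fixes_prime_field:
  assumes "rhom \<beta>"
  shows "\<beta> (to_ac (a :: 'p::prime_card mod_ring)) = to_ac a"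
proof -
  obtain i where "a = of_nat i" using surj_of_nat_mod_ring by blast
  then show ?thesis by (simp add: rhom.of_nat[OF assms])
qed

lemma galois_map_scaleZp:
  assumes "rhom \<beta>"
  shows "galois_map \<beta> (scaleZp c v) = scaleZp c (galois_map \<beta> v)"
proof -
  have "witt_map \<beta> (witt_map to_ac c) = witt_map to_ac c"
    by (rule witt_eqI) (simp add: rhom_fixes_prime_field[OF assms])
  then show ?thesis by (simp add: galois_map_def scaleZp_def rhom.mult[OF rhom_witt_map[OF assms]])
qed

lemma galois_twist_equivalent:
  fixes \<sigma> \<sigma>' :: "'p::prime_card Fpbar \<Rightarrow> qz"
  assumes \<sigma>: "inj_unit_hom \<sigma>" and \<sigma>': "inj_unit_hom \<sigma>'"
    and \<alpha>: "field_aut \<alpha>" "\<And>x. x \<noteq> 0 \<Longrightarrow> \<sigma>' x = \<sigma> (\<alpha> x)"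
  shows "equivalent_reps scaleZp (pi_rep \<sigma>) (pi_rep \<sigma>')"
proof -
  interpret s: unit_embedding \<sigma> by standard fact
  interpret s': unit_embedding \<sigma>' by standard fact
  let ?\<beta> = "inv_into UNIV \<alpha>"
  have b: "bij \<alpha>" using \<alpha>(1) by (simp add: field_aut_def)
  note inv = inv_into_f_f[OF bij_is_inj[OF b] UNIV_I] surj_f_inv_f[OF bij_is_surj[OF b]]
  have \<beta>: "rhom ?\<beta>" by (intro field_aut_rhom field_aut_inv \<alpha>)
  have nz: "?\<beta> x \<noteq> 0" if "x \<noteq> 0" for x
    using that inv(2)[of x] rhom.zero[OF field_aut_rhom[OF \<alpha>(1)]] by metis
  have hom: "Modules.module_hom scaleZp scaleZp (galois_map ?\<beta>)"
    unfolding module_hom_iff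
    by (simp add: module_scaleZp galois_map_scaleZp[OF \<beta>])
      (simp add: galois_map_def fun_eq_iff rhom.add[OF rhom_witt_map[OF \<beta>]])
  have homeo: "homeomorphism UNIV UNIV (galois_map ?\<beta>) (galois_map \<alpha> :: 'p O_Ip \<Rightarrow> _)"
  proof (rule homeomorphismI)
    show "galois_map \<alpha> (galois_map ?\<beta> v) = v" "galois_map ?\<beta> (galois_map \<alpha> v) = v" for v :: "'p O_Ip"
      by (auto simp: galois_map_def fun_eq_iff inv intro!: witt_eqI)
  qed (auto intro: continuous_galois_map \<beta> field_aut_rhom \<alpha>)
  have "galois_map ?\<beta> (s.pi_bc a v) = s'.pi_bc a (galois_map ?\<beta> v)" for a v
    by (rule galois_map_intertwines[OF \<sigma> \<sigma>' \<beta>]) (simp_all add: nz \<alpha>(2) inv)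
  then show ?thesis unfolding equivalent_reps_def s.pi_rep_eq s'.pi_rep_eq using hom homeo by blast
qed

lemma equivalent_reps_intertwiner:
  fixes \<sigma> \<sigma>' :: "'p::prime_card Fpbar \<Rightarrow> qz"
  assumes \<sigma>: "inj_unit_hom \<sigma>" and \<sigma>': "inj_unit_hom \<sigma>'"
    and T: "Modules.additive T" "homeomorphism UNIV UNIV T T'"
    and comm: "\<And>a v. a \<in> bc_subalgebra CARD('p) \<Longrightarrow>
      T (unit_embedding.pi_bc \<sigma> a v) = unit_embedding.pi_bc \<sigma>' a (T v)"
  shows "intertwiner \<sigma> \<sigma>' (T :: 'p O_Ip \<Rightarrow> _)" "T (eps (imk 1)) \<noteq> 0"
proof -
  show "intertwiner \<sigma> \<sigma>' T"
    using T(2) by (intro intertwinerI[OF \<sigma> \<sigma>' T(1) _ comm]) (auto simp: homeomorphism_def)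
  have "eps (imk 1) (imk 1) \<noteq> (0 :: 'p O_Ip) (imk 1)" by (simp add: eps_def)
  then have "eps (imk 1) \<noteq> (0 :: 'p O_Ip)" by metis
  moreover have "inj T" using T(2) by (metis homeomorphism_def injI UNIV_I)
  ultimately show "T (eps (imk 1)) \<noteq> 0" by (metis additive.zero[OF T(1)] injD)
qed

section \<open>Indecomposability and equivalence\<close>

theorem proposition6p9:
  shows
    "(\<forall>\<sigma> :: 'p::prime_card Fpbar \<Rightarrow> qz. inj_unit_hom \<sigma> \<longrightarrow>
        linear_rep scaleO (pi_rep_p \<sigma>) \<and> indecomposable scaleO (pi_rep_p \<sigma>)) \<and>
     (\<forall>\<sigma> \<sigma>' :: 'p Fpbar \<Rightarrow> qz. inj_unit_hom \<sigma> \<longrightarrow> inj_unit_hom \<sigma>' \<longrightarrow> (\<exists>x. x \<noteq> 0 \<and> \<sigma> x \<noteq> \<sigma>' x) \<longrightarrow>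
        \<not> equivalent_reps scaleO (pi_rep_p \<sigma>) (pi_rep_p \<sigma>')) \<and>
     (\<forall>\<sigma> :: 'p Fpbar \<Rightarrow> qz. inj_unit_hom \<sigma> \<longrightarrow>
        linear_rep scaleZp (pi_rep \<sigma>) \<and> indecomposable scaleZp (pi_rep \<sigma>)) \<and>
     (\<forall>\<sigma> \<sigma>' :: 'p Fpbar \<Rightarrow> qz. inj_unit_hom \<sigma> \<longrightarrow> inj_unit_hom \<sigma>' \<longrightarrow>
        (equivalent_reps scaleZp (pi_rep \<sigma>) (pi_rep \<sigma>') \<longleftrightarrow>
          (\<exists>\<alpha>. field_aut \<alpha> \<and> (\<forall>x. x \<noteq> 0 \<longrightarrow> \<sigma>' x = \<sigma> (\<alpha> x)))))"
proof (intro conjI allI impI)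
  fix \<sigma> :: "'p Fpbar \<Rightarrow> qz" assume \<sigma>: "inj_unit_hom \<sigma>"
  interpret s: unit_embedding \<sigma> by standard fact
  show "linear_rep scaleO (pi_rep_p \<sigma>)" by (rule s.linear_rep_pi_rep_p)
  show "linear_rep scaleZp (pi_rep \<sigma>)" by (rule s.linear_rep_pi_rep)
  have idem: "P = (\<lambda>v. 0) \<or> P = (\<lambda>v. v)"
    if "Modules.additive P" "continuous_on UNIV P" "\<And>v. P (P v) = P v"
      "\<And>a v. a \<in> bc_subalgebra CARD('p) \<Longrightarrow> P (s.pi_bc a v) = s.pi_bc a (P v)" for P
    using intertwiner.idempotent_trivial[OF intertwinerI[OF \<sigma> \<sigma> that(1,2,4)] refl that(3)] .
  show "indecomposable scaleO (pi_rep_p \<sigma>)"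
  proof (rule indecomposableI[OF module_scaleO s.is_rep_pi_rep_p])
    fix P :: "'p O_Ip \<Rightarrow> 'p O_Ip"
    assume P: "Modules.additive P" "continuous_on UNIV P" "\<And>v. P (P v) = P v"
      "\<And>a v. P (pi_rep_p \<sigma> a v) = pi_rep_p \<sigma> a (P v)"
    have "P (s.pi_bc a v) = s.pi_bc a (P v)" if "a \<in> bc_subalgebra CARD('p)" for a v
      using P(4)[of "bc_p_class a"] by (simp add: s.pi_rep_p_class[OF that])
    with P(1-3) show "P = (\<lambda>v. 0) \<or> P = (\<lambda>v. v)" by (rule idem)
  qed
  show "indecomposable scaleZp (pi_rep \<sigma>)"
  proof (rule indecomposableI[OF module_scaleZp])
    show "is_rep (pi_rep \<sigma>)" by (simp add: s.pi_rep_eq s.is_rep_pi_bc)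
    fix P :: "'p O_Ip \<Rightarrow> 'p O_Ip"
    assume P: "Modules.additive P" "continuous_on UNIV P" "\<And>v. P (P v) = P v"
      "\<And>a v. P (pi_rep \<sigma> a v) = pi_rep \<sigma> a (P v)"
    from P(1-3) P(4)[unfolded s.pi_rep_eq] show "P = (\<lambda>v. 0) \<or> P = (\<lambda>v. v)" by (rule idem)
  qed
next
  fix \<sigma> \<sigma>' :: "'p Fpbar \<Rightarrow> qz"
  assume \<sigma>: "inj_unit_hom \<sigma>" and \<sigma>': "inj_unit_hom \<sigma>'" and "\<exists>x. x \<noteq> 0 \<and> \<sigma> x \<noteq> \<sigma>' x"
  then obtain x where x: "x \<noteq> 0" "\<sigma> x \<noteq> \<sigma>' x" by blast
  interpret s: unit_embedding \<sigma> by standard fact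
  interpret s': unit_embedding \<sigma>' by standard fact
  show "\<not> equivalent_reps scaleO (pi_rep_p \<sigma>) (pi_rep_p \<sigma>')"
  proof
    assume "equivalent_reps scaleO (pi_rep_p \<sigma>) (pi_rep_p \<sigma>')"
    then obtain T T' where T: "Modules.module_hom scaleO scaleO T" "homeomorphism UNIV UNIV T T'"
      "\<And>a v. T (pi_rep_p \<sigma> a v) = pi_rep_p \<sigma>' a (T v)" by (auto simp: equivalent_reps_def)
    have T_add: "Modules.additive T"
      using module_hom.add[OF T(1)] by (intro additive.intro)
    have T_comm: "T (s.pi_bc a v) = s'.pi_bc a (T v)" if "a \<in> bc_subalgebra CARD('p)" for a v
      using T(3)[of "bc_p_class a"] by (simp add: s.pi_rep_p_class[OF that] s'.pi_rep_p_class[OF that])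
    interpret intertwiner \<sigma> \<sigma>' T by (rule equivalent_reps_intertwiner(1)[OF \<sigma> \<sigma>' T_add T(2) T_comm])
    have "T (eps (imk 1)) \<noteq> 0" by (rule equivalent_reps_intertwiner(2)[OF \<sigma> \<sigma>' T_add T(2) T_comm])
    then have nz: "phi (imk 1) 1 \<noteq> 0" using intertwiner_eq_0 by metis
    \<comment> \<open>By \<open>O\<close>-linearity; comparison with semilinearity along \<open>theta\<close> forces \<open>theta x = x\<close>.\<close>
    have "phi (imk 1) (teichmueller x) = teichmueller x * phi (imk 1) 1"
      unfolding phi_def
      using module_hom.scale[OF T(1), of "teichmueller x" "scaleO 1 (eps (imk 1))"]
      by (simp add: scaleO_scaleO) (simp add: scaleO_def)
    then have "(teichmueller (theta x) - teichmueller x) * phi (imk 1) 1 = 0"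
      by (simp add: phi_teichmueller_1 algebra_simps)
    then have "theta x = x" using nz by (simp add: ring_O_mult_eq_0_iff)
    then show False using sigma'_theta[OF x(1)] x(2) by simp
  qed
next
  fix \<sigma> \<sigma>' :: "'p Fpbar \<Rightarrow> qz" assume \<sigma>: "inj_unit_hom \<sigma>" and \<sigma>': "inj_unit_hom \<sigma>'"
  interpret s: unit_embedding \<sigma> by standard fact
  interpret s': unit_embedding \<sigma>' by standard fact
  show "equivalent_reps scaleZp (pi_rep \<sigma>) (pi_rep \<sigma>') \<longleftrightarrow>
          (\<exists>\<alpha>. field_aut \<alpha> \<and> (\<forall>x. x \<noteq> 0 \<longrightarrow> \<sigma>' x = \<sigma> (\<alpha> x)))"
  proof
    assume "equivalent_reps scaleZp (pi_rep \<sigma>) (pi_rep \<sigma>')"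
    then obtain T T' where T: "Modules.module_hom scaleZp scaleZp T" "homeomorphism UNIV UNIV T T'"
      "\<And>a v. T (s.pi_bc a v) = s'.pi_bc a (T v)" by (auto simp: equivalent_reps_def s.pi_rep_eq s'.pi_rep_eq)
    have T_add: "Modules.additive T"
      using module_hom.add[OF T(1)] by (intro additive.intro)
    interpret intertwiner \<sigma> \<sigma>' T by (rule equivalent_reps_intertwiner(1)[OF \<sigma> \<sigma>' T_add T(2,3)])
    have "T (eps (imk 1)) \<noteq> 0" by (rule equivalent_reps_intertwiner(2)[OF \<sigma> \<sigma>' T_add T(2,3)])
    then have aut: "field_aut theta" by (rule field_aut_theta)
    let ?\<alpha> = "inv_into UNIV theta"
    have "\<sigma>' x = \<sigma> (?\<alpha> x)" if "x \<noteq> 0" for x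
    proof -
      have "theta (?\<alpha> x) = x" by (rule surj_f_inv_f[OF bij_is_surj[OF bij_theta]])
      then show ?thesis using sigma'_theta[of "?\<alpha> x"] theta_eq_0_iff[of "?\<alpha> x"] that by auto
    qed
    then show "\<exists>\<alpha>. field_aut \<alpha> \<and> (\<forall>x. x \<noteq> 0 \<longrightarrow> \<sigma>' x = \<sigma> (\<alpha> x))"
      using field_aut_inv[OF aut] by blast
  next
    assume "\<exists>\<alpha>. field_aut \<alpha> \<and> (\<forall>x. x \<noteq> 0 \<longrightarrow> \<sigma>' x = \<sigma> (\<alpha> x))"
    then show "equivalent_reps scaleZp (pi_rep \<sigma>) (pi_rep \<sigma>')"
      using galois_twist_equivalent[OF \<sigma> \<sigma>'] by blast
  qed
qed

end
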